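(* For any $D$-invariant subspace $W\subset\mathcal U_a$, there exists its residual interval $I_W$, and it equals $[c_{\mathcal J};d_{\mathcal J}]\cap(-a;a)$, where $\mathcal J=\mathcal F(W^0)$.
   Context: Weight. $\omega:[0;\infty)\to[0;\infty)$ is a non-decreasing continuous function such that: $\varphi_\omega(t):=\omega(e^t)$ is convex on $[0;\infty)$; $\omega(x)=o(x)$ and $\ln x=o(\omega(x))$ as $x\to\infty$; for every $\sigma>1$ there is $C>0$ with $\omega(x+y)\le\sigma(\omega(x)+\omega(y))+C$ for all $x,y\ge0$; $\int_1^\infty\omega(x)x^{-2}\,dx<\infty$. Fix $0<a\le+\infty$, a sequence $0<c_k\nearrow a$ such that $\{[-c_k;c_k]\}$ is an increasing sequence of closed intervals exhausting $(-a;a)$, and a sequence $0<r_k\nearrow1$. Ultradifferentiable functions. Put $\varphi_\omega^*(s)=\sup_t(st-\varphi_\omega(t))$ and, for $f\in C^\infty(-a;a)$, $q\in(0;1)$, $k\in\mathbb N$, $\|f\|_{\omega,q,k}=\sup_{j\in\mathbb N_0}\sup_{|x|\le c_k}|f^{(j)}(x)|e^{-q\varphi_\omega^*(j/q)}$. $\mathcal U_a$ is the space of all $f\in C^\infty(-a;a)$ with $\|f\|_{\omega,q,k}<\infty$ for all $q\in(0;1)$, $k\in\mathbb N$, with the locally convex topology given by these semi-norms; $\mathcal U_a'$ is its strong dual. $D=d/dx$. A $D$-invariant subspace is a closed subspace $W\subset\mathcal U_a$ with $D(W)\subset W$. $W^0=\{S\in\mathcal U_a': S(f)=0\ \forall f\in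 W\}$. Residual interval. For an interval $I\subset(-a;a)$ relatively closed in $(-a;a)$ put $W_I=\{f\in\mathcal U_a: f=0\text{ on }I\}$. The residual interval $I_W$ of $W$ is defined by the requirements: $I_W$ is relatively closed in $(-a;a)$, $W_{I_W}\subset W$, and $W_I\setminus W\ne\emptyset$ for every relatively closed interval $I\subsetneq I_W$. Module. $P_k$ is the Banach space of entire functions $\varphi$ with $\|\varphi\|_k=\sup_{z\in\mathbb C}|\varphi(z)|e^{-r_k\omega(|z|)-c_k|\mathrm{Im}\,z|}<\infty$, and $\mathcal P_a$ is the locally convex inductive limit of the $P_k$. The Fourier-Laplace transform $\mathcal F(S)(z)=S(e^{-\mathrm itz})$ is a linear topological isomorphism of $\mathcal U_a'$ onto $\mathcal P_a$, and $\mathcal F(W^0)$ is a closed submodule of $\mathcal P_a$ over $\mathbb C[z]$. For $\varphi\in\mathcal P_a$, $h_\varphi(\theta)=\limsup_{r\to\infty}r^{-1}\ln|\varphi(re^{\mathrm i\theta})|$ is its indicator function. The indicator segment of a closed submodule $\mathcal J\subset\mathcal P_a$ is $[c_{\mathcal J};d_{\mathcal J}]\subset\overline{\mathbb R}$, where $c_{\mathcal J}=-\sup_{\varphi\in\mathcal J}h_\varphi(-\pi/2)$ and $d_{\mathcal J}=\sup_{\varphi\in\mathcal J}h_\varphi(\pi/2)$.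
   Formalization: In W_I, "f = 0 on I" is read as vanishing on I with all derivatives. This differs only when I is a single point {p}, where the literal claim fails: for W = all functions flat at p, [c_J;d_J] = {p}, but x-p vanishes at p and is not in W. *)

theory Defs
  imports "HOL-Analysis.Analysis" "HOL-Library.Landau_Symbols"
begin

text \<open>Only the values of a weight on \<open>[0;\<infty>)\<close> matter.\<close>

definition is_weight :: "(real \<Rightarrow> real) \<Rightarrow> bool" where
  "is_weight \<omega> \<longleftrightarrow>
     (\<forall>x\<ge>0. \<omega> x \<ge> 0) \<and> mono_on {0..} \<omega> \<and> continuous_on {0..} \<omega> \<and>
     convex_on {0..} (\<lambda>t. \<omega> (exp t)) \<and>
     \<omega> \<in> o[at_top](\<lambda>x. x) \<and> ln \<in> o[at_top](\<omega>) \<and>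
     (\<forall>\<sigma>>1. \<exists>C>0. \<forall>x\<ge>0. \<forall>y\<ge>0. \<omega> (x + y) \<le> \<sigma> * (\<omega> x + \<omega> y) + C) \<and>
     set_integrable lborel {1..} (\<lambda>x. \<omega> x / x\<^sup>2)"

text \<open>The supremum is finite for every \<open>s\<close> when \<open>\<omega>\<close> is a weight, because \<open>ln x = o(\<omega>(x))\<close>;
  so the real-valued \<open>Sup\<close> is the true one.\<close>

definition young_conj :: "(real \<Rightarrow> real) \<Rightarrow> real \<Rightarrow> real" where
  "young_conj \<omega> s = (SUP t\<in>{0..}. s * t - \<omega> (exp t))"

definition sym_interval :: "ereal \<Rightarrow> real set" where
  "sym_interval a = {x. - a < ereal x \<and> ereal x < a}"

text \<open>\<open>{[-c\<^sub>k;c\<^sub>k]}\<close> is an increasing exhaustion of \<open>(-a;a)\<close> by compact intervals.\<close>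

definition exhausting :: "ereal \<Rightarrow> (nat \<Rightarrow> real) \<Rightarrow> bool" where
  "exhausting a c \<longleftrightarrow> incseq c \<and> (\<forall>k. 0 < c k \<and> ereal (c k) < a) \<and> (\<lambda>k. ereal (c k)) \<longlonglongrightarrow> a"

text \<open>A complex-valued function on \<open>(-a;a)\<close> is represented by its extension by \<open>0\<close> to the real
  line, so that equality in \<open>real \<Rightarrow> complex\<close> is equality of functions on \<open>(-a;a)\<close>. Accordingly
  the derivative is set to \<open>0\<close> off \<open>(-a;a)\<close>.\<close>

definition D :: "ereal \<Rightarrow> (real \<Rightarrow> complex) \<Rightarrow> real \<Rightarrow> complex" where
  "D a f = (\<lambda>x. if x \<in> sym_interval a then vector_derivative f (at x) else 0)"

definition smooth_fns :: "ereal \<Rightarrow> (real \<Rightarrow> complex) set" where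
  "smooth_fns a = {f. (\<forall>x. x \<notin> sym_interval a \<longrightarrow> f x = 0) \<and>
                      (\<forall>j. \<forall>x\<in>sym_interval a. (D a ^^ j) f differentiable (at x))}"

definition U_norm ::
  "ereal \<Rightarrow> (real \<Rightarrow> real) \<Rightarrow> (nat \<Rightarrow> real) \<Rightarrow> real \<Rightarrow> nat \<Rightarrow> (real \<Rightarrow> complex) \<Rightarrow> ereal" where
  "U_norm a \<omega> c q k f =
     (SUP j. SUP x\<in>{- c k..c k}.
        ereal (norm ((D a ^^ j) f x) * exp (- q * young_conj \<omega> (real j / q))))"

definition U_space ::
  "ereal \<Rightarrow> (real \<Rightarrow> real) \<Rightarrow> (nat \<Rightarrow> real) \<Rightarrow> (real \<Rightarrow> complex) set" where
  "U_space a \<omega> c = {f \<in> smooth_fns a. \<forall>q\<in>{0<..<1}. \<forall>k. U_norm a \<omega> c q k f < \<infinity>}"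

text \<open>The locally convex topology given by the semi-norms: the balls of the individual
  semi-norms form a subbase; the underlying set is \<open>U_space a \<omega> c\<close>.\<close>

definition U_top ::
  "ereal \<Rightarrow> (real \<Rightarrow> real) \<Rightarrow> (nat \<Rightarrow> real) \<Rightarrow> (real \<Rightarrow> complex) topology" where
  "U_top a \<omega> c = topology_generated_by
     {{g \<in> U_space a \<omega> c. U_norm a \<omega> c q k (\<lambda>x. g x - f x) < ereal \<epsilon>} | f q k \<epsilon>.
        f \<in> U_space a \<omega> c \<and> 0 < q \<and> q < 1 \<and> 0 < \<epsilon>}"

text \<open>The underlying set of the dual; functionals are extended by \<open>0\<close> off \<open>U_space a \<omega> c\<close>.\<close>

definition U_dual ::
  "ereal \<Rightarrow> (real \<Rightarrow> real) \<Rightarrow> (nat \<Rightarrow> real) \<Rightarrow> ((real \<Rightarrow> complex) \<Rightarrow> complex) set" where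
  "U_dual a \<omega> c =
     {S. (\<forall>f. f \<notin> U_space a \<omega> c \<longrightarrow> S f = 0) \<and>
         (\<forall>f\<in>U_space a \<omega> c. \<forall>g\<in>U_space a \<omega> c. \<forall>\<alpha> \<beta>.
            S (\<lambda>x. \<alpha> * f x + \<beta> * g x) = \<alpha> * S f + \<beta> * S g) \<and>
         continuous_map (U_top a \<omega> c) euclidean S}"

definition D_invariant_subspace ::
  "ereal \<Rightarrow> (real \<Rightarrow> real) \<Rightarrow> (nat \<Rightarrow> real) \<Rightarrow> (real \<Rightarrow> complex) set \<Rightarrow> bool" where
  "D_invariant_subspace a \<omega> c W \<longleftrightarrow>
     W \<subseteq> U_space a \<omega> c \<and> (\<lambda>x. 0) \<in> W \<and>
     (\<forall>f\<in>W. \<forall>g\<in>W. \<forall>\<alpha> \<beta>. (\<lambda>x. \<alpha> * f x + \<beta> * g x) \<in> W) \<and>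
     closedin (U_top a \<omega> c) W \<and> D a ` W \<subseteq> W"

definition annihilator ::
  "ereal \<Rightarrow> (real \<Rightarrow> real) \<Rightarrow> (nat \<Rightarrow> real) \<Rightarrow> (real \<Rightarrow> complex) set
     \<Rightarrow> ((real \<Rightarrow> complex) \<Rightarrow> complex) set" where
  "annihilator a \<omega> c W = {S \<in> U_dual a \<omega> c. \<forall>f\<in>W. S f = 0}"

text \<open>Relatively closed subintervals of \<open>(-a;a)\<close>. The empty set and single points are included:
  the residual interval of the whole space is empty, and that of the space of all functions
  flat at a point \<open>p\<close> is \<open>{p}\<close>.\<close>

definition rel_closed_interval :: "ereal \<Rightarrow> real set \<Rightarrow> bool" where
  "rel_closed_interval a I \<longleftrightarrow> is_interval I \<and> I \<subseteq> sym_interval a \<and> closedin (top_of_set (sym_interval a)) I"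

text \<open>Vanishing on \<open>I\<close> is understood together with all derivatives. Unless \<open>I\<close> is a single point
  this is the same as \<open>f = 0\<close> on \<open>I\<close>, see \<open>vanishing_space_eq\<close> below. For \<open>I = {p}\<close> the
  derivatives cannot be dropped: the space of all functions flat at \<open>p\<close> is a \<open>D\<close>-invariant
  subspace, and with the bare condition \<open>f p = 0\<close> it would have no residual interval.\<close>

definition vanishing_space ::
  "ereal \<Rightarrow> (real \<Rightarrow> real) \<Rightarrow> (nat \<Rightarrow> real) \<Rightarrow> real set \<Rightarrow> (real \<Rightarrow> complex) set" where
  "vanishing_space a \<omega> c I = {f \<in> U_space a \<omega> c. \<forall>j. \<forall>x\<in>I. (D a ^^ j) f x = 0}"

definition is_residual_interval ::
  "ereal \<Rightarrow> (real \<Rightarrow> real) \<Rightarrow> (nat \<Rightarrow> real) \<Rightarrow> (real \<Rightarrow> complex) set \<Rightarrow> real set \<Rightarrow> bool" where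
  "is_residual_interval a \<omega> c W I \<longleftrightarrow>
     rel_closed_interval a I \<and> vanishing_space a \<omega> c I \<subseteq> W \<and>
     (\<forall>I'. rel_closed_interval a I' \<and> I' \<subset> I \<longrightarrow> vanishing_space a \<omega> c I' - W \<noteq> {})"

definition residual_interval ::
  "ereal \<Rightarrow> (real \<Rightarrow> real) \<Rightarrow> (nat \<Rightarrow> real) \<Rightarrow> (real \<Rightarrow> complex) set \<Rightarrow> real set" where
  "residual_interval a \<omega> c W = (THE I. is_residual_interval a \<omega> c W I)"

definition fourier_laplace ::
  "ereal \<Rightarrow> ((real \<Rightarrow> complex) \<Rightarrow> complex) \<Rightarrow> complex \<Rightarrow> complex" where
  "fourier_laplace a S z = S (\<lambda>t. if t \<in> sym_interval a then exp (- \<i> * of_real t * z) else 0)"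

text \<open>Here \<open>ln 0 = -\<infinity>\<close>, unlike for the real-valued \<open>ln\<close>; so the indicator of the zero function
  is \<open>-\<infinity>\<close>.\<close>

definition indicator_fn :: "(complex \<Rightarrow> complex) \<Rightarrow> real \<Rightarrow> ereal" where
  "indicator_fn \<phi> \<theta> =
     Limsup at_top (\<lambda>r::real.
       if \<phi> (of_real r * cis \<theta>) = 0 then - \<infinity>
       else ereal (ln (norm (\<phi> (of_real r * cis \<theta>))) / r))"

definition seg_left :: "(complex \<Rightarrow> complex) set \<Rightarrow> ereal" where
  "seg_left J = - (SUP \<phi>\<in>J. indicator_fn \<phi> (- pi / 2))"

definition seg_right :: "(complex \<Rightarrow> complex) set \<Rightarrow> ereal" where
  "seg_right J = (SUP \<phi>\<in>J. indicator_fn \<phi> (pi / 2))"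

definition indicator_segment :: "(complex \<Rightarrow> complex) set \<Rightarrow> ereal set" where
  "indicator_segment J = {seg_left J..seg_right J}"

lemma D_pow_zero_on_interval:
  assumes f: "f \<in> smooth_fns a" and I: "is_interval I" "I \<subseteq> sym_interval a" "u \<in> I" "v \<in> I" "u < v"
    and z: "\<forall>x\<in>I. f x = 0"
  shows "\<forall>x\<in>I. (D a ^^ j) f x = 0"
proof (induction j)
  case 0
  show ?case using z by simp
next
  case (Suc j)
  let ?g = "(D a ^^ j) f"
  show ?case
  proof
    fix x assume x: "x \<in> I"
    then have xd: "x \<in> sym_interval a" using I by blast
    have "?g differentiable (at x)" using f xd unfolding smooth_fns_def by blast
    then have "(?g has_vector_derivative vector_derivative ?g (at x)) (at x)"
      by (simp add: vector_derivative_works)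
    then have 1: "(?g has_vector_derivative vector_derivative ?g (at x)) (at x within I)"
      by (rule has_vector_derivative_at_within)
    have 2: "(?g has_vector_derivative 0) (at x within I)"
      by (rule has_vector_derivative_transform[OF x, of _ "\<lambda>_. 0"]) (use Suc in auto)
    have "connected I" using I(1) by (simp add: is_interval_connected)
    then have "x islimpt I"
      by (rule connected_imp_perfect) (use x I in auto)
    then have "at x within I \<noteq> bot" by (simp add: trivial_limit_within)
    then have "vector_derivative ?g (at x) = 0"
      using vector_derivative_unique_within[OF _ 1 2] by blast
    then show "(D a ^^ Suc j) f x = 0" by (simp add: D_def)
  qed
qed

lemma vanishing_space_eq:
  assumes "rel_closed_interval a I" and "\<And>p. I \<noteq> {p}"
  shows "vanishing_space a \<omega> c I = {f \<in> U_space a \<omega> c. \<forall>x\<in>I. f x = 0}"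
proof (cases "I = {}")
  case True
  then show ?thesis by (simp add: vanishing_space_def)
next
  case False
  then obtain u v where uv: "u \<in> I" "v \<in> I" "u < v"
    using assms(2) by (metis is_singletonI' is_singleton_def linorder_neq_iff)
  have "(D a ^^ j) f x = 0" if "f \<in> U_space a \<omega> c" "\<forall>x\<in>I. f x = 0" "x \<in> I" for f j x
    using D_pow_zero_on_interval[of f a I u v j] that uv assms(1)
    unfolding rel_closed_interval_def U_space_def by blast
  moreover have "f x = 0" if "\<forall>j. \<forall>x\<in>I. (D a ^^ j) f x = 0" "x \<in> I" for f x
    using that(1)[rule_format, of x 0] that(2) by simp
  ultimately show ?thesis unfolding vanishing_space_def by blast
qed

end

theory Submission
  imports Defs "HOL-Library.Function_Algebras"
begin

text \<open>
  For \<open>S \<in> U\<^sub>a'\<close> the indicators of \<open>\<phi> = \<F> S\<close> at \<open>\<plusminus> \<pi> / 2\<close> describe the growth of \<open>S (exp (r t))\<close> as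
  \<open>r \<rightarrow> \<plusminus>\<infinity>\<close>, so \<open>[c;d] = [- h\<^sub>\<phi> (- \<pi> / 2); h\<^sub>\<phi> (\<pi> / 2)]\<close> should be the convex hull of the support of \<open>S\<close>.
  The theorem follows from two precise forms of this statement and the Hahn--Banach theorem. The
  arguments are symmetric under reflection, so only the right end is described.

  \<^item> If \<open>h\<^sub>\<phi> (\<pi> / 2) \<le> d\<close> with \<open>d \<in> (-a;a)\<close>, then \<open>S\<close> annihilates every \<open>f\<close> that vanishes on the left of
    \<open>d\<close> (lemma \<open>kills_right\<close>). Up to a small shift of the step to the right, \<open>f\<close> is the limit of the
    convolutions of \<open>f'\<close> with \<open>1 - exp (- exp (n s))\<close>, which tend to those with the Heaviside function.
    The power series of \<open>1 - exp (- z)\<close> writes them as series in the exponentials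
    \<open>exp (k n t)\<close>, \<open>k \<ge> 1\<close>, with coefficients of size \<open>exp (- k n (d + \<delta>)) / k!\<close>, and the values of \<open>S\<close> on
    them sum to a quantity that tends to \<open>0\<close>.
  \<^item> If \<open>S\<close> annihilates every \<open>f\<close> that vanishes on the left of \<open>p\<close>, then \<open>h\<^sub>\<phi> (\<pi> / 2) \<le> p'\<close> for all
    \<open>p' > p\<close> (lemma \<open>growth_le_of_kills\<close>). Here \<open>exp (r t)\<close> is replaced by its product with a cutoff
    function. The space contains cutoff functions because the weight is not quasianalytic: they are
    infinite convolutions of a ramp with normalised indicator functions of intervals of lengths
    proportional to \<open>1 / Y\<^sub>i\<close>, where \<open>\<omega> (Y\<^sub>i) = i + N\<close>, and the sum of the \<open>1 / Y\<^sub>i\<close> is bounded by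
    the integral of \<open>\<omega> x / x\<^sup>2\<close>.

  Let \<open>K\<close> be the intersection of the indicator segment of \<open>\<F> W\<^sup>0\<close> with \<open>(-a;a)\<close>. If \<open>K\<close> is
  empty, then \<open>W\<^sup>0\<close> is zero (\<open>growth_point\<close>) and \<open>W\<close> is the whole space. Otherwise a function flat on
  \<open>K\<close> is the sum of two functions supported on either side of \<open>K\<close>. By the first statement both are
  annihilated by \<open>W\<^sup>0\<close>, hence so is their sum, and it lies in \<open>W\<close> because \<open>W\<close> is closed
  (\<open>vanishing_on_segment\<close>). By the second statement, if \<open>W\<close> contains the functions flat on a
  relatively closed interval \<open>I\<close>, then \<open>K \<subseteq> I\<close> (\<open>segment_subset\<close>). So \<open>K\<close> is the least
  interval with \<open>W\<^sub>I \<subseteq> W\<close>, that is, the residual interval.\<close>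

section \<open>The Hahn--Banach theorem\<close>

text \<open>Subadditive and positively homogeneous functionals.\<close>

definition sublinear :: "('a::real_vector \<Rightarrow> real) \<Rightarrow> bool" where
  "sublinear p \<longleftrightarrow> (\<forall>x y. p (x + y) \<le> p x + p y) \<and> (\<forall>t x. 0 \<le> t \<longrightarrow> p (t *\<^sub>R x) = t * p x)"

lemma sublinear_zero: "sublinear p \<Longrightarrow> p 0 = 0"
  unfolding sublinear_def by (metis mult_zero_left order_refl scaleR_zero_left)

lemma sublinearI:
  assumes add: "\<And>x y. p (x + y) \<le> p x + p y" and zero: "p 0 = 0"
    and scale: "\<And>t x. 0 < t \<Longrightarrow> p (t *\<^sub>R x) \<le> t * p x"
  shows "sublinear p"
proof -
  have "p (t *\<^sub>R x) = t * p x" if "0 \<le> t" for t x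
  proof (cases "t = 0")
    case False
    then have t: "0 < t" using that by simp
    have "p ((1 / t) *\<^sub>R (t *\<^sub>R x)) \<le> (1 / t) * p (t *\<^sub>R x)"
      by (rule scale) (use t in simp)
    then have "t * p x \<le> p (t *\<^sub>R x)" using t by (simp add: field_simps)
    then show ?thesis using scale[OF t, of x] by simp
  qed (simp add: zero)
  then show ?thesis using add by (auto simp: sublinear_def)
qed

lemma sublinear_minus: "sublinear p \<Longrightarrow> - p (- x) \<le> p x"
  using sublinear_zero[of p] unfolding sublinear_def
  by (metis add.right_inverse neg_le_iff_le le_minus_iff minus_le_iff diff_ge_0_iff_ge add.commute
      diff_minus_eq_add)

text \<open>A sublinear minorant of \<open>p\<close> that takes the value \<open>- p y\<close> or less at \<open>- y\<close>. A minimal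
  sublinear functional coincides with all its minorants of this kind, and is therefore linear.\<close>

definition sublinear_red :: "('a::real_vector \<Rightarrow> real) \<Rightarrow> 'a \<Rightarrow> 'a \<Rightarrow> real" where
  "sublinear_red p y x = (INF t\<in>{0..}. p (x + t *\<^sub>R y) - t * p y)"

lemma sublinear_red_bdd:
  assumes "sublinear p"
  shows "bdd_below ((\<lambda>t. p (x + t *\<^sub>R y) - t * p y) ` {0..})"
proof (rule bdd_belowI2)
  fix t :: real assume t: "t \<in> {0..}"
  have "t * p y = p (t *\<^sub>R y)" using assms t by (simp add: sublinear_def)
  also have "\<dots> = p ((x + t *\<^sub>R y) + (- x))" by (simp add: algebra_simps)
  also have "\<dots> \<le> p (x + t *\<^sub>R y) + p (- x)" using assms by (simp only: sublinear_def)
  finally show "- p (- x) \<le> p (x + t *\<^sub>R y) - t * p y" by simp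
qed

lemma sublinear_red_le:
  assumes "sublinear p" "0 \<le> t"
  shows "sublinear_red p y x \<le> p (x + t *\<^sub>R y) - t * p y"
  unfolding sublinear_red_def
  by (rule cINF_lower[OF sublinear_red_bdd[OF assms(1)]]) (use assms(2) in auto)

lemma sublinear_red_sublinear:
  assumes p: "sublinear p"
  shows "sublinear (sublinear_red p y)"
proof -
  have add: "sublinear_red p y (u + v) \<le> sublinear_red p y u + sublinear_red p y v" for u v
  proof -
    have *: "sublinear_red p y (u + v) \<le> (p (u + s *\<^sub>R y) - s * p y) + (p (v + t *\<^sub>R y) - t * p y)"
      if "0 \<le> s" "0 \<le> t" for s t
    proof -
      have "sublinear_red p y (u + v) \<le> p ((u + v) + (s + t) *\<^sub>R y) - (s + t) * p y"
        using that by (intro sublinear_red_le p) auto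
      also have "(u + v) + (s + t) *\<^sub>R y = (u + s *\<^sub>R y) + (v + t *\<^sub>R y)" by (simp add: algebra_simps)
      also have "p \<dots> \<le> p (u + s *\<^sub>R y) + p (v + t *\<^sub>R y)" using p by (simp only: sublinear_def)
      finally show ?thesis by (simp add: algebra_simps)
    qed
    have "sublinear_red p y (u + v) - (p (u + s *\<^sub>R y) - s * p y) \<le> sublinear_red p y v" if "0 \<le> s" for s
      unfolding sublinear_red_def[of p y v]
      by (rule cINF_greatest) (use *[OF that] in \<open>auto simp: algebra_simps\<close>)
    then have "sublinear_red p y (u + v) - sublinear_red p y v \<le> p (u + s *\<^sub>R y) - s * p y" if "0 \<le> s" for s
      using that by (metis diff_le_eq add.commute)
    then have "sublinear_red p y (u + v) - sublinear_red p y v \<le> sublinear_red p y u"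
      unfolding sublinear_red_def[of p y u] by (intro cINF_greatest) auto
    then show ?thesis by simp
  qed
  have sc: "sublinear_red p y (r *\<^sub>R x) \<le> r * sublinear_red p y x" if r: "0 < r" for r x
  proof -
    have "sublinear_red p y (r *\<^sub>R x) / r \<le> p (x + t *\<^sub>R y) - t * p y" if t: "0 \<le> t" for t
    proof -
      have "sublinear_red p y (r *\<^sub>R x) \<le> p (r *\<^sub>R x + (r * t) *\<^sub>R y) - (r * t) * p y"
        using r t by (intro sublinear_red_le p) auto
      also have "r *\<^sub>R x + (r * t) *\<^sub>R y = r *\<^sub>R (x + t *\<^sub>R y)" by (simp add: algebra_simps)
      also have "p \<dots> = r * p (x + t *\<^sub>R y)" using p r by (simp add: sublinear_def)
      finally show ?thesis using r by (simp add: field_simps)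
    qed
    then have "sublinear_red p y (r *\<^sub>R x) / r \<le> sublinear_red p y x"
      unfolding sublinear_red_def[of p y x] by (intro cINF_greatest) auto
    then show ?thesis using r by (simp add: field_simps)
  qed
  have z: "sublinear_red p y 0 = 0"
  proof -
    have "p (0 + t *\<^sub>R y) - t * p y = 0" if "0 \<le> t" for t
      using p that by (simp add: sublinear_def)
    then have "(\<lambda>t. p (0 + t *\<^sub>R y) - t * p y) ` {0..} = {0}" by force
    then show ?thesis by (simp add: sublinear_red_def)
  qed
  show ?thesis using add z sc by (rule sublinearI)
qed

lemma sublinear_dominates_linear:
  fixes p :: "'a::real_vector \<Rightarrow> real"
  assumes p: "sublinear p"
  obtains L where "linear L" "\<And>x. L x \<le> p x"
proof -
  (* Zorn's lemma for the reverse order yields a minimal sublinear m below p. *)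
  let ?A = "{q. sublinear q \<and> q \<le> p}"
  let ?P = "\<lambda>f g :: 'a \<Rightarrow> real. g \<le> f"
  have "\<exists>m\<in>?A. \<forall>q\<in>?A. ?P m q \<longrightarrow> q = m"
  proof (rule predicate_Zorn)
    show "partial_order_on ?A (relation_of ?P ?A)"
      by (auto simp: partial_order_on_def preorder_on_def refl_on_def trans_def antisym_def relation_of_def)
  next
    fix C assume C: "C \<in> Chains (relation_of ?P ?A)"
    have CA: "C \<subseteq> ?A" using C by (auto simp: Chains_def relation_of_def)
    have ch: "f \<le> g \<or> g \<le> f" if "f \<in> C" "g \<in> C" for f g
      using C that by (auto simp: Chains_def relation_of_def)
    show "\<exists>u\<in>?A. \<forall>q\<in>C. ?P q u"
    proof (cases "C = {}")
      case True
      then show ?thesis using p by auto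
    next
      case False
      define u where "u x = (INF q\<in>C. q x)" for x
      have bdd: "bdd_below ((\<lambda>q. q x) ` C)" for x
      proof (rule bdd_belowI2)
        fix q assume q: "q \<in> C"
        then have "- q (- x) \<le> q x" using CA sublinear_minus by blast
        moreover have "q (- x) \<le> p (- x)" using q CA by (auto simp: le_fun_def)
        ultimately show "- p (- x) \<le> q x" by simp
      qed
      have uq: "u x \<le> q x" if "q \<in> C" for q x
        unfolding u_def by (rule cINF_lower[OF bdd that])
      have gr: "r \<le> u x" if "\<And>q. q \<in> C \<Longrightarrow> r \<le> q x" for r x
        unfolding u_def by (rule cINF_greatest[OF False]) (use that in auto)
      have add: "u (x + y) \<le> u x + u y" for x y
      proof -
        have *: "u (x + y) \<le> q x + r y" if q: "q \<in> C" and r: "r \<in> C" for q r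
        proof -
          obtain s where s: "s \<in> C" "s \<le> q" "s \<le> r" using ch[OF q r] q r by auto
          have "u (x + y) \<le> s (x + y)" by (rule uq[OF s(1)])
          also have "\<dots> \<le> s x + s y" using s CA by (auto simp: sublinear_def)
          also have "\<dots> \<le> q x + r y" using s by (auto simp: le_fun_def intro: add_mono)
          finally show ?thesis .
        qed
        have "u (x + y) - q x \<le> u y" if "q \<in> C" for q
          by (rule gr) (use *[OF that] in \<open>auto simp: algebra_simps\<close>)
        then have "u (x + y) - u y \<le> u x" by (intro gr) (auto simp: algebra_simps)
        then show ?thesis by simp
      qed
      have sc: "u (t *\<^sub>R x) \<le> t * u x" if t: "0 < t" for t x
      proof -
        have "u (t *\<^sub>R x) / t \<le> q x" if q: "q \<in> C" for q
        proof -
          have "u (t *\<^sub>R x) \<le> q (t *\<^sub>R x)" by (rule uq[OF q])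
          also have "\<dots> = t * q x" using q CA t by (auto simp: sublinear_def)
          finally show ?thesis using t by (simp add: field_simps)
        qed
        then have "u (t *\<^sub>R x) / t \<le> u x" by (rule gr)
        then show ?thesis using t by (simp add: field_simps)
      qed
      have "u 0 = 0"
      proof -
        have "q 0 = 0" if "q \<in> C" for q using that CA sublinear_zero by blast
        then have "(\<lambda>q. q 0) ` C = {0}" using False by force
        then show ?thesis by (simp add: u_def)
      qed
      with add have "sublinear u" using sc by (rule sublinearI)
      moreover obtain q0 where "q0 \<in> C" using False by auto
      then have "u \<le> p" using uq[of q0] CA by (auto simp: le_fun_def intro: order_trans)
      ultimately show ?thesis using uq by (auto simp: le_fun_def)
    qed
  qed
  then obtain m where m: "sublinear m" "m \<le> p" and
    min: "\<And>q. sublinear q \<Longrightarrow> q \<le> m \<Longrightarrow> q = m"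
    by (metis (no_types, lifting) mem_Collect_eq order_trans)
  have red: "sublinear_red m y = m" for y
  proof (rule min)
    show "sublinear_red m y \<le> m"
      using sublinear_red_le[OF m(1), of 0 y] by (auto simp: le_fun_def)
  qed (rule sublinear_red_sublinear[OF m(1)])
  have ge: "m x + m y \<le> m (x + y)" for x y
    using sublinear_red_le[OF m(1), of 1 y x] by (simp add: red)
  have add: "m (x + y) = m x + m y" for x y
    using ge[of x y] m(1) by (auto simp: sublinear_def intro: antisym)
  have neg: "m (- x) = - m x" for x
    using add[of x "- x"] sublinear_zero[OF m(1)] by simp
  have "m (t *\<^sub>R x) = t * m x" for t x
  proof (cases "0 \<le> t")
    case True then show ?thesis using m(1) by (simp add: sublinear_def)
  next
    case False
    then have "m ((- t) *\<^sub>R x) = (- t) * m x" using m(1) by (simp only: sublinear_def)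
    then show ?thesis using neg[of "t *\<^sub>R x"] by simp
  qed
  then have "linear m" using add by (intro linearI) auto
  then show ?thesis using that m(2) by (auto simp: le_fun_def)
qed

lemma sublinear_supporting_linear:
  fixes p :: "'a::real_vector \<Rightarrow> real"
  assumes p: "sublinear p"
  obtains L where "linear L" "\<And>x. L x \<le> p x" "L x0 = p x0"
proof -
  obtain L where L: "linear L" "\<And>x. L x \<le> sublinear_red p x0 x"
    using sublinear_dominates_linear[OF sublinear_red_sublinear[OF p]] by metis
  have le: "L x \<le> p x" for x
    using L(2)[of x] sublinear_red_le[OF p, of 0 x0 x] by simp
  have "L (- x0) \<le> - p x0"
    using L(2)[of "- x0"] sublinear_red_le[OF p, of 1 x0 "- x0"] sublinear_zero[OF p] by simp
  then have "L x0 = p x0" using le[of x0] linear_neg[OF L(1), of x0] by simp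
  then show ?thesis using that L(1) le by blast
qed

text \<open>Separation of a point from a subspace at positive seminorm distance; the seminorm need only
  be given on a subspace \<open>E\<close>.\<close>

lemma seminorm_separation:
  fixes p :: "'a::real_vector \<Rightarrow> real"
  assumes E: "subspace E" and W: "subspace W" "W \<subseteq> E" and x0: "x0 \<in> E"
    and add: "\<And>x y. x \<in> E \<Longrightarrow> y \<in> E \<Longrightarrow> p (x + y) \<le> p x + p y"
    and sc: "\<And>t x. x \<in> E \<Longrightarrow> p (t *\<^sub>R x) = \<bar>t\<bar> * p x"
    and far: "\<And>w. w \<in> W \<Longrightarrow> \<epsilon> \<le> p (x0 - w)"
  shows "\<exists>L. linear L \<and> (\<forall>x\<in>E. \<bar>L x\<bar> \<le> p x) \<and> (\<forall>w\<in>W. L w = 0) \<and> \<epsilon> \<le> L x0"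
proof -
  (* A linear projection onto E turns p into a functional on the whole space; d is its quotient
     seminorm modulo W. *)
  obtain \<pi> where \<pi>: "range \<pi> \<subseteq> E" "linear \<pi>" "\<And>v. v \<in> E \<Longrightarrow> \<pi> v = v"
    using linear_exists_left_inverse_on[of "\<lambda>x::'a. x" E] E by (auto simp: linear_iff)
  have \<pi>E: "\<pi> x \<in> E" for x using \<pi>(1) by auto
  have minus: "p (- x) = p x" if "x \<in> E" for x using sc[OF that, of "-1"] by simp
  have p0: "p 0 = 0" using sc[of 0 0] subspace_0[OF E] by simp
  have nonneg: "0 \<le> p x" if "x \<in> E" for x
    using add[of x "- x"] minus[OF that] p0 that subspace_neg[OF E that] by simp
  define d where "d x = (INF w\<in>W. p (\<pi> x - w))" for x
  have Wn: "W \<noteq> {}" using subspace_0[OF W(1)] by auto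
  have mem: "\<pi> x - w \<in> E" if "w \<in> W" for x w
    using that W(2) by (intro subspace_diff[OF E \<pi>E]) auto
  have bdd: "bdd_below ((\<lambda>w. p (\<pi> x - w)) ` W)" for x
    by (rule bdd_belowI2[of _ 0]) (use nonneg mem in auto)
  have dle: "d x \<le> p (\<pi> x - w)" if "w \<in> W" for x w
    unfolding d_def by (rule cINF_lower[OF bdd that])
  have gr: "r \<le> d x" if "\<And>w. w \<in> W \<Longrightarrow> r \<le> p (\<pi> x - w)" for r x
    unfolding d_def by (rule cINF_greatest[OF Wn]) (use that in auto)
  have dadd: "d (x + y) \<le> d x + d y" for x y
  proof -
    have *: "d (x + y) \<le> p (\<pi> x - v) + p (\<pi> y - w)" if "v \<in> W" "w \<in> W" for v w
    proof -
      have "d (x + y) \<le> p (\<pi> (x + y) - (v + w))" by (intro dle subspace_add W that)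
      also have "\<pi> (x + y) - (v + w) = (\<pi> x - v) + (\<pi> y - w)"
        by (simp add: linear_add[OF \<pi>(2)])
      finally show ?thesis using add[OF mem[OF that(1), of x] mem[OF that(2), of y]] by linarith
    qed
    have "d (x + y) - p (\<pi> x - v) \<le> d y" if "v \<in> W" for v
      by (rule gr) (use *[OF that] in \<open>auto simp: algebra_simps\<close>)
    then have "d (x + y) - d y \<le> d x" by (intro gr) (auto simp: algebra_simps)
    then show ?thesis by simp
  qed
  have dsc: "d (t *\<^sub>R x) \<le> t * d x" if t: "0 < t" for t x
  proof -
    have "d (t *\<^sub>R x) / t \<le> p (\<pi> x - w)" if w: "w \<in> W" for w
    proof -
      have "d (t *\<^sub>R x) \<le> p (\<pi> (t *\<^sub>R x) - t *\<^sub>R w)" by (intro dle subspace_scale W w)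
      also have "\<pi> (t *\<^sub>R x) - t *\<^sub>R w = t *\<^sub>R (\<pi> x - w)"
        by (simp add: linear_scale[OF \<pi>(2)] algebra_simps)
      also have "p \<dots> = t * p (\<pi> x - w)" using sc[OF mem[OF w], of t x] t by simp
      finally show ?thesis using t by (simp add: field_simps)
    qed
    then have "d (t *\<^sub>R x) / t \<le> d x" by (rule gr)
    then show ?thesis using t by (simp add: field_simps)
  qed
  have dp: "d x \<le> p (\<pi> x)" for x using dle[OF subspace_0[OF W(1)], of x] by simp
  have d0: "d 0 = 0"
  proof (rule antisym)
    show "d 0 \<le> 0" using dp[of 0] p0 by (simp add: linear_0[OF \<pi>(2)])
    show "0 \<le> d 0" by (rule gr) (use nonneg mem in auto)
  qed
  have "sublinear d" using dadd d0 dsc by (rule sublinearI)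
  then obtain L where L: "linear L" "\<And>x. L x \<le> d x" "L x0 = d x0"
    using sublinear_supporting_linear by metis
  have le: "L x \<le> p x" if "x \<in> E" for x using L(2)[of x] dp[of x] \<pi>(3)[OF that] by simp
  show ?thesis
  proof (intro exI[of _ L] conjI ballI L(1))
    show "\<bar>L x\<bar> \<le> p x" if "x \<in> E" for x
      using le[OF that] le[OF subspace_neg[OF E that]] minus[OF that] linear_neg[OF L(1), of x] by simp
    show "L w = 0" if w: "w \<in> W" for w
    proof -
      have z: "L v \<le> 0" if "v \<in> W" for v
        using L(2)[of v] dle[OF that, of v] \<pi>(3)[of v] that W(2) p0 by auto
      show ?thesis using z[OF w] z[OF subspace_neg[OF W(1) w]] linear_neg[OF L(1), of w] by simp
    qed
    show "\<epsilon> \<le> L x0" unfolding L(3) by (rule gr) (use far \<pi>(3)[OF x0] in auto)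
  qed
qed

text \<open>Functions form a real vector space under pointwise operations.\<close>

instantiation "fun" :: (type, real_vector) real_vector
begin

definition scaleR_fun :: "real \<Rightarrow> ('a \<Rightarrow> 'b) \<Rightarrow> 'a \<Rightarrow> 'b" where
  "scaleR_fun r f = (\<lambda>x. r *\<^sub>R f x)"

instance
  by standard (simp_all add: scaleR_fun_def fun_eq_iff algebra_simps)

end

section \<open>Weights and the weight sequences they define\<close>

text \<open>The sequence \<open>exp (q \<phi>*(j / q))\<close> that bounds the \<open>j\<close>-th derivatives in the norm with parameter
  \<open>q\<close>. For a weight it is the supremum of \<open>x^j exp (- q \<omega> x)\<close> over \<open>x \<ge> 1\<close>; all its properties are
  read off from this description (lemmas \<open>power_le_wseq\<close> and \<open>wseq_least\<close>).\<close>

definition wseq :: "(real \<Rightarrow> real) \<Rightarrow> real \<Rightarrow> nat \<Rightarrow> real" where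
  "wseq \<omega> q j = exp (q * young_conj \<omega> (real j / q))"

lemma wseq_pos [simp]: "0 < wseq \<omega> q j" by (simp add: wseq_def)

lemma wseq_nonneg [simp]: "0 \<le> wseq \<omega> q j" by (simp add: wseq_def)

lemma wseq_not_le_zero [simp]: "\<not> wseq \<omega> q j \<le> 0" by (simp add: not_le)

locale weight_fn =
  fixes \<omega> :: "real \<Rightarrow> real"
  assumes weight: "is_weight \<omega>"
begin

lemma omega_nonneg: "0 \<le> x \<Longrightarrow> 0 \<le> \<omega> x"
  using weight by (auto simp: is_weight_def)

lemma omega_mono: "0 \<le> x \<Longrightarrow> x \<le> y \<Longrightarrow> \<omega> x \<le> \<omega> y"
  using weight by (auto simp: is_weight_def mono_on_def)

lemma ln_le_omega:
  assumes "0 < e"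
  obtains K where "\<And>x. 1 \<le> x \<Longrightarrow> ln x \<le> e * \<omega> x + K"
proof -
  have "ln \<in> o[at_top](\<omega>)" using weight by (simp add: is_weight_def)
  then have "eventually (\<lambda>x. norm (ln x) \<le> e * norm (\<omega> x)) at_top"
    by (rule landau_o.smallD) (use assms in simp)
  then obtain X where X: "\<And>x. X \<le> x \<Longrightarrow> norm (ln x) \<le> e * norm (\<omega> x)"
    by (auto simp: eventually_at_top_linorder)
  have "ln x \<le> e * \<omega> x + ln (max 1 X)" if "1 \<le> x" for x
  proof (cases "X \<le> x")
    case True
    have "ln x \<le> e * \<omega> x" using X[OF True] omega_nonneg[of x] that by auto
    then show ?thesis by (simp add: add_increasing2)
  next
    case False
    then have "ln x \<le> ln (max 1 X)" using that by simp
    then show ?thesis using omega_nonneg[of x] that assms by (simp add: add_increasing)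
  qed
  then show ?thesis by (rule that)
qed

lemma omega_le_linear:
  assumes "0 < e"
  obtains K where "\<And>x. 0 \<le> x \<Longrightarrow> \<omega> x \<le> e * x + K"
proof -
  have "\<omega> \<in> o[at_top](\<lambda>x. x)" using weight by (simp add: is_weight_def)
  then have "eventually (\<lambda>x. norm (\<omega> x) \<le> e * norm x) at_top"
    by (rule landau_o.smallD) (use assms in simp)
  then obtain X where X: "\<And>x. X \<le> x \<Longrightarrow> norm (\<omega> x) \<le> e * norm x"
    by (auto simp: eventually_at_top_linorder)
  have "\<omega> x \<le> e * x + \<omega> (max 0 X)" if "0 \<le> x" for x
  proof (cases "X \<le> x")
    case True
    have "\<omega> x \<le> e * x" using X[OF True] that by auto
    then show ?thesis using omega_nonneg[of "max 0 X"] by simp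
  next
    case False
    then have "\<omega> x \<le> \<omega> (max 0 X)" using that by (intro omega_mono) auto
    then show ?thesis using that assms by (simp add: add_increasing)
  qed
  then show ?thesis by (rule that)
qed

lemma omega_add:
  assumes "1 < \<sigma>"
  obtains K where "\<And>x y. 0 \<le> x \<Longrightarrow> 0 \<le> y \<Longrightarrow> \<omega> (x + y) \<le> \<sigma> * (\<omega> x + \<omega> y) + K"
proof -
  have "\<exists>C>0. \<forall>x\<ge>0. \<forall>y\<ge>0. \<omega> (x + y) \<le> \<sigma> * (\<omega> x + \<omega> y) + C"
    using weight assms by (simp add: is_weight_def)
  then show ?thesis using that by blast
qed

lemma young_bdd: "0 < q \<Longrightarrow> bdd_above ((\<lambda>t. real j / q * t - \<omega> (exp t)) ` {0..})"
proof -
  assume q: "0 < q"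
  obtain K where K: "\<And>x. 1 \<le> x \<Longrightarrow> ln x \<le> q / real (Suc j) * \<omega> x + K"
    by (rule ln_le_omega[of "q / real (Suc j)"]) (use q in auto)
  show ?thesis
  proof (rule bdd_aboveI2)
    fix t :: real assume t: "t \<in> {0..}"
    have "t \<le> q / real (Suc j) * \<omega> (exp t) + K" using K[of "exp t"] t by simp
    then have "real j / q * t \<le> real j / q * (q / real (Suc j) * \<omega> (exp t) + K)"
      using q by (intro mult_left_mono) auto
    also have "\<dots> = real j / real (Suc j) * \<omega> (exp t) + real j / q * K"
      using q by (simp add: field_simps)
    also have "\<dots> \<le> 1 * \<omega> (exp t) + real j / q * K"
      using omega_nonneg[of "exp t"] by (intro add_right_mono mult_right_mono) auto
    finally show "real j / q * t - \<omega> (exp t) \<le> real j / q * K" by simp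
  qed
qed

lemma power_le_wseq:
  assumes "0 < q" "1 \<le> x"
  shows "x ^ j \<le> wseq \<omega> q j * exp (q * \<omega> x)"
proof -
  have "real j / q * ln x - \<omega> (exp (ln x)) \<le> young_conj \<omega> (real j / q)"
    unfolding young_conj_def by (rule cSUP_upper[OF _ young_bdd]) (use assms in auto)
  then have "q * (real j / q * ln x - \<omega> x) \<le> q * young_conj \<omega> (real j / q)"
    using assms by (intro mult_left_mono) auto
  then have "real j * ln x \<le> q * young_conj \<omega> (real j / q) + q * \<omega> x"
    using assms by (simp add: algebra_simps)
  then have "exp (real j * ln x) \<le> exp (q * young_conj \<omega> (real j / q) + q * \<omega> x)" by simp
  then show ?thesis using assms by (simp add: wseq_def exp_add exp_of_nat_mult)
qed

lemma wseq_least: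
  assumes q: "0 < q" and B: "\<And>x. 1 \<le> x \<Longrightarrow> x ^ j * exp (- q * \<omega> x) \<le> B"
  shows "wseq \<omega> q j \<le> B"
proof -
  have "exp (- q * \<omega> 1) \<le> B" using B[of 1] by simp
  then have B0: "0 < B" using exp_gt_zero[of "- q * \<omega> 1"] by linarith
  have "young_conj \<omega> (real j / q) \<le> ln B / q"
    unfolding young_conj_def
  proof (rule cSUP_least)
    fix t :: real assume t: "t \<in> {0..}"
    have "exp (real j * t + - q * \<omega> (exp t)) \<le> B"
      using B[of "exp t"] t unfolding exp_add by (simp add: exp_of_nat_mult)
    then have "real j * t + - q * \<omega> (exp t) \<le> ln B" using B0 by (simp add: ln_ge_iff)
    then have "(real j * t - q * \<omega> (exp t)) / q \<le> ln B / q"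
      using q by (intro divide_right_mono) auto
    then show "real j / q * t - \<omega> (exp t) \<le> ln B / q" using q by (simp add: diff_divide_distrib)
  qed auto
  then have "q * young_conj \<omega> (real j / q) \<le> ln B" using q by (simp add: field_simps)
  then show ?thesis using B0 by (simp add: wseq_def ln_ge_iff)
qed

lemma wseq_antimono:
  assumes "0 < q" "q \<le> q'"
  shows "wseq \<omega> q' j \<le> wseq \<omega> q j"
proof (rule wseq_least)
  fix x :: real assume x: "1 \<le> x"
  have "x ^ j * exp (- q' * \<omega> x) \<le> x ^ j * exp (- q * \<omega> x)"
    using x assms omega_nonneg[of x] by (intro mult_left_mono) (auto intro!: mult_right_mono)
  also have "\<dots> \<le> wseq \<omega> q j"
    using power_le_wseq[OF assms(1) x, of j] by (simp add: exp_minus field_simps)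
  finally show "x ^ j * exp (- q' * \<omega> x) \<le> wseq \<omega> q j" .
qed (use assms in auto)

lemma wseq_Suc:
  assumes "0 < q" "q < q'"
  obtains C where "0 < C" "\<And>j. wseq \<omega> q' (Suc j) \<le> C * wseq \<omega> q j"
proof -
  obtain K where K: "\<And>x. 1 \<le> x \<Longrightarrow> ln x \<le> (q' - q) * \<omega> x + K"
    by (rule ln_le_omega[of "q' - q"]) (use assms in auto)
  have "wseq \<omega> q' (Suc j) \<le> exp K * wseq \<omega> q j" for j
  proof (rule wseq_least)
    fix x :: real assume x: "1 \<le> x"
    have "x = exp (ln x)" using x by simp
    also have "\<dots> \<le> exp ((q' - q) * \<omega> x + K)" using K[OF x] by simp
    finally have le: "x \<le> exp K * exp ((q' - q) * \<omega> x)" by (simp add: exp_add mult.commute)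
    have "x ^ Suc j * exp (- q' * \<omega> x) = x * (x ^ j * exp (- q' * \<omega> x))" by simp
    also have "\<dots> \<le> (exp K * exp ((q' - q) * \<omega> x)) * (x ^ j * exp (- q' * \<omega> x))"
      using le x by (intro mult_right_mono) auto
    also have "\<dots> = exp K * (x ^ j * (exp ((q' - q) * \<omega> x) * exp (- q' * \<omega> x)))" by simp
    also have "exp ((q' - q) * \<omega> x) * exp (- q' * \<omega> x) = exp (- q * \<omega> x)"
      unfolding exp_add[symmetric] by (simp add: algebra_simps)
    also have "x ^ j * exp (- q * \<omega> x) \<le> wseq \<omega> q j"
      using power_le_wseq[OF assms(1) x, of j] by (simp add: exp_minus field_simps)
    finally show "x ^ Suc j * exp (- q' * \<omega> x) \<le> exp K * wseq \<omega> q j" by simp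
  qed (use assms in auto)
  then show ?thesis using that[of "exp K"] by simp
qed

text \<open>The weight sequences behave well under the Leibniz formula. As
  \<open>(i + j choose i) x^i y^j \<le> (x + y)^(i + j)\<close>, this reduces to the almost subadditivity
  \<open>\<omega> (x + y) \<le> (q' / q) (\<omega> x + \<omega> y) + K\<close>.\<close>

lemma wseq_conv:
  assumes "0 < q" "q < q'"
  obtains C where "0 < C"
    "\<And>i j. real ((i + j) choose i) * wseq \<omega> q' i * wseq \<omega> q' j \<le> C * wseq \<omega> q (i + j)"
proof -
  obtain K where K: "\<And>x y. 0 \<le> x \<Longrightarrow> 0 \<le> y \<Longrightarrow> \<omega> (x + y) \<le> (q' / q) * (\<omega> x + \<omega> y) + K"
    by (rule omega_add[of "q' / q"]) (use assms in auto)
  have "real ((i + j) choose i) * wseq \<omega> q' i * wseq \<omega> q' j \<le> exp (q * K) * wseq \<omega> q (i + j)" for i j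
  proof -
    define b where "b = real ((i + j) choose i)"
    have b: "0 < b" by (simp add: b_def)
    define R where "R = exp (q * K) * wseq \<omega> q (i + j)"
    have main: "b * (x ^ i * exp (- q' * \<omega> x)) * (y ^ j * exp (- q' * \<omega> y)) \<le> R"
      if x: "1 \<le> x" and y: "1 \<le> y" for x y
    proof -
      have "b * (x ^ i * y ^ j) \<le> (x + y) ^ (i + j)"
      proof -
        have "real ((i + j) choose i) * x ^ i * y ^ (i + j - i) \<le>
              (\<Sum>k\<le>i + j. real ((i + j) choose k) * x ^ k * y ^ (i + j - k))"
          using x y by (intro member_le_sum) auto
        then show ?thesis by (simp add: binomial_ring b_def)
      qed
      also have "\<dots> \<le> wseq \<omega> q (i + j) * exp (q * \<omega> (x + y))"
        by (rule power_le_wseq) (use x y assms in auto)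
      also have "\<dots> \<le> wseq \<omega> q (i + j) * exp (q * ((q' / q) * (\<omega> x + \<omega> y) + K))"
        using K[of x y] x y assms by (intro mult_left_mono) auto
      also have "q * ((q' / q) * (\<omega> x + \<omega> y) + K) = q' * \<omega> x + q' * \<omega> y + q * K"
        using assms by (simp add: field_simps)
      finally have "b * (x ^ i * y ^ j) \<le> R * exp (q' * \<omega> x) * exp (q' * \<omega> y)"
        by (simp add: R_def exp_add mult_ac)
      then show ?thesis by (simp add: exp_minus field_simps)
    qed
    have 1: "b * wseq \<omega> q' i * (y ^ j * exp (- q' * \<omega> y)) \<le> R" if y: "1 \<le> y" for y
    proof -
      define Y where "Y = y ^ j * exp (- q' * \<omega> y)"
      have Y: "0 < Y" using y by (simp add: Y_def)
      have "wseq \<omega> q' i \<le> R / (b * Y)"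
      proof (rule wseq_least)
        fix x :: real assume x: "1 \<le> x"
        have "b * (x ^ i * exp (- q' * \<omega> x)) * Y \<le> R" unfolding Y_def by (rule main[OF x y])
        then show "x ^ i * exp (- q' * \<omega> x) \<le> R / (b * Y)"
          using b Y by (simp add: pos_le_divide_eq mult_ac)
      qed (use assms in auto)
      then have "b * wseq \<omega> q' i * Y \<le> R" using b Y by (simp add: pos_le_divide_eq mult_ac)
      then show ?thesis by (simp only: Y_def)
    qed
    have "wseq \<omega> q' j \<le> R / (b * wseq \<omega> q' i)"
    proof (rule wseq_least)
      fix x :: real assume "1 \<le> x"
      then show "x ^ j * exp (- q' * \<omega> x) \<le> R / (b * wseq \<omega> q' i)"
        using 1[of x] b by (simp add: pos_le_divide_eq mult_ac)
    qed (use assms in auto)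
    then show ?thesis using b by (simp add: pos_le_divide_eq mult_ac R_def b_def)
  qed
  then show ?thesis using that[of "exp (q * K)"] by simp
qed

text \<open>A factor \<open>j + 1 = (j + 1 choose 1)\<close> costs an arbitrarily small decrease of \<open>q\<close>.\<close>

lemma wseq_linear_factor:
  assumes "0 < q" "q < q'"
  obtains C where "0 < C" "\<And>j. real (Suc j) * wseq \<omega> q' j \<le> C * wseq \<omega> q j"
proof -
  obtain r where r: "q < r" "r < q'" using assms(2) dense by blast
  obtain C where C: "0 < C"
    "\<And>i j. real ((i + j) choose i) * wseq \<omega> q' i * wseq \<omega> q' j \<le> C * wseq \<omega> r (i + j)"
    by (rule wseq_conv[of r q']) (use assms r in auto)
  obtain C' where C': "0 < C'" "\<And>j. wseq \<omega> r (Suc j) \<le> C' * wseq \<omega> q j"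
    by (rule wseq_Suc[of q r]) (use assms r in auto)
  let ?m = "wseq \<omega> q' 1"
  have "real (Suc j) * wseq \<omega> q' j \<le> (C * C' / ?m) * wseq \<omega> q j" for j
  proof -
    have "real (Suc j) * ?m * wseq \<omega> q' j \<le> C * wseq \<omega> r (Suc j)"
      using C(2)[of 1 j] by simp
    also have "\<dots> \<le> C * (C' * wseq \<omega> q j)" using C'(2)[of j] C by simp
    finally show ?thesis by (simp add: field_simps)
  qed
  then show ?thesis using that[of "C * C' / ?m"] C C' by simp
qed

lemma wseq_conv_sum:
  assumes "0 < q" "q < q'"
  obtains C where "0 < C"
    "\<And>j. (\<Sum>i\<le>j. real (j choose i) * wseq \<omega> q' i * wseq \<omega> q' (j - i)) \<le> C * wseq \<omega> q j"
proof -
  obtain r where r: "q < r" "r < q'" using assms(2) dense by blast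
  obtain C where C: "0 < C"
    "\<And>i j. real ((i + j) choose i) * wseq \<omega> q' i * wseq \<omega> q' j \<le> C * wseq \<omega> r (i + j)"
    by (rule wseq_conv[of r q']) (use assms r in auto)
  obtain C' where C': "0 < C'" "\<And>j. real (Suc j) * wseq \<omega> r j \<le> C' * wseq \<omega> q j"
    by (rule wseq_linear_factor[of q r]) (use assms r in auto)
  have "(\<Sum>i\<le>j. real (j choose i) * wseq \<omega> q' i * wseq \<omega> q' (j - i)) \<le> (C * C') * wseq \<omega> q j" for j
  proof -
    have "(\<Sum>i\<le>j. real (j choose i) * wseq \<omega> q' i * wseq \<omega> q' (j - i)) \<le> (\<Sum>i\<le>j. C * wseq \<omega> r j)"
    proof (rule sum_mono)
      fix i assume "i \<in> {..j}"
      then show "real (j choose i) * wseq \<omega> q' i * wseq \<omega> q' (j - i) \<le> C * wseq \<omega> r j"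
        using C(2)[of i "j - i"] by simp
    qed
    also have "\<dots> = C * (real (Suc j) * wseq \<omega> r j)" by simp
    also have "\<dots> \<le> C * (C' * wseq \<omega> q j)" using C C'(2)[of j] by (intro mult_left_mono) auto
    finally show ?thesis by simp
  qed
  then show ?thesis using that[of "C * C'"] C C' by simp
qed

end

section \<open>The space of ultradifferentiable functions\<close>

text \<open>A function together with all its derivatives, each extended by zero off \<open>(-a;a)\<close>.\<close>

definition deriv_tower :: "ereal \<Rightarrow> (nat \<Rightarrow> real \<Rightarrow> complex) \<Rightarrow> bool" where
  "deriv_tower a F \<longleftrightarrow> (\<forall>j x. x \<notin> sym_interval a \<longrightarrow> F j x = 0) \<and>
     (\<forall>j. \<forall>x\<in>sym_interval a. (F j has_vector_derivative F (Suc j) x) (at x))"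

lemma deriv_tower_zero: "deriv_tower a F \<Longrightarrow> x \<notin> sym_interval a \<Longrightarrow> F j x = 0"
  by (simp add: deriv_tower_def)

lemma deriv_tower_deriv:
  "deriv_tower a F \<Longrightarrow> x \<in> sym_interval a \<Longrightarrow> (F j has_vector_derivative F (Suc j) x) (at x)"
  by (simp add: deriv_tower_def)

lemma deriv_tower_D:
  assumes "deriv_tower a F"
  shows "(D a ^^ j) (F 0) = F j"
proof (induction j)
  case (Suc j)
  have "(D a ^^ Suc j) (F 0) = D a (F j)" using Suc by simp
  also have "\<dots> = F (Suc j)"
    using assms by (auto simp: fun_eq_iff D_def deriv_tower_def intro: vector_derivative_at)
  finally show ?case .
qed simp

lemma deriv_tower_smooth:
  assumes "deriv_tower a F"
  shows "F 0 \<in> smooth_fns a"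
  using differentiableI_vector[OF deriv_tower_deriv[OF assms]] deriv_tower_zero[OF assms]
  by (auto simp: smooth_fns_def deriv_tower_D[OF assms])

lemma smooth_deriv_tower:
  assumes "f \<in> smooth_fns a"
  shows "deriv_tower a (\<lambda>j. (D a ^^ j) f)"
proof -
  have "(D a ^^ j) f x = 0" if "x \<notin> sym_interval a" for j x
    using assms that by (cases j) (auto simp: smooth_fns_def D_def)
  moreover have "((D a ^^ j) f has_vector_derivative (D a ^^ Suc j) f x) (at x)"
    if "x \<in> sym_interval a" for j x
  proof -
    have "(D a ^^ j) f differentiable (at x)" using assms that by (auto simp: smooth_fns_def)
    then show ?thesis using that by (simp add: vector_derivative_works D_def)
  qed
  ultimately show ?thesis by (simp add: deriv_tower_def)
qed

lemma sym_interval_open: "open (sym_interval a)"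
  unfolding sym_interval_def by (intro open_Collect_conj open_Collect_less continuous_intros)

lemma sym_interval_uminus: "- x \<in> sym_interval a \<longleftrightarrow> x \<in> sym_interval a"
  unfolding sym_interval_def by (cases a) auto

lemma sym_interval_convexD: "x \<in> sym_interval a \<Longrightarrow> y \<in> sym_interval a \<Longrightarrow> x \<le> t \<Longrightarrow> t \<le> y
   \<Longrightarrow> t \<in> sym_interval a"
  unfolding sym_interval_def by (cases a) auto

lemma has_vector_derivative_cong_open:
  assumes "(f has_vector_derivative f') (at x)" "open S" "x \<in> S" "\<And>y. y \<in> S \<Longrightarrow> g y = f y"
  shows "(g has_vector_derivative f') (at x)"
  using has_vector_derivative_transform_within_open[OF assms(1-3)] assms(4) by metis

lemma deriv_towerI:
  assumes "\<And>j x. x \<in> sym_interval a \<Longrightarrow> (G j has_vector_derivative G (Suc j) x) (at x)"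
  shows "deriv_tower a (\<lambda>j x. if x \<in> sym_interval a then G j x else 0)"
  unfolding deriv_tower_def
proof (intro conjI allI ballI impI)
  fix j x assume x: "x \<in> sym_interval a"
  show "((\<lambda>x. if x \<in> sym_interval a then G j x else 0) has_vector_derivative
      (if x \<in> sym_interval a then G (Suc j) x else 0)) (at x)"
    using has_vector_derivative_cong_open[OF assms[OF x] sym_interval_open x,
        of "\<lambda>x. if x \<in> sym_interval a then G j x else 0"] x by simp
qed auto

lemma zero_deriv_tower: "deriv_tower a (\<lambda>j x. 0)"
  by (simp add: deriv_tower_def)

lemma deriv_tower_lincomb:
  assumes "deriv_tower a F" "deriv_tower a G"
  shows "deriv_tower a (\<lambda>j x. \<alpha> * F j x + \<beta> * G j x)"
  using assms unfolding deriv_tower_def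
  by (auto intro!: has_vector_derivative_add has_vector_derivative_mult_right)

lemma deriv_tower_reflect:
  assumes "deriv_tower a F"
  shows "deriv_tower a (\<lambda>j x. (- 1) ^ j * F j (- x))"
  unfolding deriv_tower_def
proof (intro conjI allI ballI impI)
  fix j x assume "x \<in> sym_interval a"
  then have x: "- x \<in> sym_interval a" by (simp add: sym_interval_uminus)
  have "((F j \<circ> uminus) has_vector_derivative (- 1) *\<^sub>R F (Suc j) (- x)) (at x)"
    by (rule vector_diff_chain_at[where f = uminus and g = "F j", OF _ deriv_tower_deriv[OF assms x]])
      (auto intro!: derivative_eq_intros)
  then have "((\<lambda>x. (- 1) ^ j * (F j \<circ> uminus) x) has_vector_derivative
     (- 1) ^ j * ((- 1) *\<^sub>R F (Suc j) (- x))) (at x)"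
    by (rule has_vector_derivative_mult_right)
  then show "((\<lambda>x. (- 1) ^ j * F j (- x)) has_vector_derivative (- 1) ^ Suc j * F (Suc j) (- x)) (at x)"
    by (simp add: o_def scaleR_conv_of_real)
qed (use assms in \<open>auto simp: deriv_tower_def sym_interval_uminus\<close>)

lemma sum_binomial_Suc:
  fixes f :: "nat \<Rightarrow> nat \<Rightarrow> 'a::comm_ring_1"
  shows "(\<Sum>i\<le>Suc j. of_nat (Suc j choose i) * f i (Suc j - i)) =
    (\<Sum>i\<le>j. of_nat (j choose i) * (f (Suc i) (j - i) + f i (Suc (j - i))))"
proof -
  have "(\<Sum>i\<le>Suc j. of_nat (Suc j choose i) * f i (Suc j - i)) =
     f 0 (Suc j) + (\<Sum>i\<le>j. of_nat (Suc j choose Suc i) * f (Suc i) (j - i))"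
    by (simp add: sum.atMost_Suc_shift del: sum.atMost_Suc)
  also have "(\<Sum>i\<le>j. of_nat (Suc j choose Suc i) * f (Suc i) (j - i)) =
     (\<Sum>i\<le>j. of_nat (j choose i) * f (Suc i) (j - i)) + (\<Sum>i\<le>j. of_nat (j choose Suc i) * f (Suc i) (j - i))"
    by (simp add: algebra_simps sum.distrib)
  also have "f 0 (Suc j) + ((\<Sum>i\<le>j. of_nat (j choose i) * f (Suc i) (j - i)) +
       (\<Sum>i\<le>j. of_nat (j choose Suc i) * f (Suc i) (j - i))) =
     (\<Sum>i\<le>j. of_nat (j choose i) * f (Suc i) (j - i)) +
     (\<Sum>i\<le>Suc j. of_nat (j choose i) * f i (Suc j - i))"
  proof -
    have "(\<Sum>i\<le>Suc j. of_nat (j choose i) * f i (Suc j - i)) =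
       f 0 (Suc j) + (\<Sum>i\<le>j. of_nat (j choose Suc i) * f (Suc i) (j - i))"
      by (simp add: sum.atMost_Suc_shift del: sum.atMost_Suc)
    then show ?thesis by (simp only: add_ac)
  qed
  also have "(\<Sum>i\<le>Suc j. of_nat (j choose i) * f i (Suc j - i)) =
    (\<Sum>i\<le>j. of_nat (j choose i) * f i (Suc (j - i)))"
    by (simp add: Suc_diff_le binomial_eq_0)
  finally show ?thesis by (simp add: distrib_left sum.distrib)
qed

lemma deriv_tower_mult:
  assumes F: "deriv_tower a F" and G: "deriv_tower a G"
  shows "deriv_tower a (\<lambda>j x. \<Sum>i\<le>j. of_nat (j choose i) * F i x * G (j - i) x)"
  unfolding deriv_tower_def
proof (intro conjI allI ballI impI)
  fix j x assume x: "x \<in> sym_interval a"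
  have "((\<lambda>x. of_nat (j choose i) * (F i x * G (j - i) x)) has_vector_derivative
      of_nat (j choose i) * (F i x * G (Suc (j - i)) x + F (Suc i) x * G (j - i) x)) (at x)" for i
    by (intro has_vector_derivative_mult_right has_vector_derivative_mult
          deriv_tower_deriv[OF F x] deriv_tower_deriv[OF G x])
  then have "((\<lambda>x. \<Sum>i\<le>j. of_nat (j choose i) * (F i x * G (j - i) x)) has_vector_derivative
     (\<Sum>i\<le>j. of_nat (j choose i) * (F i x * G (Suc (j - i)) x + F (Suc i) x * G (j - i) x))) (at x)"
    by (rule has_vector_derivative_sum)
  also have "(\<Sum>i\<le>j. of_nat (j choose i) * (F i x * G (Suc (j - i)) x + F (Suc i) x * G (j - i) x)) =
     (\<Sum>i\<le>Suc j. of_nat (Suc j choose i) * (F i x * G (Suc j - i) x))"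
    using sum_binomial_Suc[of j "\<lambda>m n. F m x * G n x"] by (simp add: add.commute)
  finally show "((\<lambda>x. \<Sum>i\<le>j. of_nat (j choose i) * F i x * G (j - i) x) has_vector_derivative
     (\<Sum>i\<le>Suc j. of_nat (Suc j choose i) * F i x * G (Suc j - i) x)) (at x)"
    by (simp only: mult.assoc)
qed (use assms in \<open>auto simp: deriv_tower_def\<close>)

lemma exp_deriv_tower:
  "deriv_tower a (\<lambda>j t. if t \<in> sym_interval a then of_real (l ^ j * exp (l * t)) else 0)"
proof (rule deriv_towerI)
  fix j x
  have "((\<lambda>t. l ^ j * exp (l * t)) has_field_derivative l ^ Suc j * exp (l * x)) (at x)"
    by (auto intro!: derivative_eq_intros)
  then show "((\<lambda>t. of_real (l ^ j * exp (l * t)) :: complex) has_vector_derivative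
     of_real (l ^ Suc j * exp (l * x))) (at x)"
    by (intro has_vector_derivative_of_real)
qed

text \<open>A fixed weight, interval and exhaustion.\<close>

locale ultra_space = weight_fn +
  fixes a :: ereal and c :: "nat \<Rightarrow> real"
  assumes a_pos: "0 < a" and exhausting: "exhausting a c"
begin

abbreviation "U \<equiv> U_space a \<omega> c"

text \<open>\<open>bounded_by q k f B\<close>: the norm of \<open>f\<close> with parameters \<open>q\<close>, \<open>k\<close> is at most \<open>B\<close>.\<close>

definition bounded_by :: "real \<Rightarrow> nat \<Rightarrow> (real \<Rightarrow> complex) \<Rightarrow> real \<Rightarrow> bool" where
  "bounded_by q k f B \<longleftrightarrow> (\<forall>j x. \<bar>x\<bar> \<le> c k \<longrightarrow> norm ((D a ^^ j) f x) \<le> B * wseq \<omega> q j)"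

lemma c_pos: "0 < c k" and c_less: "ereal (c k) < a" and c_mono: "k \<le> k' \<Longrightarrow> c k \<le> c k'"
  using exhausting by (auto simp: exhausting_def incseq_def)

lemma c_in: "\<bar>x\<bar> \<le> c k \<Longrightarrow> x \<in> sym_interval a"
  using c_less[of k] unfolding sym_interval_def by (cases a) auto

lemma c_above:
  assumes "x \<in> sym_interval a"
  obtains k where "\<bar>x\<bar> < c k"
proof -
  have "ereal \<bar>x\<bar> < a" using assms unfolding sym_interval_def by (cases a) auto
  moreover have "(\<lambda>k. ereal (c k)) \<longlonglongrightarrow> a" using exhausting by (simp add: exhausting_def)
  ultimately have "eventually (\<lambda>k. ereal \<bar>x\<bar> < ereal (c k)) sequentially"
    by (rule order_tendstoD(1)[rotated])
  then show ?thesis using that by (auto simp: eventually_sequentially)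
qed

lemma U_norm_le_iff: "U_norm a \<omega> c q k f \<le> ereal B \<longleftrightarrow> bounded_by q k f B"
proof -
  have "norm ((D a ^^ j) f x) * exp (- q * young_conj \<omega> (real j / q)) \<le> B \<longleftrightarrow>
      norm ((D a ^^ j) f x) \<le> B * wseq \<omega> q j" for j x
    by (simp add: wseq_def exp_minus field_simps)
  then show ?thesis
    by (auto simp: U_norm_def SUP_le_iff bounded_by_def abs_le_iff)
qed

lemma bounded_byD: "bounded_by q k f B \<Longrightarrow> \<bar>x\<bar> \<le> c k \<Longrightarrow> norm ((D a ^^ j) f x) \<le> B * wseq \<omega> q j"
  by (simp add: bounded_by_def)

lemma bounded_by_nonneg: "bounded_by q k f B \<Longrightarrow> 0 \<le> B"
  using bounded_byD[of q k f B 0 0] c_pos[of k] norm_ge_zero[of "f 0"] wseq_pos[of \<omega> q 0]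
  by (metis (no_types) abs_zero less_imp_le norm_ge_zero order_trans zero_le_mult_iff not_less)

lemma bounded_by_mono:
  assumes "bounded_by q' k' f B" "0 < q" "q \<le> q'" "k \<le> k'" "B \<le> B'"
  shows "bounded_by q k f B'"
  unfolding bounded_by_def
proof (intro allI impI)
  fix j x assume "\<bar>x\<bar> \<le> c k"
  then have "\<bar>x\<bar> \<le> c k'" using c_mono[OF assms(4)] by simp
  then have "norm ((D a ^^ j) f x) \<le> B * wseq \<omega> q' j" by (rule bounded_byD[OF assms(1)])
  also have "\<dots> \<le> B' * wseq \<omega> q j"
    using wseq_antimono[OF assms(2,3)] bounded_by_nonneg[OF assms(1)] assms(5)
    by (intro mult_mono) auto
  finally show "norm ((D a ^^ j) f x) \<le> B' * wseq \<omega> q j" .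
qed

lemma U_iff:
  "f \<in> U \<longleftrightarrow> f \<in> smooth_fns a \<and> (\<forall>q k. 0 < q \<and> q < 1 \<longrightarrow> (\<exists>B. bounded_by q k f B))"
proof -
  have "U_norm a \<omega> c q k f < \<infinity> \<longleftrightarrow> (\<exists>B. bounded_by q k f B)" for q k
  proof
    assume l: "U_norm a \<omega> c q k f < \<infinity>"
    then show "\<exists>B. bounded_by q k f B"
    proof (cases "U_norm a \<omega> c q k f")
      case (real r)
      then show ?thesis using U_norm_le_iff[of q k f r] by auto
    next
      case MInf
      then show ?thesis using U_norm_le_iff[of q k f 0] by auto
    qed auto
  next
    assume "\<exists>B. bounded_by q k f B"
    then show "U_norm a \<omega> c q k f < \<infinity>"
      using U_norm_le_iff[of q k f] by (metis ereal_infty_less(1) ereal_less_eq(1) less_le_trans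
        linorder_not_less order_le_less PInfty_neq_ereal(1))
  qed
  then show ?thesis by (auto simp: U_space_def)
qed

lemma U_tower: "f \<in> U \<Longrightarrow> deriv_tower a (\<lambda>j. (D a ^^ j) f)"
  by (auto simp: U_iff intro: smooth_deriv_tower)

lemma U_bounded: "f \<in> U \<Longrightarrow> 0 < q \<Longrightarrow> q < 1 \<Longrightarrow> \<exists>B. bounded_by q k f B"
  by (auto simp: U_iff)

lemma U_I:
  assumes F: "deriv_tower a F"
    and B: "\<And>q k. 0 < q \<Longrightarrow> q < 1 \<Longrightarrow> \<exists>B. \<forall>j x. \<bar>x\<bar> \<le> c k \<longrightarrow> norm (F j x) \<le> B * wseq \<omega> q j"
  shows "F 0 \<in> U"
  using deriv_tower_smooth[OF F] B by (auto simp: U_iff bounded_by_def deriv_tower_D[OF F])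

lemma D_lincomb:
  assumes "f \<in> U" "g \<in> U"
  shows "(D a ^^ j) (\<lambda>x. \<alpha> * f x + \<beta> * g x) x = \<alpha> * (D a ^^ j) f x + \<beta> * (D a ^^ j) g x"
  using deriv_tower_D[OF deriv_tower_lincomb[OF U_tower[OF assms(1)] U_tower[OF assms(2)], of \<alpha> \<beta>], of j]
  by simp

lemma bounded_by_lincomb:
  assumes "f \<in> U" "g \<in> U" "bounded_by q k f A" "bounded_by q k g B"
  shows "bounded_by q k (\<lambda>x. \<alpha> * f x + \<beta> * g x) (norm \<alpha> * A + norm \<beta> * B)"
  unfolding bounded_by_def
proof (intro allI impI)
  fix j x assume x: "\<bar>x\<bar> \<le> c k"
  have "norm (\<alpha> * (D a ^^ j) f x + \<beta> * (D a ^^ j) g x) \<le>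
     norm \<alpha> * norm ((D a ^^ j) f x) + norm \<beta> * norm ((D a ^^ j) g x)"
    by (metis norm_mult norm_triangle_ineq)
  also have "\<dots> \<le> norm \<alpha> * (A * wseq \<omega> q j) + norm \<beta> * (B * wseq \<omega> q j)"
    by (intro add_mono mult_left_mono bounded_byD[OF assms(3) x] bounded_byD[OF assms(4) x]) auto
  finally show "norm ((D a ^^ j) (\<lambda>x. \<alpha> * f x + \<beta> * g x) x) \<le> (norm \<alpha> * A + norm \<beta> * B) * wseq \<omega> q j"
    unfolding D_lincomb[OF assms(1,2)] by (simp add: algebra_simps)
qed

lemma U_lincomb:
  assumes "f \<in> U" "g \<in> U"
  shows "(\<lambda>x. \<alpha> * f x + \<beta> * g x) \<in> U"
proof -
  have "(\<lambda>x. \<alpha> * f x + \<beta> * g x) \<in> smooth_fns a"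
    using deriv_tower_smooth[OF deriv_tower_lincomb[OF U_tower[OF assms(1)] U_tower[OF assms(2)], of \<alpha> \<beta>]]
    by simp
  moreover have "\<exists>B. bounded_by q k (\<lambda>x. \<alpha> * f x + \<beta> * g x) B" if "0 < q" "q < 1" for q k
    using bounded_by_lincomb[OF assms] U_bounded[OF assms(1) that] U_bounded[OF assms(2) that] by blast
  ultimately show ?thesis by (simp add: U_iff)
qed

lemma U_diff: "f \<in> U \<Longrightarrow> g \<in> U \<Longrightarrow> (\<lambda>x. f x - g x) \<in> U"
  using U_lincomb[of f g 1 "-1"] by simp

lemma zero_bounded: "bounded_by q k (\<lambda>x. 0) 0"
proof -
  from deriv_tower_D[OF zero_deriv_tower] show ?thesis by (simp add: bounded_by_def)
qed

lemma zero_U: "(\<lambda>x. 0) \<in> U"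
proof -
  from deriv_tower_smooth[OF zero_deriv_tower] show ?thesis using zero_bounded by (auto simp: U_iff)
qed

subsection \<open>The dual space\<close>

text \<open>The subbasic sets are balls with arbitrary centres; the balls of a single norm around \<open>f\<close> still
  form a neighbourhood base at \<open>f\<close>, since the norms increase with both parameters.\<close>

lemma U_top_nbhd:
  assumes "openin (U_top a \<omega> c) V" "f \<in> V"
  shows "\<exists>q k \<epsilon>. 0 < q \<and> q < 1 \<and> 0 < \<epsilon> \<and> (\<forall>g\<in>U. bounded_by q k (\<lambda>x. g x - f x) \<epsilon> \<longrightarrow> g \<in> V)"
proof -
  let ?S = "{{g \<in> U. U_norm a \<omega> c q k (\<lambda>x. g x - f x) < ereal \<epsilon>} | f q k \<epsilon>.
        f \<in> U \<and> 0 < q \<and> q < 1 \<and> 0 < \<epsilon>}"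
  have "generate_topology_on ?S V"
    using assms(1) unfolding U_top_def by (rule openin_topology_generated_by)
  then show ?thesis using assms(2)
  proof (induction arbitrary: f rule: generate_topology_on.induct)
    case Empty
    then show ?case by simp
  next
    case (Int V V')
    obtain q k \<epsilon> where 1: "0 < q" "q < 1" "0 < \<epsilon>"
      "\<And>g. g \<in> U \<Longrightarrow> bounded_by q k (\<lambda>x. g x - f x) \<epsilon> \<Longrightarrow> g \<in> V"
      using Int.IH(1)[of f] Int.prems by blast
    obtain q' k' \<epsilon>' where 2: "0 < q'" "q' < 1" "0 < \<epsilon>'"
      "\<And>g. g \<in> U \<Longrightarrow> bounded_by q' k' (\<lambda>x. g x - f x) \<epsilon>' \<Longrightarrow> g \<in> V'"
      using Int.IH(2)[of f] Int.prems by blast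
    show ?case
    proof (intro exI conjI ballI impI)
      fix g assume g: "g \<in> U" and b: "bounded_by (max q q') (max k k') (\<lambda>x. g x - f x) (min \<epsilon> \<epsilon>')"
      have "bounded_by q k (\<lambda>x. g x - f x) \<epsilon>" "bounded_by q' k' (\<lambda>x. g x - f x) \<epsilon>'"
        by (rule bounded_by_mono[OF b]; use 1 2 in simp)+
      then show "g \<in> V \<inter> V'" using 1(4) 2(4) g by blast
    qed (use 1 2 in auto)
  next
    case (UN \<K>)
    then obtain V where V: "V \<in> \<K>" "f \<in> V" by blast
    show ?case using UN.IH[OF V] V(1) by blast
  next
    case (Basis V)
    then obtain h q k \<epsilon> where h: "h \<in> U" "0 < q" "q < 1" "0 < \<epsilon>"
      and V: "V = {g \<in> U. U_norm a \<omega> c q k (\<lambda>x. g x - h x) < ereal \<epsilon>}" by blast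
    have f: "f \<in> U" and fl: "U_norm a \<omega> c q k (\<lambda>x. f x - h x) < ereal \<epsilon>" using Basis.prems V by auto
    obtain e where e: "U_norm a \<omega> c q k (\<lambda>x. f x - h x) < ereal e" "ereal e < ereal \<epsilon>"
      using ereal_dense2[OF fl] by blast
    have be: "bounded_by q k (\<lambda>x. f x - h x) e" using e(1) U_norm_le_iff less_imp_le by blast
    show ?case
    proof (intro exI conjI ballI impI)
      fix g assume g: "g \<in> U" and b: "bounded_by q k (\<lambda>x. g x - f x) ((\<epsilon> - e) / 2)"
      have "bounded_by q k (\<lambda>x. 1 * (g x - f x) + 1 * (f x - h x)) (norm (1::complex) * ((\<epsilon> - e) / 2) + norm (1::complex) * e)"
        by (rule bounded_by_lincomb[OF U_diff[OF g f] U_diff[OF f h(1)] b be])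
      then have "U_norm a \<omega> c q k (\<lambda>x. g x - h x) \<le> ereal ((\<epsilon> - e) / 2 + e)"
        by (simp add: U_norm_le_iff)
      also have "\<dots> < ereal \<epsilon>" using e(2) by (simp add: field_simps)
      finally show "g \<in> V" using g V by simp
    qed (use h e in auto)
  qed
qed

lemma U_top_topspace: "topspace (U_top a \<omega> c) = U"
proof -
  have "f \<in> \<Union> {{g \<in> U. U_norm a \<omega> c q k (\<lambda>x. g x - f x) < ereal \<epsilon>} | f q k \<epsilon>.
        f \<in> U \<and> 0 < q \<and> q < 1 \<and> 0 < \<epsilon>}" if f: "f \<in> U" for f
  proof -
    have "U_norm a \<omega> c (1/2) 0 (\<lambda>x. f x - f x) \<le> ereal 0"
      using zero_bounded[of "1/2" 0] unfolding U_norm_le_iff by simp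
    also have "\<dots> < ereal 1" by simp
    finally have "f \<in> {g \<in> U. U_norm a \<omega> c (1/2) 0 (\<lambda>x. g x - f x) < ereal 1}" using f by simp
    moreover have "(0::real) < 1/2" "(1/2::real) < 1" "(0::real) < 1" by auto
    ultimately show ?thesis using f by blast
  qed
  then show ?thesis unfolding U_top_def topology_generated_by_topspace by blast
qed

lemma dual_bounded:
  assumes S: "S \<in> U_dual a \<omega> c"
  obtains q k C where "0 < q" "q < 1" "0 \<le> C"
    "\<And>f B. f \<in> U \<Longrightarrow> bounded_by q k f B \<Longrightarrow> norm (S f) \<le> C * B"
proof -
  have lin: "S (\<lambda>x. \<alpha> * f x + \<beta> * g x) = \<alpha> * S f + \<beta> * S g" if "f \<in> U" "g \<in> U" for f g \<alpha> \<beta>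
    using S that by (auto simp: U_dual_def)
  have S0: "S (\<lambda>x. 0) = 0" using lin[OF zero_U zero_U, of 0 0] by simp
  have cont: "continuous_map (U_top a \<omega> c) euclidean S" using S by (simp add: U_dual_def)
  let ?V = "{f \<in> topspace (U_top a \<omega> c). S f \<in> ball 0 1}"
  have "openin (U_top a \<omega> c) ?V"
    by (rule openin_continuous_map_preimage[OF cont]) (simp add: open_ball)
  moreover have "(\<lambda>x. 0) \<in> ?V" using zero_U S0 by (simp add: U_top_topspace)
  ultimately have "\<exists>q k \<epsilon>. 0 < q \<and> q < 1 \<and> 0 < \<epsilon> \<and> (\<forall>g\<in>U. bounded_by q k (\<lambda>x. g x - (\<lambda>x. 0) x) \<epsilon> \<longrightarrow> g \<in> ?V)"
    by (rule U_top_nbhd)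
  then obtain q k \<epsilon> where q: "0 < q" "q < 1" "0 < \<epsilon>"
    and small: "\<And>g. g \<in> U \<Longrightarrow> bounded_by q k g \<epsilon> \<Longrightarrow> norm (S g) < 1" by auto
  have "norm (S f) \<le> (1 / \<epsilon>) * B" if f: "f \<in> U" and B: "bounded_by q k f B" for f B
  proof -
    have "\<epsilon> * norm (S f) \<le> B'" if B': "B < B'" for B'
    proof -
      have B'0: "0 < B'" using bounded_by_nonneg[OF B] B' by simp
      define t where "t = \<epsilon> / B'"
      have t: "0 < t" using q B'0 by (simp add: t_def)
      let ?t = "of_real t :: complex"
      have b: "bounded_by q k (\<lambda>x. ?t * f x) (t * B)"
        using bounded_by_lincomb[OF f zero_U B zero_bounded, of ?t 0] t by simp
      have "t * B \<le> \<epsilon>"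
        using B' B'0 q bounded_by_nonneg[OF B] by (simp add: t_def field_simps)
      then have "bounded_by q k (\<lambda>x. ?t * f x) \<epsilon>"
        using bounded_by_mono[OF b q(1) order_refl order_refl] by simp
      moreover have "(\<lambda>x. ?t * f x) \<in> U" using U_lincomb[OF f zero_U, of ?t 0] by simp
      ultimately have "norm (S (\<lambda>x. ?t * f x)) < 1" using small by blast
      also have "S (\<lambda>x. ?t * f x) = ?t * S f" using lin[OF f zero_U, of ?t 0] by simp
      finally have "t * norm (S f) < 1" using t by (simp add: norm_mult)
      then show ?thesis using B'0 by (simp add: t_def field_simps)
    qed
    then have "\<epsilon> * norm (S f) \<le> B" by (rule dense_ge)
    then show ?thesis using q by (simp add: field_simps)
  qed
  then show ?thesis using that[of q "1 / \<epsilon>" k] q by auto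
qed

lemma dualI:
  assumes off: "\<And>f. f \<notin> U \<Longrightarrow> S f = 0"
    and lin: "\<And>f g \<alpha> \<beta>. f \<in> U \<Longrightarrow> g \<in> U \<Longrightarrow> S (\<lambda>x. \<alpha> * f x + \<beta> * g x) = \<alpha> * S f + \<beta> * S g"
    and q: "0 < q" "q < 1" and C: "0 \<le> C"
    and bnd: "\<And>f B. f \<in> U \<Longrightarrow> bounded_by q k f B \<Longrightarrow> norm (S f) \<le> C * B"
  shows "S \<in> U_dual a \<omega> c"
proof -
  have "openin (U_top a \<omega> c) {f \<in> U. S f \<in> Q}" if Q: "open Q" for Q
    unfolding openin_subopen[of _ "{f \<in> U. S f \<in> Q}"]
  proof
    fix f assume "f \<in> {f \<in> U. S f \<in> Q}"
    then have f: "f \<in> U" and fO: "S f \<in> Q" by auto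
    obtain e where e: "0 < e" "ball (S f) e \<subseteq> Q" using Q fO by (auto simp: open_contains_ball)
    define d where "d = e / (C + 1)"
    have d: "0 < d" using e C by (simp add: d_def)
    define T where "T = {g \<in> U. U_norm a \<omega> c q k (\<lambda>x. g x - f x) < ereal d}"
    have "openin (U_top a \<omega> c) T"
      unfolding U_top_def T_def by (rule topology_generated_by_Basis) (use f q d in blast)
    moreover have "f \<in> T"
    proof -
      have "U_norm a \<omega> c q k (\<lambda>x. f x - f x) \<le> ereal 0"
        using zero_bounded[of q k] unfolding U_norm_le_iff by simp
      also have "\<dots> < ereal d" using d by simp
      finally show ?thesis using f by (simp add: T_def)
    qed
    moreover have "T \<subseteq> {f \<in> U. S f \<in> Q}"
    proof
      fix g assume "g \<in> T"
      then have g: "g \<in> U" and "U_norm a \<omega> c q k (\<lambda>x. g x - f x) \<le> ereal d"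
        by (auto simp: T_def)
      then have b: "bounded_by q k (\<lambda>x. g x - f x) d" by (simp add: U_norm_le_iff)
      have "S (\<lambda>x. g x - f x) = S g - S f" using lin[OF g f, of 1 "-1"] by simp
      then have "norm (S g - S f) \<le> C * d" using bnd[OF U_diff[OF g f] b] by simp
      also have "\<dots> < e" using e C by (simp add: d_def field_simps)
      finally have "S g \<in> ball (S f) e" by (simp add: dist_norm norm_minus_commute)
      then show "g \<in> {f \<in> U. S f \<in> Q}" using e g by blast
    qed
    ultimately show "\<exists>T. openin (U_top a \<omega> c) T \<and> f \<in> T \<and> T \<subseteq> {f \<in> U. S f \<in> Q}" by blast
  qed
  then have "continuous_map (U_top a \<omega> c) euclidean S"
    by (simp add: continuous_map_def U_top_topspace)
  then show ?thesis using off lin by (auto simp: U_dual_def)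
qed

end

context ultra_space
begin

subsection \<open>Operations on ultradifferentiable functions\<close>

text \<open>The exponentials with real exponent, extended by zero. The Fourier-Laplace transform on the
  imaginary axis is the value of the functional on these.\<close>

definition exp_fn :: "real \<Rightarrow> real \<Rightarrow> complex" where
  "exp_fn l = (\<lambda>t. if t \<in> sym_interval a then of_real (exp (l * t)) else 0)"

lemma D_exp_fn:
  "(D a ^^ j) (exp_fn l) t = (if t \<in> sym_interval a then of_real (l ^ j * exp (l * t)) else 0)"
  using deriv_tower_D[OF exp_deriv_tower[of a l], of j] by (simp add: exp_fn_def cong: if_cong)

lemma bounded_by_exp_fn:
  assumes q: "0 < q"
  shows "bounded_by q k (exp_fn l) (exp (q * \<omega> (max 1 \<bar>l\<bar>)) * exp (\<bar>l\<bar> * c k))"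
  unfolding bounded_by_def
proof (intro allI impI)
  fix j x assume x: "\<bar>x\<bar> \<le> c k"
  let ?x = "max 1 \<bar>l\<bar>"
  have "l * x \<le> \<bar>l\<bar> * c k"
    using order_trans[OF abs_ge_self, of "l * x" "\<bar>l\<bar> * c k"] mult_left_mono[OF x, of "\<bar>l\<bar>"]
    by (simp add: abs_mult)
  then have e: "exp (l * x) \<le> exp (\<bar>l\<bar> * c k)" by simp
  have "\<bar>l\<bar> ^ j \<le> ?x ^ j" by (rule power_mono) auto
  also have "\<dots> \<le> wseq \<omega> q j * exp (q * \<omega> ?x)" by (rule power_le_wseq[OF q]) simp
  finally have p: "\<bar>l\<bar> ^ j \<le> wseq \<omega> q j * exp (q * \<omega> ?x)" .
  have "norm ((D a ^^ j) (exp_fn l) x) = \<bar>l\<bar> ^ j * exp (l * x)"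
    using c_in[OF x] by (simp add: D_exp_fn norm_mult norm_power)
  also have "\<dots> \<le> (wseq \<omega> q j * exp (q * \<omega> ?x)) * exp (\<bar>l\<bar> * c k)"
    by (rule mult_mono[OF p e]) simp_all
  finally show "norm ((D a ^^ j) (exp_fn l) x) \<le> exp (q * \<omega> ?x) * exp (\<bar>l\<bar> * c k) * wseq \<omega> q j"
    by (simp only: mult_ac)
qed

lemma exp_fn_U: "exp_fn l \<in> U"
proof -
  have "exp_fn l \<in> smooth_fns a"
    using deriv_tower_smooth[OF exp_deriv_tower[of a l]] by (simp add: exp_fn_def cong: if_cong)
  then show ?thesis using bounded_by_exp_fn by (auto simp: U_iff)
qed

lemma D_mult:
  assumes "f \<in> U" "g \<in> U"
  shows "(D a ^^ j) (\<lambda>x. f x * g x) x =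
    (\<Sum>i\<le>j. of_nat (j choose i) * (D a ^^ i) f x * (D a ^^ (j - i)) g x)"
  using deriv_tower_D[OF deriv_tower_mult[OF U_tower[OF assms(1)] U_tower[OF assms(2)]], of j] by simp

lemma D_mult_bound:
  assumes "0 < q" "q < q'"
  shows "\<exists>C>0. \<forall>f\<in>U. \<forall>g\<in>U. \<forall>x A B. (\<forall>i. norm ((D a ^^ i) f x) \<le> A * wseq \<omega> q' i) \<longrightarrow>
       (\<forall>i. norm ((D a ^^ i) g x) \<le> B * wseq \<omega> q' i) \<longrightarrow>
       (\<forall>j. norm ((D a ^^ j) (\<lambda>x. f x * g x) x) \<le> C * A * B * wseq \<omega> q j)"
proof -
  obtain C where C: "0 < C"
    "\<And>j. (\<Sum>i\<le>j. real (j choose i) * wseq \<omega> q' i * wseq \<omega> q' (j - i)) \<le> C * wseq \<omega> q j"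
    using wseq_conv_sum[OF assms] by metis
  have "norm ((D a ^^ j) (\<lambda>x. f x * g x) x) \<le> C * A * B * wseq \<omega> q j"
    if f: "f \<in> U" and g: "g \<in> U" and A: "\<And>i. norm ((D a ^^ i) f x) \<le> A * wseq \<omega> q' i"
      and B: "\<And>i. norm ((D a ^^ i) g x) \<le> B * wseq \<omega> q' i" for f g x A B j
  proof -
    have A0: "0 \<le> A" using order_trans[OF norm_ge_zero A[of 0]] by (simp add: zero_le_mult_iff)
    have B0: "0 \<le> B" using order_trans[OF norm_ge_zero B[of 0]] by (simp add: zero_le_mult_iff)
    have "norm ((D a ^^ j) (\<lambda>x. f x * g x) x) \<le>
       (\<Sum>i\<le>j. norm (of_nat (j choose i) * (D a ^^ i) f x * (D a ^^ (j - i)) g x))"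
      unfolding D_mult[OF f g] by (rule norm_sum)
    also have "\<dots> = (\<Sum>i\<le>j. real (j choose i) * (norm ((D a ^^ i) f x) * norm ((D a ^^ (j - i)) g x)))"
      by (simp add: norm_mult mult.assoc)
    also have "\<dots> \<le> (\<Sum>i\<le>j. real (j choose i) * ((A * wseq \<omega> q' i) * (B * wseq \<omega> q' (j - i))))"
      by (intro sum_mono mult_left_mono mult_mono A B) (auto simp: A0)
    also have "\<dots> = A * B * (\<Sum>i\<le>j. real (j choose i) * wseq \<omega> q' i * wseq \<omega> q' (j - i))"
      by (simp add: sum_distrib_left mult_ac)
    also have "\<dots> \<le> A * B * (C * wseq \<omega> q j)" using C(2)[of j] A0 B0 by (intro mult_left_mono) auto
    finally show ?thesis by (simp add: mult_ac)
  qed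
  then show ?thesis using C(1) by blast
qed

lemma U_mult:
  assumes "f \<in> U" "g \<in> U"
  shows "(\<lambda>x. f x * g x) \<in> U"
proof -
  have "\<exists>B. bounded_by q k (\<lambda>x. f x * g x) B" if q: "0 < q" "q < 1" for q k
  proof -
    obtain q' where q': "q < q'" "q' < 1" using q(2) dense by blast
    obtain A B where A: "bounded_by q' k f A" and B: "bounded_by q' k g B"
      using U_bounded[OF assms(1), of q' k] U_bounded[OF assms(2), of q' k] q q' by auto
    obtain C where C: "\<forall>f\<in>U. \<forall>g\<in>U. \<forall>x A B. (\<forall>i. norm ((D a ^^ i) f x) \<le> A * wseq \<omega> q' i) \<longrightarrow>
       (\<forall>i. norm ((D a ^^ i) g x) \<le> B * wseq \<omega> q' i) \<longrightarrow>
       (\<forall>j. norm ((D a ^^ j) (\<lambda>x. f x * g x) x) \<le> C * A * B * wseq \<omega> q j)"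
      using D_mult_bound[OF q(1) q'(1)] by blast
    have "bounded_by q k (\<lambda>x. f x * g x) (C * A * B)"
      unfolding bounded_by_def
    proof (intro allI impI)
      fix j x assume x: "\<bar>x\<bar> \<le> c k"
      show "norm ((D a ^^ j) (\<lambda>x. f x * g x) x) \<le> C * A * B * wseq \<omega> q j"
        using C assms bounded_byD[OF A x] bounded_byD[OF B x] by blast
    qed
    then show ?thesis by blast
  qed
  moreover have "(\<lambda>x. f x * g x) \<in> smooth_fns a"
    using deriv_tower_smooth[OF deriv_tower_mult[OF U_tower[OF assms(1)] U_tower[OF assms(2)]]] by simp
  ultimately show ?thesis by (simp add: U_iff)
qed

lemma D_reflect:
  assumes "f \<in> U"
  shows "(D a ^^ j) (\<lambda>x. f (- x)) x = (- 1) ^ j * (D a ^^ j) f (- x)"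
  using deriv_tower_D[OF deriv_tower_reflect[OF U_tower[OF assms]], of j] by simp

lemma bounded_by_reflect:
  assumes "f \<in> U" "bounded_by q k f B"
  shows "bounded_by q k (\<lambda>x. f (- x)) B"
  using assms(2) unfolding bounded_by_def D_reflect[OF assms(1)]
  by (simp add: norm_mult norm_power)

lemma U_reflect:
  assumes "f \<in> U"
  shows "(\<lambda>x. f (- x)) \<in> U"
proof -
  have "(\<lambda>x. f (- x)) \<in> smooth_fns a"
    using deriv_tower_smooth[OF deriv_tower_reflect[OF U_tower[OF assms]]] by simp
  then show ?thesis using bounded_by_reflect[OF assms] U_bounded[OF assms] by (fastforce simp: U_iff)
qed

lemma has_vector_derivative_zero_truncate:
  fixes h :: "real \<Rightarrow> complex"
  assumes h: "(h has_vector_derivative 0) (at p)" and "h p = 0"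
  shows "((\<lambda>x. if p < x then h x else 0) has_vector_derivative 0) (at p)"
proof -
  have "((\<lambda>y. norm ((h y - h p) - 0) / norm (y - p)) \<longlongrightarrow> 0) (at p)"
    using h unfolding has_vector_derivative_def has_derivative_iff_norm by simp
  then have lim: "((\<lambda>y. norm (h y) / norm (y - p)) \<longlongrightarrow> 0) (at p)" using assms(2) by simp
  have "((\<lambda>y. norm (if p < y then h y else 0) / norm (y - p)) \<longlongrightarrow> 0) (at p)"
    by (rule tendsto_sandwich[OF _ _ tendsto_const lim]) (auto intro!: always_eventually divide_right_mono)
  then show ?thesis
    unfolding has_vector_derivative_def has_derivative_iff_norm by simp
qed

lemma right_part_tower:
  assumes F: "deriv_tower a F" and p: "\<And>j. F j p = 0"
  shows "deriv_tower a (\<lambda>j x. if p < x then F j x else 0)"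
  unfolding deriv_tower_def
proof (intro conjI allI ballI impI)
  fix j x assume x: "x \<in> sym_interval a"
  note d = deriv_tower_deriv[OF F x, of j]
  consider "x < p" | "x = p" | "p < x" by linarith
  then show "((\<lambda>x. if p < x then F j x else 0) has_vector_derivative
      (if p < x then F (Suc j) x else 0)) (at x)"
  proof cases
    case 1
    have "((\<lambda>x. 0::complex) has_vector_derivative 0) (at x)" by simp
    then have "((\<lambda>x. if p < x then F j x else 0) has_vector_derivative 0) (at x)"
      by (rule has_vector_derivative_cong_open[of _ _ _ "{..<p}"]) (use 1 in auto)
    then show ?thesis using 1 by simp
  next
    case 2
    then show ?thesis
      using has_vector_derivative_zero_truncate[of "F j" p] d p by simp
  next
    case 3
    have "((\<lambda>x. if p < x then F j x else 0) has_vector_derivative F (Suc j) x) (at x)"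
      by (rule has_vector_derivative_cong_open[OF d, of "{p<..}"]) (use 3 in auto)
    then show ?thesis using 3 by simp
  qed
qed (use F in \<open>auto simp: deriv_tower_def\<close>)

text \<open>A function flat at \<open>p\<close> splits at \<open>p\<close> into two functions of the space.\<close>

lemma right_part_U:
  assumes f: "f \<in> U" and p: "\<And>j. (D a ^^ j) f p = 0"
  shows "(\<lambda>x. if p < x then f x else 0) \<in> U"
proof -
  note t = right_part_tower[OF U_tower[OF f] p]
  have "\<exists>B. bounded_by q k (\<lambda>x. if p < x then f x else 0) B" if q: "0 < q" "q < 1" for q k
  proof -
    obtain B where B: "bounded_by q k f B" using U_bounded[OF f q] by blast
    have "norm (if p < x then (D a ^^ j) f x else 0) \<le> B * wseq \<omega> q j" if "\<bar>x\<bar> \<le> c k" for j x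
      using bounded_byD[OF B that, of j] bounded_by_nonneg[OF B] by simp
    then have "bounded_by q k (\<lambda>x. if p < x then f x else 0) B"
      using deriv_tower_D[OF t] by (simp add: bounded_by_def cong: if_cong)
    then show ?thesis by blast
  qed
  moreover have "(\<lambda>x. if p < x then f x else 0) \<in> smooth_fns a"
    using deriv_tower_smooth[OF t] by (simp cong: if_cong)
  ultimately show ?thesis by (simp add: U_iff)
qed

lemma D_zero_left:
  assumes f: "f \<in> U" and z: "\<And>x. x \<le> d \<Longrightarrow> f x = 0" and d: "d \<in> sym_interval a" and x: "x \<le> d"
  shows "(D a ^^ j) f x = 0"
proof (cases "x \<in> sym_interval a")
  case True
  obtain k where k: "\<bar>x\<bar> < c k" using c_above[OF True] .
  have k1: "- c k \<in> sym_interval a" by (rule c_in[of _ k]) (use c_pos[of k] in simp)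
  let ?I = "{- c k..d}"
  have "\<forall>y\<in>?I. (D a ^^ j) f y = 0"
  proof (rule D_pow_zero_on_interval[of f a _ "- c k" d])
    show "f \<in> smooth_fns a" using f by (simp add: U_iff)
    show "?I \<subseteq> sym_interval a" using sym_interval_convexD[OF k1 d] by auto
  qed (use k x z in \<open>auto simp: is_interval_cc\<close>)
  then show ?thesis using k x by auto
next
  case False
  then show ?thesis using deriv_tower_zero[OF U_tower[OF f]] by blast
qed

lemma D_cong_open:
  assumes "open Q" "\<And>x. x \<in> Q \<Longrightarrow> f x = g x" "x \<in> Q"
  shows "(D a ^^ j) f x = (D a ^^ j) g x"
  using assms(3)
proof (induction j arbitrary: x)
  case (Suc j)
  have "eventually (\<lambda>y. (D a ^^ j) f y = (D a ^^ j) g y) (nhds x)"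
    using eventually_nhds_in_open[OF assms(1) Suc.prems] by eventually_elim (rule Suc.IH)
  then have "vector_derivative ((D a ^^ j) f) (at x) = vector_derivative ((D a ^^ j) g) (at x)"
    by (intro vector_derivative_cong_eq) (auto intro: Suc.IH Suc.prems)
  then show ?case by (simp add: D_def[of a "(D a ^^ j) f"] D_def[of a "(D a ^^ j) g"])
qed (simp add: assms(2))

lemma D_eq_0_open:
  assumes "open Q" "\<And>x. x \<in> Q \<Longrightarrow> f x = 0" "x \<in> Q"
  shows "(D a ^^ j) f x = 0"
proof -
  from deriv_tower_D[OF zero_deriv_tower] show ?thesis using D_cong_open[of Q f "\<lambda>x. 0" x j] assms by simp
qed

subsection \<open>Linearity and reflection of functionals\<close>

lemma dual_lin:
  assumes "S \<in> U_dual a \<omega> c" "f \<in> U" "g \<in> U"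
  shows "S (\<lambda>x. \<alpha> * f x + \<beta> * g x) = \<alpha> * S f + \<beta> * S g"
  using assms by (simp add: U_dual_def)

lemma dual_add: "S \<in> U_dual a \<omega> c \<Longrightarrow> f \<in> U \<Longrightarrow> g \<in> U \<Longrightarrow> S (\<lambda>x. f x + g x) = S f + S g"
  using dual_lin[of S f g 1 1] by simp

lemma dual_diff: "S \<in> U_dual a \<omega> c \<Longrightarrow> f \<in> U \<Longrightarrow> g \<in> U \<Longrightarrow> S (\<lambda>x. f x - g x) = S f - S g"
  using dual_lin[of S f g 1 "-1"] by simp

lemma dual_zero: "S \<in> U_dual a \<omega> c \<Longrightarrow> S (\<lambda>x. 0) = 0"
  using dual_lin[OF _ zero_U zero_U, of S 0 0] by simp

lemma U_sum:
  assumes "finite K" "\<And>k. k \<in> K \<Longrightarrow> f k \<in> U"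
  shows "(\<lambda>x. \<Sum>k\<in>K. \<alpha> k * f k x) \<in> U"
  using assms
proof (induction K rule: finite_induct)
  case (insert k K)
  then show ?case using U_lincomb[of "f k" "\<lambda>x. \<Sum>k\<in>K. \<alpha> k * f k x" "\<alpha> k" 1] by simp
qed (simp add: zero_U)

lemma D_sum:
  assumes "finite K" "\<And>k. k \<in> K \<Longrightarrow> f k \<in> U"
  shows "(D a ^^ j) (\<lambda>x. \<Sum>k\<in>K. \<alpha> k * f k x) x = (\<Sum>k\<in>K. \<alpha> k * (D a ^^ j) (f k) x)"
  using assms
proof (induction K rule: finite_induct)
  case empty
  from deriv_tower_D[OF zero_deriv_tower] show ?case by simp
next
  case (insert k K)
  then show ?case
    using D_lincomb[of "f k" "\<lambda>x. \<Sum>k\<in>K. \<alpha> k * f k x" j "\<alpha> k" 1 x] U_sum[of K f \<alpha>] by simp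
qed

lemma dual_sum:
  assumes S: "S \<in> U_dual a \<omega> c" and "finite K" "\<And>k. k \<in> K \<Longrightarrow> f k \<in> U"
  shows "S (\<lambda>x. \<Sum>k\<in>K. \<alpha> k * f k x) = (\<Sum>k\<in>K. \<alpha> k * S (f k))"
  using assms(2,3)
proof (induction K rule: finite_induct)
  case (insert k K)
  then show ?case
    using dual_lin[OF S, of "f k" "\<lambda>x. \<Sum>k\<in>K. \<alpha> k * f k x" "\<alpha> k" 1] U_sum[of K f \<alpha>] by simp
qed (simp add: dual_zero[OF S])

text \<open>The reflection of a functional, which exchanges the two ends of the indicator segment.\<close>

definition reflect_dual :: "((real \<Rightarrow> complex) \<Rightarrow> complex) \<Rightarrow> (real \<Rightarrow> complex) \<Rightarrow> complex" where
  "reflect_dual S f = (if f \<in> U then S (\<lambda>x. f (- x)) else 0)"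

lemma reflect_dual:
  assumes S: "S \<in> U_dual a \<omega> c"
  shows "reflect_dual S \<in> U_dual a \<omega> c"
proof -
  obtain q k C where C: "0 < q" "q < 1" "0 \<le> C"
    "\<And>f B. f \<in> U \<Longrightarrow> bounded_by q k f B \<Longrightarrow> norm (S f) \<le> C * B"
    using dual_bounded[OF S] by metis
  show ?thesis
  proof (rule dualI[OF _ _ C(1-3), of _ k])
    fix f g \<alpha> \<beta> assume f: "f \<in> U" and g: "g \<in> U"
    then show "reflect_dual S (\<lambda>x. \<alpha> * f x + \<beta> * g x) = \<alpha> * reflect_dual S f + \<beta> * reflect_dual S g"
      using dual_lin[OF S U_reflect[OF f] U_reflect[OF g]] by (simp add: reflect_dual_def U_lincomb)
  next
    fix f B assume f: "f \<in> U" "bounded_by q k f B"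
    show "norm (reflect_dual S f) \<le> C * B"
      using C(4)[OF U_reflect[OF f(1)] bounded_by_reflect[OF f]] f by (simp add: reflect_dual_def)
  qed (simp add: reflect_dual_def)
qed

lemma exp_fn_reflect: "(\<lambda>x. exp_fn l (- x)) = exp_fn (- l)"
  by (simp add: exp_fn_def fun_eq_iff sym_interval_uminus)

lemma reflect_dual_exp: "reflect_dual S (exp_fn l) = S (exp_fn (- l))"
  by (simp add: reflect_dual_def exp_fn_U exp_fn_reflect)

lemma reflect_dual_reflect: "f \<in> U \<Longrightarrow> reflect_dual S (\<lambda>x. f (- x)) = S f"
  by (simp add: reflect_dual_def U_reflect)

end

section \<open>Recovering the support from the growth on the imaginary axis\<close>

text \<open>The coefficients of \<open>1 - exp (- z) = \<Sum>k\<ge>1. step_coeff k * z ^ k\<close>. At \<open>z = exp (n s)\<close> the sum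
  tends to the Heaviside function of \<open>s\<close> as \<open>n \<rightarrow> \<infinity>\<close>.\<close>

definition step_coeff :: "nat \<Rightarrow> real" where
  "step_coeff k = - ((- 1) ^ k / fact k)"

lemma norm_step_coeff: "\<bar>step_coeff k\<bar> = 1 / fact k"
  by (simp add: step_coeff_def abs_divide power_abs)

lemma sum_inverse_fact_le: "(\<Sum>k=1..N. 1 / fact k) \<le> exp (1::real)"
proof -
  have "(\<Sum>k=1..N. 1 / fact k :: real) = (\<Sum>k\<in>{1..N}. inverse (fact k) * 1 ^ k)"
    by (simp add: field_simps)
  also have "\<dots> \<le> (\<Sum>k. inverse (fact k) * 1 ^ k)"
    by (rule sum_le_suminf[OF summable_exp]) auto
  also have "\<dots> = exp (1::real)" by (simp add: exp_def field_simps)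
  finally show ?thesis .
qed

lemma exp_tail_uniform:
  fixes Z e :: real
  assumes "0 < e"
  obtains N where "\<And>z. 0 \<le> z \<Longrightarrow> z \<le> Z \<Longrightarrow> \<bar>(\<Sum>k=1..N. step_coeff k * z ^ k) - (1 - exp (- z))\<bar> \<le> e"
proof -
  have "(\<lambda>N. inverse (fact N) * (max Z 0) ^ N) \<longlonglongrightarrow> 0"
    using summable_LIMSEQ_zero[OF summable_exp[of "max Z 0"]] .
  then have "(\<lambda>N. exp Z * (inverse (fact N) * (max Z 0) ^ N)) \<longlonglongrightarrow> 0"
    by (rule tendsto_mult_right_zero)
  then have "eventually (\<lambda>N. exp Z * (inverse (fact N) * (max Z 0) ^ N) < e) sequentially"
    using assms by (rule order_tendstoD)
  then obtain N0 where N0: "\<And>N. N \<ge> N0 \<Longrightarrow> exp Z * (inverse (fact N) * (max Z 0) ^ N) < e"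
    by (auto simp: eventually_sequentially)
  have "\<bar>(\<Sum>k=1..N0. step_coeff k * z ^ k) - (1 - exp (- z))\<bar> \<le> e" if z: "0 \<le> z" "z \<le> Z" for z
  proof -
    obtain t where t: "\<bar>t\<bar> \<le> \<bar>- z\<bar>"
      "exp (- z) = (\<Sum>m<Suc N0. (- z) ^ m / fact m) + exp t / fact (Suc N0) * (- z) ^ Suc N0"
      using Maclaurin_exp_le[of "- z" "Suc N0"] by blast
    have "(\<Sum>m<Suc N0. (- z) ^ m / fact m) = 1 + (\<Sum>m=1..N0. (- z) ^ m / fact m)"
      by (simp add: lessThan_Suc_atMost atMost_atLeast0 sum.atLeast_Suc_atMost)
    also have "(\<Sum>m=1..N0. (- z) ^ m / fact m) = - (\<Sum>k=1..N0. step_coeff k * z ^ k)"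
      by (simp add: step_coeff_def sum_negf[symmetric] power_minus[of z])
    finally have "(\<Sum>k=1..N0. step_coeff k * z ^ k) - (1 - exp (- z)) =
        exp t / fact (Suc N0) * (- z) ^ Suc N0" using t(2) by simp
    then have "\<bar>(\<Sum>k=1..N0. step_coeff k * z ^ k) - (1 - exp (- z))\<bar> = exp t / fact (Suc N0) * z ^ Suc N0"
      using z by (simp add: abs_mult power_abs del: power_Suc fact_Suc)
    also have "\<dots> \<le> exp Z / fact (Suc N0) * Z ^ Suc N0"
      using t z by (intro mult_mono divide_right_mono power_mono) auto
    also have "\<dots> = exp Z * (inverse (fact (Suc N0)) * (max Z 0) ^ Suc N0)"
      using z by (simp add: field_simps max_def del: power_Suc fact_Suc)
    also have "\<dots> \<le> e" using N0[of "Suc N0"] by simp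
    finally show ?thesis .
  qed
  then show ?thesis by (rule that)
qed

lemma exp_decay:
  fixes \<eta> e M :: real
  assumes "0 < \<eta>" "0 < e"
  shows "\<exists>L::nat. \<forall>n\<ge>L. M * exp (- (real n * \<eta>)) \<le> e"
proof -
  obtain L :: nat where L: "\<bar>M\<bar> / e / \<eta> < real L" using reals_Archimedean2 by blast
  have "M * exp (- (real n * \<eta>)) \<le> e" if "L \<le> n" for n
  proof -
    have "\<bar>M\<bar> / e / \<eta> < real n" using L that by (meson less_le_trans of_nat_le_iff)
    then have "\<bar>M\<bar> \<le> e * (real n * \<eta>)" using assms by (simp add: field_simps)
    also have "\<dots> \<le> e * exp (real n * \<eta>)"
      using assms order_trans[OF _ exp_ge_add_one_self, of "real n * \<eta>"] by (intro mult_left_mono) auto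
    finally have "M \<le> e * exp (real n * \<eta>)" by simp
    then show ?thesis by (simp add: exp_minus field_simps)
  qed
  then show ?thesis by blast
qed

text \<open>An exponential polynomial with frequencies \<open>n, 2 n, \<dots>, N n\<close>; for large \<open>n\<close> and suitable \<open>N\<close>
  it approximates the Heaviside function, shifted by \<open>\<delta>\<close> to the right, off an interval of
  length \<open>2 \<delta>\<close>.\<close>

definition step_sum :: "nat \<Rightarrow> nat \<Rightarrow> real \<Rightarrow> real \<Rightarrow> real" where
  "step_sum n N \<delta> s = (\<Sum>k=1..N. step_coeff k * exp (real (k * n) * (s - \<delta>)))"

lemma step_sum_approximation:
  fixes \<delta> \<tau> R :: real
  assumes "0 < \<delta>" "0 < \<tau>" "\<tau> \<le> 1"
  shows "\<exists>L. \<forall>n\<ge>L. \<exists>N. \<forall>s\<le>R. (s \<le> 0 \<longrightarrow> \<bar>step_sum n N \<delta> s\<bar> \<le> \<tau>) \<and>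
     (2 * \<delta> \<le> s \<longrightarrow> \<bar>step_sum n N \<delta> s - 1\<bar> \<le> \<tau>) \<and> \<bar>step_sum n N \<delta> s - 1\<bar> \<le> 2"
proof -
  obtain L :: nat where L: "\<forall>n\<ge>L. 1 * exp (- (real n * \<delta>)) \<le> \<tau> / 2"
    using exp_decay[of \<delta> "\<tau> / 2" 1] assms by auto
  show ?thesis
  proof (rule exI[of _ L], intro allI impI)
    fix n assume n: "L \<le> n"
    have dec: "exp (- (real n * \<delta>)) \<le> \<tau> / 2" using L n by simp
    obtain N where N: "\<And>z. 0 \<le> z \<Longrightarrow> z \<le> exp (real n * (R - \<delta>)) \<Longrightarrow>
        \<bar>(\<Sum>k=1..N. step_coeff k * z ^ k) - (1 - exp (- z))\<bar> \<le> \<tau> / 2"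
      using exp_tail_uniform[of "\<tau> / 2"] assms by (metis half_gt_zero)
    have "(s \<le> 0 \<longrightarrow> \<bar>step_sum n N \<delta> s\<bar> \<le> \<tau>) \<and>
        (2 * \<delta> \<le> s \<longrightarrow> \<bar>step_sum n N \<delta> s - 1\<bar> \<le> \<tau>) \<and> \<bar>step_sum n N \<delta> s - 1\<bar> \<le> 2"
      if s: "s \<le> R" for s
    proof -
      define z where "z = exp (real n * (s - \<delta>))"
      define E where "E = step_sum n N \<delta> s"
      have z0: "0 < z" by (simp add: z_def)
      have zR: "z \<le> exp (real n * (R - \<delta>))" using s by (simp add: z_def mult_left_mono)
      have "exp (real (k * n) * (s - \<delta>)) = z ^ k" for k
        by (simp add: z_def exp_of_nat_mult[symmetric] mult.assoc)
      then have E: "\<bar>E - (1 - exp (- z))\<bar> \<le> \<tau> / 2" using N[of z] z0 zR by (simp add: E_def step_sum_def)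
      have ez: "0 < exp (- z)" "exp (- z) \<le> 1" using z0 by auto
      have 1: "\<bar>E\<bar> \<le> \<tau>" if "s \<le> 0"
      proof -
        have "1 - exp (- z) \<le> z" using exp_ge_add_one_self[of "- z"] by simp
        also have "real n * s \<le> 0" using that by (simp add: mult_nonneg_nonpos)
        then have "z \<le> exp (- (real n * \<delta>))" by (simp add: z_def right_diff_distrib)
        finally have "1 - exp (- z) \<le> \<tau> / 2" using dec by simp
        then show ?thesis using E ez by linarith
      qed
      have 2: "\<bar>E - 1\<bar> \<le> \<tau>" if "2 * \<delta> \<le> s"
      proof -
        have "real n * \<delta> \<le> real n * (s - \<delta>)" using that by (intro mult_left_mono) auto
        also have "\<dots> \<le> z" unfolding z_def by (rule order_trans[OF _ exp_ge_add_one_self]) simp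
        finally have "exp (- z) \<le> exp (- (real n * \<delta>))" by simp
        then show ?thesis using E ez dec by linarith
      qed
      have 3: "\<bar>E - 1\<bar> \<le> 2" using E ez assms by linarith
      show ?thesis using 1 2 3 by (simp add: E_def)
    qed
    then show "\<exists>N. \<forall>s\<le>R. (s \<le> 0 \<longrightarrow> \<bar>step_sum n N \<delta> s\<bar> \<le> \<tau>) \<and>
        (2 * \<delta> \<le> s \<longrightarrow> \<bar>step_sum n N \<delta> s - 1\<bar> \<le> \<tau>) \<and> \<bar>step_sum n N \<delta> s - 1\<bar> \<le> 2"
      by blast
  qed
qed

text \<open>Repeated integration by parts of a Laplace integral over \<open>[d;e]\<close> of a function flat at \<open>d\<close>.\<close>

lemma laplace_by_parts:
  fixes F :: "nat \<Rightarrow> real \<Rightarrow> complex"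
  assumes de: "d \<le> e"
    and F: "\<And>i x. x \<in> {d..e} \<Longrightarrow> (F i has_vector_derivative F (Suc i) x) (at x)"
    and flat: "\<And>i. F i d = 0"
  shows "of_real (l ^ j) * integral {d..e} (\<lambda>x. F 1 x * of_real (exp (- l * x))) =
    integral {d..e} (\<lambda>x. F (Suc j) x * of_real (exp (- l * x))) -
    (\<Sum>i=1..j. of_real (l ^ (j - i) * exp (- l * e)) * F i e)"
proof -
  define I where "I i = integral {d..e} (\<lambda>x. F i x * of_real (exp (- l * x)))" for i
  have cont: "continuous_on {d..e} (F i)" for i
    by (intro continuous_at_imp_continuous_on ballI has_vector_derivative_continuous[OF F])
  have int: "(\<lambda>x. F i x * of_real (exp (- l * x))) integrable_on {d..e}" for i
    by (intro integrable_continuous_real continuous_intros cont)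
  have step: "of_real l * I i = I (Suc i) - F i e * of_real (exp (- l * e))" for i
  proof -
    have "((\<lambda>x. F i x * of_real (exp (- l * x))) has_vector_derivative
        F i x * of_real (exp (- l * x) * (- l)) + F (Suc i) x * of_real (exp (- l * x))) (at x within {d..e})"
      if x: "x \<in> {d..e}" for x
    proof -
      have "((\<lambda>x. exp (- l * x)) has_field_derivative exp (- l * x) * (- l)) (at x)"
        by (auto intro!: derivative_eq_intros)
      then have "((\<lambda>x. of_real (exp (- l * x)) :: complex) has_vector_derivative of_real (exp (- l * x) * (- l))) (at x)"
        by (intro has_vector_derivative_of_real)
      from has_vector_derivative_mult[OF F[OF x, of i] this]
      show ?thesis by (rule has_vector_derivative_at_within)
    qed
    then have "((\<lambda>x. F i x * of_real (exp (- l * x) * (- l)) + F (Suc i) x * of_real (exp (- l * x)))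
        has_integral F i e * of_real (exp (- l * e)) - F i d * of_real (exp (- l * d))) {d..e}"
      by (rule fundamental_theorem_of_calculus[OF de])
    also have "(\<lambda>x. F i x * of_real (exp (- l * x) * (- l)) + F (Suc i) x * of_real (exp (- l * x))) =
       (\<lambda>x. (- of_real l) * (F i x * of_real (exp (- l * x))) + F (Suc i) x * of_real (exp (- l * x)))"
      by (simp add: fun_eq_iff)
    also have "F i e * of_real (exp (- l * e)) - F i d * of_real (exp (- l * d)) = F i e * of_real (exp (- l * e))"
      by (simp only: flat mult_zero_left diff_zero)
    finally have h1: "((\<lambda>x. (- of_real l) * (F i x * of_real (exp (- l * x))) + F (Suc i) x * of_real (exp (- l * x)))
        has_integral F i e * of_real (exp (- l * e))) {d..e}" .
    have "((\<lambda>x. (- of_real l) * (F i x * of_real (exp (- l * x))) + F (Suc i) x * of_real (exp (- l * x)))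
        has_integral (- of_real l) * I i + I (Suc i)) {d..e}"
      unfolding I_def by (intro has_integral_add has_integral_mult_right integrable_integral int)
    from has_integral_unique[OF this h1]
    show ?thesis by (simp add: algebra_simps)
  qed
  have "of_real (l ^ j) * I 1 = I (Suc j) - (\<Sum>i=1..j. of_real (l ^ (j - i) * exp (- l * e)) * F i e)"
  proof (induction j)
    case (Suc j)
    have "of_real (l ^ Suc j) * I 1 = of_real l * (of_real (l ^ j) * I 1)" by simp
    also have "\<dots> = of_real l * I (Suc j) - of_real l * (\<Sum>i=1..j. of_real (l ^ (j - i) * exp (- l * e)) * F i e)"
      unfolding Suc by (simp add: algebra_simps)
    also have "of_real l * (\<Sum>i=1..j. of_real (l ^ (j - i) * exp (- l * e)) * F i e) =
       (\<Sum>i=1..j. of_real (l ^ (Suc j - i) * exp (- l * e)) * F i e)"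
      unfolding sum_distrib_left by (rule sum.cong) (auto simp: Suc_diff_le)
    also have "of_real l * I (Suc j) = I (Suc (Suc j)) - F (Suc j) e * of_real (exp (- l * e))" by (rule step)
    finally show ?case by (simp add: algebra_simps)
  qed simp
  then show ?thesis by (simp add: I_def)
qed

lemma integral_step_bound:
  fixes G :: "real \<Rightarrow> complex" and \<psi> :: "real \<Rightarrow> real"
  assumes "d \<le> e" "0 \<le> \<delta>" "0 \<le> \<tau>" "0 \<le> B"
    and G: "continuous_on {d..e} G" "\<And>x. x \<in> {d..e} \<Longrightarrow> norm (G x) \<le> B"
    and int: "(\<lambda>x. G x * of_real (\<psi> x)) integrable_on {d..e}"
    and far: "\<And>x. x \<in> {d..e} \<Longrightarrow> x \<notin> {t - 2 * \<delta>..t} \<Longrightarrow> \<bar>\<psi> x\<bar> \<le> \<tau>"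
    and near: "\<And>x. x \<in> {d..e} \<Longrightarrow> \<bar>\<psi> x\<bar> \<le> 2"
  shows "norm (integral {d..e} (\<lambda>x. G x * of_real (\<psi> x))) \<le> B * (\<tau> * (e - d) + 4 * \<delta>)"
proof -
  let ?h = "\<lambda>x. if x \<in> {t - 2 * \<delta>..t} then 2 * B else (0::real)"
  have hU: "(?h has_integral 4 * \<delta> * B) UNIV"
    using has_integral_const_real[of "2 * B" "t - 2 * \<delta>" t] assms(2)
    unfolding has_integral_restrict_UNIV by (simp add: mult_ac)
  then have hi: "?h integrable_on UNIV" by blast
  have hd: "?h integrable_on {d..e}"
    using integrable_on_subcbox[OF hi, of d e] by simp
  have hle: "integral {d..e} ?h \<le> 4 * \<delta> * B"
    using integral_subset_le[OF _ hd hi] integral_unique[OF hU] assms(4) by fastforce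
  have "norm (integral {d..e} (\<lambda>x. G x * of_real (\<psi> x))) \<le> integral {d..e} (\<lambda>x. B * \<tau> + ?h x)"
  proof (rule integral_norm_bound_integral[OF int])
    show "(\<lambda>x. B * \<tau> + ?h x) integrable_on {d..e}" by (intro integrable_add hd) auto
    fix x assume x: "x \<in> {d..e}"
    show "norm (G x * of_real (\<psi> x)) \<le> B * \<tau> + ?h x"
    proof (cases "x \<in> {t - 2 * \<delta>..t}")
      case True
      have "norm (G x) * \<bar>\<psi> x\<bar> \<le> B * 2" using G(2)[OF x] near[OF x] assms(4) by (intro mult_mono) auto
      moreover have "0 \<le> B * \<tau>" using assms by simp
      ultimately show ?thesis using True by (simp add: norm_mult)
    next
      case False
      have "norm (G x) * \<bar>\<psi> x\<bar> \<le> B * \<tau>" using G(2)[OF x] far[OF x False] assms(4) by (intro mult_mono) auto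
      then show ?thesis unfolding if_not_P[OF False] by (simp add: norm_mult)
    qed
  qed
  also have "\<dots> = integral {d..e} (\<lambda>x. B * \<tau>) + integral {d..e} ?h"
    by (rule integral_add) (use hd in auto)
  also have "\<dots> \<le> B * \<tau> * (e - d) + 4 * \<delta> * B" using hle assms(1) by (simp add: mult_ac)
  finally show ?thesis by (simp add: algebra_simps)
qed

context ultra_space
begin

text \<open>An exponential polynomial with frequencies \<open>n, 2 n, \<dots>\<close> at distance at most \<open>T \<delta>\<close> from \<open>f\<close>,
  with coefficients so small that its value under a functional which grows like \<open>exp (d r)\<close> on the
  exponentials tends to \<open>0\<close> as \<open>n \<rightarrow> \<infinity>\<close>.\<close>

definition exp_approx :: "real \<Rightarrow> nat \<Rightarrow> (real \<Rightarrow> complex) \<Rightarrow> real \<Rightarrow> real \<Rightarrow> real \<Rightarrow> nat \<Rightarrow> bool" where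
  "exp_approx q k f d T \<delta> n \<longleftrightarrow> (\<exists>N \<alpha>.
     bounded_by q k (\<lambda>t. (\<Sum>k=1..N. \<alpha> k * exp_fn (real (k * n)) t) - f t) (T * \<delta>) \<and>
     (\<forall>k. norm (\<alpha> k) \<le> T * (exp (- real (k * n) * (d + \<delta>)) / fact k)))"

text \<open>Let \<open>f\<close> vanish to the left of \<open>d\<close>, and let \<open>e\<close> lie to the right of \<open>d\<close> and \<open>c k\<close>. The
  approximant is the convolution
  \<open>g t = \<integral> f' x * step_sum n N \<delta> (t - x) dx\<close> over \<open>[d;e]\<close>, which is an exponential polynomial in \<open>t\<close>.
  Integration by parts turns its \<open>j\<close>-th derivative into the same integral with the derivative of
  \<open>f\<close> of order \<open>j + 1\<close>, which is close to the \<open>j\<close>-th derivative of \<open>f\<close>, up to boundary terms at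
  \<open>e\<close>. These are small because \<open>t - e\<close> is bounded away from \<open>0\<close> for \<open>t \<le> c k\<close>.\<close>

lemma exponential_approximation:
  assumes f: "f \<in> U" and d: "d \<in> sym_interval a" and z: "\<And>x. x \<le> d \<Longrightarrow> f x = 0"
    and q: "0 < q" "q < 1"
  shows "\<exists>T\<ge>0. \<forall>\<delta>. 0 < \<delta> \<longrightarrow> \<delta> \<le> 1 \<longrightarrow> (\<exists>L. \<forall>n\<ge>L. 0 < n \<longrightarrow>
     exp_approx q k f d T \<delta> n)"
proof -
  (* The endpoint e also dominates - d, so that [d;e] lies in [-e;e], where f is under control. *)
  have "max \<bar>d\<bar> (c k) \<in> sym_interval a"
    using d c_in[of "c k" k] c_pos[of k] sym_interval_uminus[of d a] by (auto simp: max_def abs_if)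
  then obtain k' where k': "\<bar>max \<bar>d\<bar> (c k)\<bar> < c k'" by (rule c_above)
  define e where "e = c k'"
  have de: "d < e" "- e < d" and ce: "c k < e" using k' by (auto simp: e_def)
  have e_in: "e \<in> sym_interval a" unfolding e_def by (rule c_in[of _ k']) (use c_pos[of k'] in simp)
  obtain q' where q': "q < q'" "q' < 1" using q(2) dense by blast
  have q'0: "0 < q'" using q q' by simp
  obtain C1 where C1: "0 < C1" "\<And>j. wseq \<omega> q' (Suc j) \<le> C1 * wseq \<omega> q j"
    using wseq_Suc[OF q(1) q'(1)] by metis
  obtain C2 where C2: "0 < C2"
    "\<And>j. (\<Sum>i\<le>j. real (j choose i) * wseq \<omega> q' i * wseq \<omega> q' (j - i)) \<le> C2 * wseq \<omega> q j"
    using wseq_conv_sum[OF q(1) q'(1)] by metis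
  obtain A where A: "bounded_by q' k' f A" using U_bounded[OF f q'0 q'(2)] by blast
  have A0: "0 \<le> A" by (rule bounded_by_nonneg[OF A])
  define F where "F j = (D a ^^ j) f" for j
  have Fd: "(F j has_vector_derivative F (Suc j) x) (at x)" if "x \<in> sym_interval a" for j x
    using deriv_tower_deriv[OF U_tower[OF f] that] by (simp add: F_def)
  have FA: "norm (F j x) \<le> A * wseq \<omega> q' j" if "\<bar>x\<bar> \<le> e" for j x
    using bounded_byD[OF A] that by (simp add: F_def e_def)
  have Fz: "F j x = 0" if "x \<le> d" for j x
    using D_zero_left[OF f z d that] by (simp add: F_def)
  have in_de: "x \<in> sym_interval a" if "x \<in> {d..e}" for x
    using sym_interval_convexD[OF d e_in] that by simp
  have Fcont: "continuous_on {d..e} (F j)" for j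
    by (intro continuous_at_imp_continuous_on ballI has_vector_derivative_continuous[OF Fd] in_de)
  define I where "I j l = integral {d..e} (\<lambda>x. F j x * of_real (exp (- l * x)))" for j l
  have Iint: "(\<lambda>x. F j x * of_real (exp (- l * x))) integrable_on {d..e}" for j l
    by (intro integrable_continuous_real continuous_intros Fcont)
  have parts: "of_real (l ^ j) * I 1 l = I (Suc j) l - (\<Sum>i=1..j. of_real (l ^ (j - i) * exp (- l * e)) * F i e)" for l j
    unfolding I_def by (rule laplace_by_parts) (use de in_de Fd Fz in auto)
  have I1: "norm (I 1 l) \<le> A * wseq \<omega> q' 1 * (e - d) * exp (- l * d)" if "0 \<le> l" for l
  proof -
    have "norm (I 1 l) \<le> (A * wseq \<omega> q' 1 * exp (- l * d)) * (e - d)"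
      unfolding I_def
    proof (rule integral_bound)
      show "norm (F 1 x * of_real (exp (- l * x))) \<le> A * wseq \<omega> q' 1 * exp (- l * d)"
        if "x \<in> {d..e}" for x
        unfolding norm_mult
        using that de \<open>0 \<le> l\<close> FA[of x 1] A0 by (intro mult_mono) (auto simp: mult_left_mono)
    qed (use de Fcont in \<open>auto intro!: continuous_intros\<close>)
    then show ?thesis by (simp add: mult_ac)
  qed
  define T where "T = A * (C1 * (e - d + 4) + C2) + A * wseq \<omega> q' 1 * (e - d)"
  have T1: "A * wseq \<omega> q' 1 * (e - d) \<le> T" and T2: "A * (C1 * (e - d + 4) + C2) \<le> T" and T0: "0 \<le> T"
    using A0 C1 C2 de by (auto simp: T_def)
  have main: "\<exists>L. \<forall>n\<ge>L. 0 < n \<longrightarrow>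
     exp_approx q k f d T \<delta> n"
    if \<delta>: "0 < \<delta>" "\<delta> \<le> 1" for \<delta>
  proof -
    (* The distance that makes the boundary terms decay like exp (- n \<eta> / 2); the other half of
       exp (- n \<eta>) absorbs the weight. *)
    define \<eta> where "\<eta> = e + \<delta> - c k"
    have \<eta>: "0 < \<eta>" using ce \<delta> by (simp add: \<eta>_def)
    obtain K where K: "\<And>x. 0 \<le> x \<Longrightarrow> \<omega> x \<le> (\<eta> / 2) * x + K"
      using omega_le_linear[of "\<eta> / 2"] \<eta> by (metis half_gt_zero)
    obtain L1 where L1: "\<forall>n\<ge>L1. \<exists>N. \<forall>s\<le>2 * e. (s \<le> 0 \<longrightarrow> \<bar>step_sum n N \<delta> s\<bar> \<le> \<delta>) \<and>
        (2 * \<delta> \<le> s \<longrightarrow> \<bar>step_sum n N \<delta> s - 1\<bar> \<le> \<delta>) \<and> \<bar>step_sum n N \<delta> s - 1\<bar> \<le> 2"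
      using step_sum_approximation[OF \<delta>(1) \<delta>] by blast
    obtain L2 :: nat where L2: "\<forall>n\<ge>L2. exp (K + 1) * exp (- (real n * (\<eta> / 2))) \<le> \<delta>"
      using exp_decay[of "\<eta> / 2" \<delta> "exp (K + 1)"] \<eta> \<delta> by auto
    have "exp_approx q k f d T \<delta> n" if n: "max L1 L2 \<le> n" "0 < n" for n
    proof -
      define l where "l k = real (k * n)" for k
      have l1: "real n \<le> l k" "1 \<le> l k" if "1 \<le> k" for k
      proof -
        have "n \<le> k * n" "1 \<le> k * n" using that n(2) by auto
        then show "real n \<le> l k" "1 \<le> l k" unfolding l_def by linarith+
      qed
      have l0: "0 \<le> l k" for k by (simp add: l_def)
      obtain N where N: "\<forall>s\<le>2 * e. (s \<le> 0 \<longrightarrow> \<bar>step_sum n N \<delta> s\<bar> \<le> \<delta>) \<and>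
          (2 * \<delta> \<le> s \<longrightarrow> \<bar>step_sum n N \<delta> s - 1\<bar> \<le> \<delta>) \<and> \<bar>step_sum n N \<delta> s - 1\<bar> \<le> 2"
        using L1 n by auto
      define E where "E = step_sum n N \<delta>"
      have E_def': "E s = (\<Sum>k=1..N. step_coeff k * exp (l k * (s - \<delta>)))" for s
        by (simp only: E_def step_sum_def l_def)
      have E: "s \<le> 0 \<Longrightarrow> \<bar>E s\<bar> \<le> \<delta>" "2 * \<delta> \<le> s \<Longrightarrow> \<bar>E s - 1\<bar> \<le> \<delta>" "\<bar>E s - 1\<bar> \<le> 2"
        if "s \<le> 2 * e" for s
        using N that unfolding E_def by blast+
      define \<alpha> where "\<alpha> k = of_real (step_coeff k * exp (- l k * \<delta>)) * I 1 (l k)" for k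
      define g where "g t = (\<Sum>k=1..N. \<alpha> k * exp_fn (l k) t)" for t
      have gU: "g \<in> U" unfolding g_def[abs_def] by (rule U_sum) (auto simp: exp_fn_U)
      have \<alpha>: "norm (\<alpha> k) \<le> T * (exp (- l k * (d + \<delta>)) / fact k)" for k
      proof -
        have "norm (\<alpha> k) = exp (- l k * \<delta>) / fact k * norm (I 1 (l k))"
          by (simp add: \<alpha>_def norm_mult norm_step_coeff)
        also have "\<dots> \<le> exp (- l k * \<delta>) / fact k * (A * wseq \<omega> q' 1 * (e - d) * exp (- l k * d))"
          by (intro mult_left_mono I1 l0) simp
        also have "\<dots> \<le> exp (- l k * \<delta>) / fact k * (T * exp (- l k * d))"
          by (intro mult_left_mono mult_right_mono T1) simp_all
        also have "\<dots> = T * ((exp (- l k * d) * exp (- l k * \<delta>)) / fact k)" by simp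
        also have "exp (- l k * d) * exp (- l k * \<delta>) = exp (- l k * (d + \<delta>))"
          unfolding exp_add[symmetric] by (simp add: algebra_simps)
        finally show ?thesis .
      qed
      have bound: "norm ((D a ^^ j) g t - F j t) \<le> T * \<delta> * wseq \<omega> q j" if t: "\<bar>t\<bar> \<le> c k" for j t
      proof -
        have t_in: "t \<in> sym_interval a" by (rule c_in[OF t])
        have te: "t < e" using t ce by simp
        define w where "w k = step_coeff k * exp (l k * (t - \<delta>))" for k
        define R where "R = (\<Sum>k=1..N. of_real (w k) * (\<Sum>i=1..j. of_real (l k ^ (j - i) * exp (- l k * e)) * F i e))"
        have "(D a ^^ j) g t = (\<Sum>k=1..N. \<alpha> k * of_real (l k ^ j * exp (l k * t)))"
          using D_sum[of "{1..N}" "\<lambda>k. exp_fn (l k)" j \<alpha> t] t_in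
          by (simp add: exp_fn_U D_exp_fn g_def[abs_def])
        also have "\<dots> = (\<Sum>k=1..N. of_real (w k) * (of_real (l k ^ j) * I 1 (l k)))"
        proof (rule sum.cong)
          fix k
          have "exp (l k * (t - \<delta>)) = exp (- l k * \<delta>) * exp (l k * t)"
            unfolding exp_add[symmetric] by (simp add: algebra_simps)
          then show "\<alpha> k * of_real (l k ^ j * exp (l k * t)) = of_real (w k) * (of_real (l k ^ j) * I 1 (l k))"
            by (simp add: \<alpha>_def w_def del: of_real_exp)
        qed simp
        also have "\<dots> = (\<Sum>k=1..N. of_real (w k) * I (Suc j) (l k)) - R"
          unfolding R_def parts by (simp add: right_diff_distrib sum_subtractf)
        also have "(\<Sum>k=1..N. of_real (w k) * I (Suc j) (l k)) =
            integral {d..e} (\<lambda>x. \<Sum>k=1..N. of_real (w k) * (F (Suc j) x * of_real (exp (- l k * x))))"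
        proof -
          have ii: "(\<lambda>x. of_real (w k) * (F (Suc j) x * of_real (exp (- l k * x)))) integrable_on {d..e}" for k
            by (rule integrable_on_mult_right[OF Iint])
          show ?thesis
            unfolding I_def integral_sum[OF finite_atLeastAtMost ii] integral_mult_right ..
        qed
        also have "(\<lambda>x. \<Sum>k=1..N. of_real (w k) * (F (Suc j) x * of_real (exp (- l k * x)))) =
           (\<lambda>x. F (Suc j) x * of_real (E (t - x)))"
        proof
          fix x
          have "exp (l k * (t - x - \<delta>)) = exp (l k * (t - \<delta>)) * exp (- l k * x)" for k
            unfolding exp_add[symmetric] by (simp add: algebra_simps)
          then show "(\<Sum>k=1..N. of_real (w k) * (F (Suc j) x * of_real (exp (- l k * x)))) =
              F (Suc j) x * of_real (E (t - x))"
            by (simp add: E_def' w_def sum_distrib_left mult_ac del: of_real_exp)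
        qed
        finally have Dg: "(D a ^^ j) g t = integral {d..e} (\<lambda>x. F (Suc j) x * of_real (E (t - x))) - R" .
        have i1: "(\<lambda>x. F (Suc j) x * of_real (E (t - x))) integrable_on {d..e}"
          unfolding E_def' by (intro integrable_continuous_real continuous_intros Fcont)
        let ?H = "\<lambda>x. if x \<in> {d..t} then F (Suc j) x else 0"
        have Fj: "(?H has_integral F j t) {d..e}"
        proof -
          have "(F (Suc j) has_integral F j t) {d..t}"
          proof (cases "d \<le> t")
            case True
            have "(F (Suc j) has_integral F j t - F j d) {d..t}"
              by (rule fundamental_theorem_of_calculus[OF True])
                (use te in \<open>auto intro!: has_vector_derivative_at_within Fd in_de\<close>)
            then show ?thesis using Fz[of d] by simp
          next
            case False
            then show ?thesis using Fz[of t] by simp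
          qed
          then show ?thesis using te by (subst has_integral_restrict) auto
        qed
        (* The error of the step function: small off an interval of length 2 \<delta>, and at most 2. *)
        define \<psi> where "\<psi> x = E (t - x) - (if x \<le> t then 1 else 0)" for x
        have "((\<lambda>x. F (Suc j) x * of_real (E (t - x)) - ?H x) has_integral
            integral {d..e} (\<lambda>x. F (Suc j) x * of_real (E (t - x))) - F j t) {d..e}"
          by (intro has_integral_diff integrable_integral i1 Fj)
        then have hi: "((\<lambda>x. F (Suc j) x * of_real (\<psi> x)) has_integral
            integral {d..e} (\<lambda>x. F (Suc j) x * of_real (E (t - x))) - F j t) {d..e}"
          by (rule has_integral_eq[rotated]) (auto simp: \<psi>_def algebra_simps)
        have "norm (integral {d..e} (\<lambda>x. F (Suc j) x * of_real (\<psi> x))) \<le>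
            (A * wseq \<omega> q' (Suc j)) * (\<delta> * (e - d) + 4 * \<delta>)"
        proof (rule integral_step_bound[where t = t])
          show "(\<lambda>x. F (Suc j) x * of_real (\<psi> x)) integrable_on {d..e}" using hi by blast
          fix x assume x: "x \<in> {d..e}"
          have s: "t - x \<le> 2 * e" using x te de by simp
          show "norm (F (Suc j) x) \<le> A * wseq \<omega> q' (Suc j)" using x de by (intro FA) auto
          show "\<bar>\<psi> x\<bar> \<le> \<delta>" if "x \<notin> {t - 2 * \<delta>..t}"
            using E(1,2)[OF s] that by (cases "x \<le> t") (auto simp: \<psi>_def)
          show "\<bar>\<psi> x\<bar> \<le> 2"
            using E(1,3)[OF s] \<delta> by (cases "x \<le> t") (auto simp: \<psi>_def)
        qed (use de \<delta> A0 Fcont in auto)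
        also have "\<dots> \<le> (A * (C1 * wseq \<omega> q j)) * (\<delta> * (e - d) + 4 * \<delta>)"
          using C1(2)[of j] A0 de \<delta> by (intro mult_right_mono mult_left_mono) auto
        finally have b1: "norm (integral {d..e} (\<lambda>x. F (Suc j) x * of_real (E (t - x))) - F j t) \<le>
            A * (C1 * (e - d + 4)) * \<delta> * wseq \<omega> q j"
          unfolding integral_unique[OF hi] by (simp add: algebra_simps)
        have boundary: "norm (of_real (w k) * (of_real (l k ^ (j - i) * exp (- l k * e)) * F i e)) \<le>
            1 / fact k * (exp K * exp (- (real n * (\<eta> / 2))) * A * (wseq \<omega> q' i * wseq \<omega> q' (j - i)))"
          if k: "1 \<le> k" for k i
        proof -
          have "q' * \<omega> (l k) \<le> 1 * \<omega> (l k)"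
            using q' omega_nonneg[OF l0] by (intro mult_right_mono) auto
          also have "\<dots> \<le> \<eta> / 2 * l k + K" using K[OF l0] by simp
          finally have "exp (q' * \<omega> (l k)) \<le> exp (\<eta> / 2 * l k + K)" by simp
          then have p: "l k ^ (j - i) \<le> wseq \<omega> q' (j - i) * exp (\<eta> / 2 * l k + K)"
            using power_le_wseq[OF q'0 l1(2)[OF k], of "j - i"]
            by (meson mult_left_mono order_trans wseq_nonneg)
          have "l k * (t - \<delta>) + - l k * e = l k * (t - \<delta> - e)" by (simp add: algebra_simps)
          also have "\<dots> \<le> l k * (- \<eta>)" using t l0 by (intro mult_left_mono) (auto simp: \<eta>_def)
          finally have x: "exp (l k * (t - \<delta>)) * exp (- l k * e) \<le> exp (- l k * \<eta>)"
            unfolding exp_add[symmetric] by simp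
          have "norm (of_real (w k) * (of_real (l k ^ (j - i) * exp (- l k * e)) * F i e)) =
            1 / fact k * ((exp (l k * (t - \<delta>)) * exp (- l k * e)) * l k ^ (j - i) * norm (F i e))"
            using l0 by (simp add: w_def norm_mult norm_power abs_mult norm_step_coeff)
          also have "\<dots> \<le> 1 / fact k * (exp (- l k * \<eta>) * (wseq \<omega> q' (j - i) * exp (\<eta> / 2 * l k + K)) *
              (A * wseq \<omega> q' i))"
            using x p FA[of e i] c_pos[of k'] l0
            by (intro mult_left_mono mult_mono) (auto simp: e_def A0)
          also have "\<dots> = 1 / fact k * (exp K * exp (- (l k * (\<eta> / 2))) * A * (wseq \<omega> q' i * wseq \<omega> q' (j - i)))"
          proof -
            have "exp (- l k * \<eta>) * exp (\<eta> / 2 * l k + K) = exp K * exp (- (l k * (\<eta> / 2)))"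
              unfolding exp_add[symmetric] by (simp add: algebra_simps)
            then show ?thesis by (simp add: mult_ac)
          qed
          also have "\<dots> \<le> 1 / fact k * (exp K * exp (- (real n * (\<eta> / 2))) * A * (wseq \<omega> q' i * wseq \<omega> q' (j - i)))"
            using l1(1)[OF k] \<eta> A0
            by (intro mult_left_mono mult_right_mono) (auto intro!: mult_right_mono)
          finally show ?thesis .
        qed
        have "norm R \<le> (\<Sum>k=1..N. \<Sum>i=1..j. norm (of_real (w k) * (of_real (l k ^ (j - i) * exp (- l k * e)) * F i e)))"
          unfolding R_def sum_distrib_left by (intro order_trans[OF norm_sum] sum_mono norm_sum)
        also have "\<dots> \<le> (\<Sum>k=1..N. \<Sum>i=1..j.
            1 / fact k * (exp K * exp (- (real n * (\<eta> / 2))) * A * (wseq \<omega> q' i * wseq \<omega> q' (j - i))))"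
          by (intro sum_mono boundary) auto
        also have "\<dots> = (\<Sum>k=1..N. 1 / fact k) * ((exp K * exp (- (real n * (\<eta> / 2))) * A) *
            (\<Sum>i=1..j. wseq \<omega> q' i * wseq \<omega> q' (j - i)))"
          by (simp add: sum_distrib_left sum_distrib_right mult_ac) (rule sum.swap)
        also have "\<dots> \<le> exp 1 * ((exp K * exp (- (real n * (\<eta> / 2))) * A) * (C2 * wseq \<omega> q j))"
        proof (intro mult_mono sum_inverse_fact_le mult_left_mono)
          have "(\<Sum>i=1..j. wseq \<omega> q' i * wseq \<omega> q' (j - i)) \<le>
              (\<Sum>i=1..j. real (j choose i) * wseq \<omega> q' i * wseq \<omega> q' (j - i))"
          proof (rule sum_mono)
            fix i assume "i \<in> {1..j}"
            then have "1 \<le> real (j choose i)" by (simp add: Suc_leI)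
            then have "1 * (wseq \<omega> q' i * wseq \<omega> q' (j - i)) \<le> real (j choose i) * (wseq \<omega> q' i * wseq \<omega> q' (j - i))"
              by (rule mult_right_mono) simp
            then show "wseq \<omega> q' i * wseq \<omega> q' (j - i) \<le> real (j choose i) * wseq \<omega> q' i * wseq \<omega> q' (j - i)"
              by (simp add: mult_ac)
          qed
          also have "\<dots> \<le> (\<Sum>i\<le>j. real (j choose i) * wseq \<omega> q' i * wseq \<omega> q' (j - i))"
            by (intro sum_mono2) auto
          also have "\<dots> \<le> C2 * wseq \<omega> q j" by (rule C2(2))
          finally show "(\<Sum>i=1..j. wseq \<omega> q' i * wseq \<omega> q' (j - i)) \<le> C2 * wseq \<omega> q j" .
        qed (use A0 in \<open>auto intro!: sum_nonneg mult_nonneg_nonneg\<close>)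
        also have "\<dots> = A * C2 * (exp (K + 1) * exp (- (real n * (\<eta> / 2)))) * wseq \<omega> q j"
          by (simp add: exp_add mult_ac)
        also have "\<dots> \<le> A * C2 * \<delta> * wseq \<omega> q j"
          using L2 n A0 C2(1) by (intro mult_right_mono mult_left_mono) auto
        finally have b2: "norm R \<le> A * C2 * \<delta> * wseq \<omega> q j" .
        have "norm ((D a ^^ j) g t - F j t) \<le>
           norm (integral {d..e} (\<lambda>x. F (Suc j) x * of_real (E (t - x))) - F j t) + norm R"
          unfolding Dg using norm_triangle_ineq4[of "integral {d..e} (\<lambda>x. F (Suc j) x * of_real (E (t - x))) - F j t" R]
          by (simp add: algebra_simps)
        also have "\<dots> \<le> A * (C1 * (e - d + 4)) * \<delta> * wseq \<omega> q j + A * C2 * \<delta> * wseq \<omega> q j"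
          by (rule add_mono[OF b1 b2])
        also have "\<dots> = (A * (C1 * (e - d + 4) + C2)) * \<delta> * wseq \<omega> q j" by (simp add: algebra_simps)
        also have "\<dots> \<le> T * \<delta> * wseq \<omega> q j" using T2 \<delta> by (intro mult_right_mono) auto
        finally show ?thesis .
      qed
      have "bounded_by q k (\<lambda>t. g t - f t) (T * \<delta>)"
        unfolding bounded_by_def
      proof (intro allI impI)
        fix j t assume t: "\<bar>t\<bar> \<le> c k"
        have "(D a ^^ j) (\<lambda>t. g t - f t) t = (D a ^^ j) g t - F j t"
          using D_lincomb[OF gU f, of j 1 "-1" t] by (simp add: F_def)
        then show "norm ((D a ^^ j) (\<lambda>t. g t - f t) t) \<le> T * \<delta> * wseq \<omega> q j" using bound[OF t] by simp
      qed
      then have "bounded_by q k (\<lambda>t. (\<Sum>k=1..N. \<alpha> k * exp_fn (real (k * n)) t) - f t) (T * \<delta>)"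
        by (simp only: g_def l_def)
      moreover have "\<forall>k. norm (\<alpha> k) \<le> T * (exp (- real (k * n) * (d + \<delta>)) / fact k)"
        using \<alpha> by (simp only: l_def) simp
      ultimately show ?thesis unfolding exp_approx_def by blast
    qed
    then show ?thesis by blast
  qed
  show ?thesis using T0 main by blast
qed

text \<open>The support theorem. It is a real-variable argument in the spirit of Mikusinski's bounded moment
  theorem: no bound on the transform of \<open>S\<close> off the imaginary axis is needed.\<close>

lemma kills_right:
  assumes S: "S \<in> U_dual a \<omega> c" and f: "f \<in> U" and d: "d \<in> sym_interval a"
    and z: "\<And>x. x \<le> d \<Longrightarrow> f x = 0"
    and growth: "\<And>\<epsilon>. 0 < \<epsilon> \<Longrightarrow> eventually (\<lambda>r. norm (S (exp_fn r)) \<le> exp ((d + \<epsilon>) * r)) at_top"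
  shows "S f = 0"
proof -
  obtain q k C where q: "0 < q" "q < 1" and C: "0 \<le> C"
    "\<And>f B. f \<in> U \<Longrightarrow> bounded_by q k f B \<Longrightarrow> norm (S f) \<le> C * B"
    using dual_bounded[OF S] by metis
  obtain T where T: "0 \<le> T" and approx: "\<And>\<delta>. 0 < \<delta> \<Longrightarrow> \<delta> \<le> 1 \<Longrightarrow> \<exists>L. \<forall>n\<ge>L. 0 < n \<longrightarrow>
     exp_approx q k f d T \<delta> n"
    using exponential_approximation[OF f d z q, of k] by blast
  have main: "norm (S f) \<le> (C * T + T) * \<delta>" if \<delta>: "0 < \<delta>" "\<delta> \<le> 1" for \<delta>
  proof -
    obtain L where L: "\<forall>n\<ge>L. 0 < n \<longrightarrow>
     exp_approx q k f d T \<delta> n"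
      using approx[OF \<delta>] by blast
    obtain r0 where r0: "\<And>r. r0 \<le> r \<Longrightarrow> norm (S (exp_fn r)) \<le> exp ((d + \<delta> / 2) * r)"
      using growth[of "\<delta> / 2"] \<delta> by (auto simp: eventually_at_top_linorder)
    obtain L' :: nat where L': "\<forall>n\<ge>L'. exp 1 * exp (- (real n * (\<delta> / 2))) \<le> \<delta>"
      using exp_decay[of "\<delta> / 2" \<delta> "exp 1"] \<delta> by auto
    obtain L0 :: nat where L0: "r0 \<le> real L0" using real_arch_simple by blast
    define n where "n = Suc (max L (max L' L0))"
    have n: "L \<le> n" "L' \<le> n" "L0 \<le> n" "0 < n" by (auto simp: n_def)
    obtain N and \<alpha> :: "nat \<Rightarrow> complex" where
      b: "bounded_by q k (\<lambda>t. (\<Sum>k=1..N. \<alpha> k * exp_fn (real (k * n)) t) - f t) (T * \<delta>)" and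
      \<alpha>: "\<And>k. norm (\<alpha> k) \<le> T * (exp (- real (k * n) * (d + \<delta>)) / fact k)"
      using L n unfolding exp_approx_def by blast
    define g where "g t = (\<Sum>k=1..N. \<alpha> k * exp_fn (real (k * n)) t)" for t
    have gU: "g \<in> U" unfolding g_def[abs_def] by (rule U_sum) (auto simp: exp_fn_U)
    have "norm (S (\<lambda>t. g t - f t)) \<le> C * (T * \<delta>)"
      by (rule C(2)[OF U_diff[OF gU f]]) (use b in \<open>simp add: g_def\<close>)
    then have 1: "norm (S g - S f) \<le> C * (T * \<delta>)" using dual_diff[OF S gU f] by simp
    have "S g = (\<Sum>k=1..N. \<alpha> k * S (exp_fn (real (k * n))))"
      unfolding g_def[abs_def] by (rule dual_sum[OF S]) (auto simp: exp_fn_U)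
    also have "norm \<dots> \<le> (\<Sum>k=1..N. norm (\<alpha> k * S (exp_fn (real (k * n)))))" by (rule norm_sum)
    also have "\<dots> \<le> (\<Sum>k=1..N. T * exp (- (real n * (\<delta> / 2))) * (1 / fact k))"
    proof (rule sum_mono)
      fix k assume k: "k \<in> {1..N}"
      have "n \<le> k * n" using k by simp
      then have nk: "real n \<le> real (k * n)" by (simp only: of_nat_le_iff)
      then have "r0 \<le> real (k * n)" using L0 n by linarith
      then have "norm (\<alpha> k * S (exp_fn (real (k * n)))) \<le>
          (T * (exp (- real (k * n) * (d + \<delta>)) / fact k)) * exp ((d + \<delta> / 2) * real (k * n))"
        unfolding norm_mult by (intro mult_mono \<alpha> r0) (use T in auto)
      also have "\<dots> = T * (exp (- real (k * n) * (d + \<delta>)) * exp ((d + \<delta> / 2) * real (k * n))) * (1 / fact k)"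
        by simp
      also have "exp (- real (k * n) * (d + \<delta>)) * exp ((d + \<delta> / 2) * real (k * n)) = exp (- (real (k * n) * (\<delta> / 2)))"
        unfolding exp_add[symmetric] by (simp add: algebra_simps)
      also have "\<dots> \<le> exp (- (real n * (\<delta> / 2)))"
        using mult_right_mono[OF nk, of "\<delta> / 2"] \<delta> by simp
      finally show "norm (\<alpha> k * S (exp_fn (real (k * n)))) \<le> T * exp (- (real n * (\<delta> / 2))) * (1 / fact k)"
        using T by (simp add: mult_left_mono divide_right_mono)
    qed
    also have "\<dots> = T * exp (- (real n * (\<delta> / 2))) * (\<Sum>k=1..N. 1 / fact k)"
      by (simp add: sum_distrib_left)
    also have "\<dots> \<le> T * exp (- (real n * (\<delta> / 2))) * exp 1"
      by (intro mult_left_mono sum_inverse_fact_le) (use T in auto)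
    also have "\<dots> = T * (exp 1 * exp (- (real n * (\<delta> / 2))))" by simp
    also have "\<dots> \<le> T * \<delta>" using L' n T by (intro mult_left_mono) auto
    finally have 2: "norm (S g) \<le> T * \<delta>" .
    have "norm (S f) \<le> norm (S g) + norm (S g - S f)"
      by (metis norm_minus_commute norm_triangle_sub)
    then show ?thesis using 1 2 by (simp add: algebra_simps)
  qed
  have "norm (S f) \<le> 0"
  proof (rule ccontr)
    assume "\<not> norm (S f) \<le> 0"
    then have p: "0 < norm (S f)" by simp
    define M where "M = C * T + T + norm (S f)"
    have M: "0 < M" "norm (S f) \<le> M" using C T p by (auto simp: M_def intro: add_nonneg_pos)
    have "norm (S f) \<le> (C * T + T) * (norm (S f) / (2 * M))"
    proof (rule main)
      show "0 < norm (S f) / (2 * M)" using p M(1) by (intro divide_pos_pos) simp_all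
      have "norm (S f) \<le> 2 * M" using M by linarith
      then show "norm (S f) / (2 * M) \<le> 1" using M(1) by (simp add: divide_le_eq_1)
    qed
    also have "\<dots> \<le> M * (norm (S f) / (2 * M))"
      using M p by (intro mult_right_mono) (auto simp: M_def)
    also have "\<dots> = norm (S f) / 2" using M by simp
    finally show False using p by simp
  qed
  then show ?thesis by simp
qed

end

section \<open>Cutoff functions\<close>

text \<open>\<open>avg h f\<close> is the mean of \<open>f\<close> over \<open>[x - h;x]\<close>, for functions that vanish on the negative
  half-line.\<close>

definition avg :: "real \<Rightarrow> (real \<Rightarrow> real) \<Rightarrow> real \<Rightarrow> real" where
  "avg h f x = (integral {0..x} f - integral {0..x - h} f) / h"

text \<open>Values in \<open>[0;1]\<close>, \<open>0\<close> on the negative half-line and \<open>1\<close> from \<open>s\<close> on.\<close>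

definition step_like :: "real \<Rightarrow> (real \<Rightarrow> real) \<Rightarrow> bool" where
  "step_like s f \<longleftrightarrow> (\<forall>x. 0 \<le> f x \<and> f x \<le> 1) \<and> (\<forall>x\<le>0. f x = 0) \<and> (\<forall>x\<ge>s. f x = 1)"

lemma step_like_integral_base:
  fixes f :: "real \<Rightarrow> real"
  assumes "\<And>x. x \<le> 0 \<Longrightarrow> f x = 0" "\<And>u v. f integrable_on {u..v}" "b \<le> 0"
  shows "integral {b..x} f = integral {0..x} f"
proof (cases "0 \<le> x")
  case True
  have "integral {b..0} f = 0"
    using assms(1) by (intro integral_unique has_integral_is_0) auto
  then show ?thesis
    using Henstock_Kurzweil_Integration.integral_combine[OF assms(3) True, of f] assms(2) by simp
next
  case False
  then have "integral {b..x} f = 0" using assms(1) by (intro integral_unique has_integral_is_0) auto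
  then show ?thesis using False by simp
qed

lemma avg_eq:
  fixes f :: "real \<Rightarrow> real"
  assumes "\<And>x. x \<le> 0 \<Longrightarrow> f x = 0" "\<And>u v. f integrable_on {u..v}" "0 < h"
  shows "avg h f x = integral {x - h..x} f / h"
proof -
  define b where "b = min 0 (x - h)"
  have "integral {b..x - h} f + integral {x - h..x} f = integral {b..x} f"
    using assms by (intro Henstock_Kurzweil_Integration.integral_combine) (auto simp: b_def)
  then show ?thesis
    using step_like_integral_base[OF assms(1,2), of b] by (simp add: avg_def b_def)
qed

lemma primitive_deriv:
  fixes f :: "real \<Rightarrow> real"
  assumes z: "\<And>x. x \<le> 0 \<Longrightarrow> f x = 0" and c: "continuous_on UNIV f"
  shows "((\<lambda>x. integral {0..x} f) has_field_derivative f x) (at x)"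
proof -
  have int: "f integrable_on {u..v}" for u v
    using c by (intro integrable_continuous_real) (auto intro: continuous_on_subset)
  define M where "M = \<bar>x\<bar> + 1"
  have M: "- M \<le> 0" by (simp add: M_def)
  have "((\<lambda>y. integral {- M..y} f) has_field_derivative f x) (at x within {- M..M})"
    using c by (intro integral_has_real_derivative) (auto intro: continuous_on_subset simp: M_def)
  moreover have "at x within {- M..M} = at x"
    by (rule at_within_interior) (simp add: M_def interior_atLeastAtMost_real abs_if)
  moreover have "integral {- M..y} f = integral {0..y} f" for y
    by (rule step_like_integral_base[OF z int M])
  ultimately show ?thesis by simp
qed

lemma avg_deriv:
  fixes f :: "real \<Rightarrow> real"
  assumes z: "\<And>x. x \<le> 0 \<Longrightarrow> f x = 0" and c: "continuous_on UNIV f" and h: "0 < h"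
  shows "(avg h f has_field_derivative (f x - f (x - h)) / h) (at x)"
proof -
  have "((\<lambda>x. x - h) has_field_derivative 1) (at x)" by (auto intro!: derivative_eq_intros)
  from DERIV_chain2[OF primitive_deriv[OF z c] this]
  have 1: "((\<lambda>x. integral {0..x - h} f) has_field_derivative f (x - h)) (at x)" by simp
  have "((\<lambda>x. (integral {0..x} f - integral {0..x - h} f) / h) has_field_derivative (f x - f (x - h)) / h) (at x)"
    by (intro DERIV_cdivide DERIV_diff primitive_deriv[OF z c] 1)
  then show ?thesis by (simp add: avg_def[abs_def])
qed

lemma avg_step_like:
  assumes f: "step_like s f" and int: "\<And>u v. f integrable_on {u..v}" and h: "0 < h"
  shows "step_like (s + h) (avg h f)"
proof -
  have z: "\<And>x. x \<le> 0 \<Longrightarrow> f x = 0" using f by (simp add: step_like_def)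
  note eq = avg_eq[OF z int h]
  have c: "integral {x - h..x} (\<lambda>x. 1) = h" for x :: real using h by simp
  have "0 \<le> avg h f x" "avg h f x \<le> 1" for x
  proof -
    have "0 \<le> integral {x - h..x} f" using f int by (intro integral_nonneg) (auto simp: step_like_def)
    then show "0 \<le> avg h f x" using h by (simp add: eq)
    have "integral {x - h..x} f \<le> integral {x - h..x} (\<lambda>x. 1)"
      using f int by (intro integral_le) (auto simp: step_like_def)
    then show "avg h f x \<le> 1" using h by (simp add: eq)
  qed
  moreover have "avg h f x = 0" if "x \<le> 0" for x
  proof -
    have "integral {x - h..x} f = 0" using that z by (intro integral_unique has_integral_is_0) auto
    then show ?thesis by (simp add: eq)
  qed
  moreover have "avg h f x = 1" if "s + h \<le> x" for x
  proof -
    have "integral {x - h..x} f = integral {x - h..x} (\<lambda>x. 1)"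
      using that f by (intro integral_cong) (auto simp: step_like_def)
    then show ?thesis using h by (simp add: eq)
  qed
  ultimately show ?thesis by (auto simp: step_like_def)
qed

text \<open>\<open>iter_avg f h m j\<close> applies to \<open>f\<close> the averages over lengths \<open>h j, \<dots>, h (j + m - 1)\<close>.\<close>

fun iter_avg :: "(real \<Rightarrow> real) \<Rightarrow> (nat \<Rightarrow> real) \<Rightarrow> nat \<Rightarrow> nat \<Rightarrow> real \<Rightarrow> real" where
  "iter_avg f h 0 j = f"
| "iter_avg f h (Suc m) j = avg (h j) (iter_avg f h m (Suc j))"

text \<open>The continuous function that rises linearly from \<open>0\<close> to \<open>1\<close> on \<open>[0;\<eta>]\<close>.\<close>

definition ramp :: "real \<Rightarrow> real \<Rightarrow> real" where
  "ramp \<eta> x = min 1 (max 0 (x / \<eta>))"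

lemma ramp_props:
  assumes "0 < \<eta>"
  shows "step_like \<eta> (ramp \<eta>)" "continuous_on UNIV (ramp \<eta>)" "mono (ramp \<eta>)"
proof -
  have "ramp \<eta> x = 0" if "x \<le> 0" for x
    using that assms divide_nonpos_pos[of x \<eta>] by (simp add: ramp_def max_def)
  moreover have "ramp \<eta> x = 1" if "\<eta> \<le> x" for x
  proof -
    have "1 \<le> x / \<eta>" using that assms by simp
    then show ?thesis by (simp add: ramp_def)
  qed
  ultimately show "step_like \<eta> (ramp \<eta>)" by (auto simp: step_like_def ramp_def)
  show "continuous_on UNIV (ramp \<eta>)" unfolding ramp_def[abs_def] by (intro continuous_intros) (use assms in auto)
  show "mono (ramp \<eta>)"
  proof
    fix x y :: real assume "x \<le> y"
    then have "x / \<eta> \<le> y / \<eta>" using assms by (simp add: divide_right_mono)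
    then show "ramp \<eta> x \<le> ramp \<eta> y" unfolding ramp_def by linarith
  qed
qed

text \<open>The infinite average: the averages over \<open>h j, h (j + 1), \<dots>\<close> of a ramp decrease to a limit
  \<open>L j\<close>, and \<open>L j\<close> is the average of \<open>L (j + 1)\<close> over the length \<open>h j\<close>.\<close>

lemma infinite_average:
  fixes h :: "nat \<Rightarrow> real"
  assumes h: "\<And>i. 0 < h i" and sm: "summable h" and \<eta>: "0 < \<eta>"
  obtains L where "\<And>j. step_like (\<eta> + (\<Sum>i. h (i + j))) (L j)" "\<And>j. continuous_on UNIV (L j)"
    "\<And>j. L j = avg (h j) (L (Suc j))"
proof -
  (* L j reaches the value 1 at \<sigma> j *)
  define \<sigma> where "\<sigma> j = \<eta> + (\<Sum>i. h (i + j))" for j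
  have smj: "summable (\<lambda>i. h (i + j))" for j using sm by (simp add: summable_iff_shift)
  have \<sigma>_Suc: "\<sigma> j = \<sigma> (Suc j) + h j" for j
    using suminf_split_head[OF smj[of j]] by (simp add: \<sigma>_def)
  have \<sigma>\<eta>: "\<eta> \<le> \<sigma> j" for j
    using suminf_nonneg[OF smj[of j]] h by (simp add: \<sigma>_def less_imp_le)
  define P where "P = iter_avg (ramp \<eta>) h"
  have P0: "P 0 j = ramp \<eta>" and PS: "P (Suc m) j = avg (h j) (P m (Suc j))" for m j
    by (simp_all add: P_def)
  have P: "step_like (\<sigma> j) (P m j) \<and> continuous_on UNIV (P m j)" for m j
  proof (induction m arbitrary: j)
    case 0
    show ?case using ramp_props[OF \<eta>] \<sigma>\<eta>[of j] by (auto simp: P0 step_like_def)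
  next
    case (Suc m)
    have int: "P m (Suc j) integrable_on {u..v}" for u v
      using Suc by (intro integrable_continuous_real) (auto intro: continuous_on_subset)
    have z: "P m (Suc j) x = 0" if "x \<le> 0" for x using Suc[of "Suc j"] that by (simp add: step_like_def)
    have c: "continuous_on UNIV (P m (Suc j))" using Suc by blast
    have "step_like (\<sigma> j) (P (Suc m) j)"
      unfolding PS \<sigma>_Suc[of j] using Suc[of "Suc j"] int h by (intro avg_step_like) auto
    moreover have "continuous_on UNIV (P (Suc m) j)"
      unfolding PS by (intro continuous_at_imp_continuous_on ballI DERIV_isCont[OF avg_deriv[OF z c h]])
    ultimately show ?case by simp
  qed
  have Pint: "P m j integrable_on {u..v}" for m j u v
    using P by (intro integrable_continuous_real) (auto intro: continuous_on_subset)
  have Pz: "P m j x = 0" if "x \<le> 0" for m j x using P that by (simp add: step_like_def)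
  have P01: "0 \<le> P m j x" "P m j x \<le> 1" for m j x using P by (auto simp: step_like_def)
  have Peq: "avg (h i) (P m j) x = integral {x - h i..x} (P m j) / h i" for i m j x
    by (rule avg_eq[OF Pz Pint h])
  have dec: "P (Suc m) j x \<le> P m j x" for m j x
  proof (induction m arbitrary: j x)
    case 0
    have "P (Suc 0) j x = integral {x - h j..x} (P 0 (Suc j)) / h j" unfolding PS by (rule Peq)
    also have "integral {x - h j..x} (P 0 (Suc j)) \<le> integral {x - h j..x} (\<lambda>y. ramp \<eta> x)"
    proof (rule integral_le[OF Pint])
      fix y assume "y \<in> {x - h j..x}"
      then show "P 0 (Suc j) y \<le> ramp \<eta> x" using ramp_props(3)[OF \<eta>] by (auto simp: P0 mono_def)
    qed auto
    also have "integral {x - h j..x} (\<lambda>y. ramp \<eta> x) = h j * ramp \<eta> x" using h[of j] by simp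
    finally show ?case using h[of j] by (simp add: P0 divide_right_mono)
  next
    case (Suc m)
    have "integral {x - h j..x} (P (Suc m) (Suc j)) \<le> integral {x - h j..x} (P m (Suc j))"
      by (intro integral_le Pint) (rule Suc)
    then show ?case using h[of j] unfolding PS[of "Suc m"] PS[of m j] Peq by (simp add: divide_right_mono)
  qed
  define L where "L j x = lim (\<lambda>m. P m j x)" for j x
  have lim: "(\<lambda>m. P m j x) \<longlonglongrightarrow> L j x" for j x
  proof -
    have "decseq (\<lambda>m. P m j x)" using dec by (rule decseq_SucI)
    then obtain l where "(\<lambda>m. P m j x) \<longlonglongrightarrow> l"
      using decseq_convergent[of "\<lambda>m. P m j x" 0] P01 by metis
    then show ?thesis unfolding L_def by (simp add: limI)
  qed
  have L: "step_like (\<sigma> j) (L j)" for j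
  proof -
    have "0 \<le> L j x" "L j x \<le> 1" for x
      using LIMSEQ_le_const[OF lim] LIMSEQ_le_const2[OF lim] P01 by blast+
    moreover have "L j x = 0" if "x \<le> 0" for x
      using LIMSEQ_unique[OF lim[of j x]] Pz[OF that] by simp
    moreover have "L j x = 1" if "\<sigma> j \<le> x" for x
    proof -
      have "P m j x = 1" for m using P that by (simp add: step_like_def)
      then show ?thesis using LIMSEQ_unique[OF lim[of j x]] by simp
    qed
    ultimately show ?thesis by (auto simp: step_like_def)
  qed
  have Lint: "L j integrable_on {u..v}" and
    Llim: "(\<lambda>m. integral {u..v} (P m j)) \<longlonglongrightarrow> integral {u..v} (L j)" for j u v
    by (rule dominated_convergence[of "\<lambda>m. P m j" _ "\<lambda>x. 1"]; use Pint P01 lim in auto)+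
  have Lz: "L j x = 0" if "x \<le> 0" for j x using L that by (simp add: step_like_def)
  have Leq: "avg (h i) (L j) x = integral {x - h i..x} (L j) / h i" for i j x
    by (rule avg_eq[OF Lz Lint h])
  have LA: "L j = avg (h j) (L (Suc j))" for j
  proof
    fix x
    have "(\<lambda>m. P (Suc m) j x) \<longlonglongrightarrow> avg (h j) (L (Suc j)) x"
      unfolding PS Peq Leq using h[of j] by (intro tendsto_divide Llim) auto
    moreover have "(\<lambda>m. P (Suc m) j x) \<longlonglongrightarrow> L j x" using lim by (rule LIMSEQ_Suc)
    ultimately show "L j x = avg (h j) (L (Suc j)) x" using LIMSEQ_unique by blast
  qed
  have "continuous_on UNIV (L j)" for j
  proof -
    have cont: "isCont (\<lambda>x. integral {0..x} (L (Suc j))) x" for x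
    proof -
      define M where "M = \<bar>x\<bar> + 1"
      have M: "- M \<le> 0" by (simp add: M_def)
      have "continuous_on {- M..M} (\<lambda>y. integral {- M..y} (L (Suc j)))"
        by (rule indefinite_integral_continuous_1[OF Lint])
      moreover have "integral {- M..y} (L (Suc j)) = integral {0..y} (L (Suc j))" for y
        by (rule step_like_integral_base[OF Lz Lint M])
      ultimately have "continuous_on {- M..M} (\<lambda>y. integral {0..y} (L (Suc j)))" by simp
      then show ?thesis
        by (rule continuous_on_interior) (simp add: M_def interior_atLeastAtMost_real abs_if)
    qed
    have c2: "isCont (\<lambda>x. integral {0..x - h j} (L (Suc j))) x" for x
      using isCont_o2[of x "\<lambda>x. x - h j", OF _ cont] by (simp add: continuous_intros)
    show ?thesis
      unfolding LA[of j] avg_def[abs_def] using h[of j]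
      by (intro continuous_at_imp_continuous_on ballI isCont_divide isCont_diff cont c2) auto
  qed
  then show ?thesis using that L LA unfolding \<sigma>_def by blast
qed

text \<open>Iterated difference quotients; these express the derivatives of iterated averages.\<close>

fun diff_quots :: "(nat \<Rightarrow> real) \<Rightarrow> nat \<Rightarrow> (real \<Rightarrow> real) \<Rightarrow> real \<Rightarrow> real" where
  "diff_quots h 0 f = f"
| "diff_quots h (Suc j) f = diff_quots h j (\<lambda>x. (f x - f (x - h j)) / h j)"

lemma diff_quots_deriv:
  assumes "\<And>x. (f has_field_derivative f' x) (at x)"
  shows "(diff_quots h j f has_field_derivative diff_quots h j f' x) (at x)"
  using assms
proof (induction j arbitrary: f f')
  case (Suc j)
  have "((\<lambda>x. (f x - f (x - h j)) / h j) has_field_derivative (f' x - f' (x - h j)) / h j) (at x)" for x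
  proof -
    have "((\<lambda>x. x - h j) has_field_derivative 1) (at x)" by (auto intro!: derivative_eq_intros)
    from DERIV_chain2[OF Suc.prems this]
    have "((\<lambda>x. f (x - h j)) has_field_derivative f' (x - h j)) (at x)" by simp
    then show ?thesis by (intro DERIV_cdivide DERIV_diff Suc.prems)
  qed
  from Suc.IH[OF this] show ?case by simp
qed simp

lemma diff_quots_bound:
  assumes h: "\<And>i. 0 < h i" and B: "\<And>x. \<bar>f x\<bar> \<le> B"
  shows "\<bar>diff_quots h j f x\<bar> \<le> B * (\<Prod>i<j. 2 / h i)"
  using B
proof (induction j arbitrary: f B)
  case (Suc j)
  have "\<bar>(f x - f (x - h j)) / h j\<bar> \<le> B * (2 / h j)" for x
  proof -
    have "\<bar>f x - f (x - h j)\<bar> \<le> 2 * B" using Suc.prems[of x] Suc.prems[of "x - h j"] by linarith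
    then have "\<bar>f x - f (x - h j)\<bar> / h j \<le> 2 * B / h j" using h[of j] by (simp add: divide_right_mono)
    then show ?thesis using h[of j] by (simp add: abs_divide mult_ac)
  qed
  from Suc.IH[OF this] show ?case by (simp add: mult_ac)
qed simp

text \<open>The derivatives of \<open>L 0\<close> are \<open>G j = diff_quots h j (L j)\<close>, because the derivative of
  \<open>L j\<close> is a difference quotient of \<open>L (j + 1)\<close> with step \<open>h j\<close>.\<close>

lemma smooth_step:
  fixes h :: "nat \<Rightarrow> real"
  assumes h: "\<And>i. 0 < h i" and sm: "summable h" and \<eta>: "0 < \<eta>"
  shows "\<exists>G. (\<forall>j x. (G j has_field_derivative G (Suc j) x) (at x)) \<and>
    (\<forall>j x. \<bar>G j x\<bar> \<le> (\<Prod>i<j. 2 / h i)) \<and> (\<forall>x\<le>0. G 0 x = 0) \<and> (\<forall>x\<ge>\<eta> + suminf h. G 0 x = 1)"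
proof -
  obtain L where L: "\<And>j. step_like (\<eta> + (\<Sum>i. h (i + j))) (L j)" "\<And>j. continuous_on UNIV (L j)"
    "\<And>j. L j = avg (h j) (L (Suc j))"
    using infinite_average[OF h sm \<eta>] by blast
  define G where "G j = diff_quots h j (L j)" for j
  show ?thesis
  proof (intro exI[of _ G] conjI allI impI)
    fix j x
    have z: "L (Suc j) x = 0" if "x \<le> 0" for x using L(1)[of "Suc j"] that by (simp add: step_like_def)
    have "(L j has_field_derivative (L (Suc j) x - L (Suc j) (x - h j)) / h j) (at x)" for x
      unfolding L(3)[of j] by (rule avg_deriv[OF z L(2) h])
    from diff_quots_deriv[OF this]
    show "(G j has_field_derivative G (Suc j) x) (at x)" by (simp add: G_def)
    have "\<bar>L j x\<bar> \<le> 1" for x using L(1)[of j] by (simp add: step_like_def)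
    from diff_quots_bound[OF h this] show "\<bar>G j x\<bar> \<le> (\<Prod>i<j. 2 / h i)" by (simp add: G_def)
  next
    show "G 0 x = 0" if "x \<le> 0" for x using L(1)[of 0] that by (simp add: G_def step_like_def)
    show "G 0 x = 1" if "\<eta> + suminf h \<le> x" for x using L(1)[of 0] that by (simp add: G_def step_like_def)
  qed
qed

context weight_fn
begin

lemma omega_at_top:
  obtains y where "1 \<le> y" "B \<le> \<omega> y"
proof -
  obtain K where K: "\<And>x. 1 \<le> x \<Longrightarrow> ln x \<le> 1 * \<omega> x + K" using ln_le_omega[of 1] by auto
  let ?t = "max 0 (B + K)"
  have "B \<le> \<omega> (exp ?t)" using K[of "exp ?t"] by simp
  then show ?thesis using that[of "exp ?t"] by simp
qed

text \<open>The points at which the weight takes integer values have a convergent sum of reciprocals;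
  this is the form in which the integral condition on the weight (non-quasianalyticity) is used.\<close>

lemma weight_level_points:
  "\<exists>(Y :: nat \<Rightarrow> real) N. (\<forall>i. 1 \<le> Y i) \<and> (\<forall>i. \<omega> (Y i) = real (i + N)) \<and> summable (\<lambda>i. 1 / Y i)"
proof -
  obtain N :: nat where N: "\<omega> 1 < real N" using reals_Archimedean2 by blast
  have N1: "1 \<le> N" using N omega_nonneg[of 1] by (cases N) auto
  have cont: "continuous_on {0..} \<omega>" using weight by (simp add: is_weight_def)
  have "\<exists>x\<ge>1. \<omega> x = real (i + N)" for i
  proof -
    obtain y where y: "1 \<le> y" "real (i + N) \<le> \<omega> y" by (rule omega_at_top)
    have "\<exists>x. 1 \<le> x \<and> x \<le> y \<and> \<omega> x = real (i + N)"
      by (rule IVT') (use N y in \<open>auto intro: continuous_on_subset[OF cont]\<close>)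
    then show ?thesis by blast
  qed
  then obtain Y where Y: "\<And>i. 1 \<le> Y i" "\<And>i. \<omega> (Y i) = real (i + N)" by metis
  let ?f = "\<lambda>x. \<omega> x / x\<^sup>2"
  have fi: "?f integrable_on {1..}"
    using weight set_borel_integral_eq_integral(1)[of "{1..}" ?f] by (simp add: is_weight_def)
  define B where "B = integral {1..} ?f"
  have fM: "?f integrable_on {1..M}" for M
  proof -
    have "continuous_on {1..M} ?f"
      by (intro continuous_intros continuous_on_subset[OF cont]) auto
    then show ?thesis by (rule integrable_continuous_real)
  qed
  have fB: "integral {1..M} ?f \<le> B" for M
    unfolding B_def by (rule integral_subset_le[OF _ fM fi]) (auto intro!: divide_nonneg_nonneg omega_nonneg)
  have part: "(\<Sum>i<n. 1 / Y i - 1 / M) \<le> B" if M: "\<And>i. i < n \<Longrightarrow> Y i \<le> M" for n M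
  proof -
    (* 1 / Y i - 1 / M is the integral of 1 / x^2 over [Y i;M], and at most \<omega> x of the points Y i
       lie below x. *)
    let ?g = "\<lambda>i x. if x \<in> {Y i..M} then 1 / x\<^sup>2 else (0::real)"
    have g: "(?g i has_integral (1 / Y i - 1 / M)) {1..M}" if i: "i < n" for i
    proof -
      have "((\<lambda>x. 1 / x\<^sup>2) has_integral (- (1 / M)) - (- (1 / Y i))) {Y i..M}"
      proof (rule fundamental_theorem_of_calculus[OF M[OF i]])
        fix x assume "x \<in> {Y i..M}"
        then have "0 < x" using Y(1)[of i] by simp
        then have "((\<lambda>x. - (1 / x)) has_field_derivative 1 / x\<^sup>2) (at x within {Y i..M})"
          by (auto intro!: derivative_eq_intros simp: power2_eq_square)
        then show "((\<lambda>x. - (1 / x)) has_vector_derivative 1 / x\<^sup>2) (at x within {Y i..M})"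
          by (simp add: has_real_derivative_iff_has_vector_derivative)
      qed
      moreover have "{Y i..M} \<subseteq> {1..M}" using Y(1)[of i] by auto
      ultimately show ?thesis by (subst has_integral_restrict) auto
    qed
    have "(\<Sum>i<n. 1 / Y i - 1 / M) = integral {1..M} (\<lambda>x. \<Sum>i<n. ?g i x)"
      by (intro integral_unique[symmetric] has_integral_sum) (use g in auto)
    also have "\<dots> \<le> integral {1..M} ?f"
    proof (rule integral_le[OF _ fM])
      show "(\<lambda>x. \<Sum>i<n. ?g i x) integrable_on {1..M}"
        by (intro integrable_sum) (use g in auto)
      fix x assume x: "x \<in> {1..M}"
      have "{i\<in>{..<n}. x \<in> {Y i..M}} \<subseteq> {..<nat \<lfloor>\<omega> x\<rfloor>}"
      proof
        fix i assume "i \<in> {i\<in>{..<n}. x \<in> {Y i..M}}"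
        then have "\<omega> (Y i) \<le> \<omega> x" using Y(1)[of i] by (intro omega_mono) auto
        then have "real (i + 1) \<le> \<omega> x" using Y(2)[of i] N1 by simp
        then show "i \<in> {..<nat \<lfloor>\<omega> x\<rfloor>}" by (simp add: le_floor_iff zless_nat_eq_int_zless) linarith
      qed
      then have "card {i\<in>{..<n}. x \<in> {Y i..M}} \<le> nat \<lfloor>\<omega> x\<rfloor>"
        using card_mono[of "{..<nat \<lfloor>\<omega> x\<rfloor>}"] by simp
      also have "real (nat \<lfloor>\<omega> x\<rfloor>) \<le> \<omega> x" using omega_nonneg[of x] x by simp
      finally have c: "real (card {i\<in>{..<n}. x \<in> {Y i..M}}) \<le> \<omega> x" by simp
      have "(\<Sum>i<n. ?g i x) = (\<Sum>i\<in>{i\<in>{..<n}. x \<in> {Y i..M}}. 1 / x\<^sup>2)"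
        by (simp only: sum.inter_filter[OF finite_lessThan])
      also have "\<dots> = real (card {i\<in>{..<n}. x \<in> {Y i..M}}) * (1 / x\<^sup>2)" by simp
      also have "\<dots> \<le> \<omega> x * (1 / x\<^sup>2)" by (intro mult_right_mono c) simp
      finally show "(\<Sum>i<n. ?g i x) \<le> ?f x" by simp
    qed
    also have "\<dots> \<le> B" by (rule fB)
    finally show ?thesis .
  qed
  have "(\<Sum>i<n. 1 / Y i) \<le> B + 1" for n
  proof -
    define M where "M = (\<Sum>i<n. Y i) + real n + 1"
    have Y0: "0 \<le> Y i" for i using Y(1)[of i] by simp
    have M0: "0 < M" "real n \<le> M" using sum_nonneg[of "{..<n}" Y] Y0 by (auto simp: M_def)
    have "Y i \<le> M" if "i < n" for i
      using member_le_sum[of i "{..<n}" Y] Y0 that by (simp add: M_def)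
    then have "(\<Sum>i<n. 1 / Y i - 1 / M) \<le> B" by (rule part)
    moreover have "real n / M \<le> 1" using M0 by simp
    ultimately show ?thesis by (simp add: sum_subtractf)
  qed
  then have "summable (\<lambda>i. 1 / Y i)"
    using Y(1) by (intro summableI_nonneg_bounded[of _ "B + 1"]) (auto intro: order_trans[of 0 1])
  then show ?thesis using Y by blast
qed

lemma wseq_shift:
  assumes "0 < q" "q < q'"
  shows "\<exists>C>0. \<forall>j. wseq \<omega> q' (j + N) \<le> C * wseq \<omega> q j"
  using assms
proof (induction N arbitrary: q)
  case 0
  then show ?case using wseq_antimono[of q q'] by (intro exI[of _ 1]) auto
next
  case (Suc N)
  obtain r where r: "q < r" "r < q'" using Suc.prems(2) dense by blast
  obtain C where C: "0 < C" "\<And>j. wseq \<omega> q' (j + N) \<le> C * wseq \<omega> r j"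
    using Suc.IH[of r] r Suc.prems by auto
  obtain C' where C': "0 < C'" "\<And>j. wseq \<omega> r (Suc j) \<le> C' * wseq \<omega> q j"
    using wseq_Suc[OF Suc.prems(1) r(1)] by metis
  have "wseq \<omega> q' (j + Suc N) \<le> (C * C') * wseq \<omega> q j" for j
  proof -
    have "wseq \<omega> q' (j + Suc N) \<le> C * wseq \<omega> r (Suc j)" using C(2)[of "Suc j"] by simp
    also have "\<dots> \<le> C * (C' * wseq \<omega> q j)" using C C'(2)[of j] by (intro mult_left_mono) auto
    finally show ?thesis by simp
  qed
  then show ?case using C C' by (intro exI[of _ "C * C'"]) auto
qed

text \<open>Smooth steps of arbitrarily small width with derivatives controlled by the weight sequence.\<close>

lemma weighted_smooth_step:
  assumes \<epsilon>: "0 < \<epsilon>"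
  shows "\<exists>G. (\<forall>j x. (G j has_field_derivative G (Suc j) x) (at x)) \<and>
    (\<forall>q. 0 < q \<longrightarrow> q < 1 \<longrightarrow> (\<exists>B. \<forall>j x. \<bar>G j x\<bar> \<le> B * wseq \<omega> q j)) \<and>
    (\<forall>x\<le>0. G 0 x = 0) \<and> (\<forall>x\<ge>\<epsilon>. G 0 x = 1)"
proof -
  obtain Y N where Y: "\<And>i. 1 \<le> Y i" "\<And>i. \<omega> (Y i) = real (i + N)" "summable (\<lambda>i. 1 / Y i)"
    using weight_level_points by auto
  (* The constant is chosen so that 2 / \<kappa> = exp (- 1): the product of the 2 / h i for i < j is then
     at most exp (- j) * Y (j + m)^j, and exp (- j) is exp (- \<omega> (Y (j + m))) up to a constant. *)
  define \<kappa> where "\<kappa> = 2 * exp (1::real)"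
  have \<kappa>: "0 < \<kappa>" "2 / \<kappa> = exp (- 1)" by (simp_all add: \<kappa>_def exp_minus inverse_eq_divide)
  have Y0: "0 < Y i" for i using Y(1)[of i] by simp
  have sm: "summable (\<lambda>i. \<kappa> * (1 / Y i))" by (intro summable_mult Y(3))
  obtain m where m: "norm (\<Sum>i. \<kappa> * (1 / Y (i + m))) < \<epsilon> / 2"
    using suminf_exist_split[OF _ sm, of "\<epsilon> / 2"] \<epsilon> by auto
  define h where "h i = \<kappa> * (1 / Y (i + m))" for i
  have h: "0 < h i" for i using \<kappa> Y0 by (simp add: h_def)
  have hs: "summable h" unfolding h_def using summable_ignore_initial_segment[OF sm, of m] by simp
  have hsum: "suminf h < \<epsilon> / 2" using m unfolding h_def by simp
  have Ymono: "Y i \<le> Y j" if "i < j" for i j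
  proof (rule ccontr)
    assume "\<not> Y i \<le> Y j"
    then have "\<omega> (Y j) \<le> \<omega> (Y i)" using Y0[of j] by (intro omega_mono) auto
    then show False using Y(2) that by simp
  qed
  have prod: "(\<Prod>i<j. 2 / h i) \<le> exp (real (m + N)) * wseq \<omega> 1 (j + (m + N))" for j
  proof -
    let ?y = "Y (j + m)"
    have "(\<Prod>i<j. 2 / h i) \<le> (\<Prod>i<j. exp (- 1) * ?y)"
    proof (rule prod_mono)
      fix i assume i: "i \<in> {..<j}"
      have "2 / h i = (2 / \<kappa>) * Y (i + m)" by (simp add: h_def)
      also have "\<dots> \<le> exp (- 1) * ?y" using Ymono[of "i + m" "j + m"] i \<kappa>(2) by simp
      finally show "0 \<le> 2 / h i \<and> 2 / h i \<le> exp (- 1) * ?y" using h[of i] by simp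
    qed
    also have "\<dots> = exp (- real j) * ?y ^ j"
      by (simp add: power_mult_distrib exp_of_nat_mult[symmetric])
    also have "\<dots> \<le> exp (- real j) * ?y ^ (j + (m + N))"
      using Y(1)[of "j + m"] by (intro mult_left_mono power_increasing) auto
    also have "\<dots> \<le> exp (- real j) * (wseq \<omega> 1 (j + (m + N)) * exp (1 * \<omega> ?y))"
      by (intro mult_left_mono power_le_wseq Y) auto
    also have "\<dots> = (exp (- real j) * exp (real (j + m + N))) * wseq \<omega> 1 (j + (m + N))"
      by (simp add: Y(2))
    also have "exp (- real j) * exp (real (j + m + N)) = exp (real (m + N))"
      unfolding exp_add[symmetric] by simp
    finally show ?thesis .
  qed
  obtain G where G: "\<And>j x. (G j has_field_derivative G (Suc j) x) (at x)"
    "\<And>j x. \<bar>G j x\<bar> \<le> (\<Prod>i<j. 2 / h i)"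
    "\<And>x. x \<le> 0 \<Longrightarrow> G 0 x = 0" "\<And>x. \<epsilon> / 2 + suminf h \<le> x \<Longrightarrow> G 0 x = 1"
    using smooth_step[OF h hs half_gt_zero[OF \<epsilon>]] by auto
  show ?thesis
  proof (intro exI[of _ G] conjI allI impI)
    show "\<exists>B. \<forall>j x. \<bar>G j x\<bar> \<le> B * wseq \<omega> q j" if q: "0 < q" "q < 1" for q
    proof -
      obtain C where C: "0 < C" "\<And>j. wseq \<omega> 1 (j + (m + N)) \<le> C * wseq \<omega> q j"
        using wseq_shift[OF q, of "m + N"] by blast
      have "\<bar>G j x\<bar> \<le> (exp (real (m + N)) * C) * wseq \<omega> q j" for j x
      proof -
        have "\<bar>G j x\<bar> \<le> exp (real (m + N)) * wseq \<omega> 1 (j + (m + N))"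
          using G(2)[of j x] prod[of j] by linarith
        also have "\<dots> \<le> exp (real (m + N)) * (C * wseq \<omega> q j)" by (intro mult_left_mono C) simp
        finally show ?thesis by simp
      qed
      then show ?thesis by blast
    qed
    show "G 0 x = 1" if "\<epsilon> \<le> x" for x using G(4)[of x] that hsum by simp
  qed (use G in auto)
qed

end

context ultra_space
begin

text \<open>The space contains cutoff functions. The values off \<open>(-a;a)\<close> are \<open>0\<close> by convention.\<close>

lemma cutoff:
  assumes "p < p'"
  obtains u where "u \<in> U" "\<And>x. x \<le> p \<Longrightarrow> u x = 0" "\<And>x. x \<in> sym_interval a \<Longrightarrow> p' \<le> x \<Longrightarrow> u x = 1"
proof -
  obtain G where G: "\<And>j x. (G j has_field_derivative G (Suc j) x) (at x)"
    "\<And>q. 0 < q \<Longrightarrow> q < 1 \<Longrightarrow> \<exists>B. \<forall>j x. \<bar>G j x\<bar> \<le> B * wseq \<omega> q j"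
    "\<And>x. x \<le> 0 \<Longrightarrow> G 0 x = 0" "\<And>x. p' - p \<le> x \<Longrightarrow> G 0 x = 1"
    using weighted_smooth_step[of "p' - p"] assms by auto
  define F :: "nat \<Rightarrow> real \<Rightarrow> complex" where
    "F j x = (if x \<in> sym_interval a then of_real (G j (x - p)) else 0)" for j x
  have t: "deriv_tower a F"
    unfolding F_def[abs_def]
  proof (rule deriv_towerI)
    fix j x
    have "((\<lambda>x. x - p) has_field_derivative 1) (at x)" by (auto intro!: derivative_eq_intros)
    from DERIV_chain2[OF G(1) this]
    have "((\<lambda>x. G j (x - p)) has_field_derivative G (Suc j) (x - p)) (at x)" by simp
    then show "((\<lambda>x. of_real (G j (x - p)) :: complex) has_vector_derivative of_real (G (Suc j) (x - p))) (at x)"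
      by (intro has_vector_derivative_of_real)
  qed
  have "F 0 \<in> U"
  proof (rule U_I[OF t])
    fix q :: real and k assume "0 < q" "q < 1"
    then obtain B where B: "\<forall>j x. \<bar>G j x\<bar> \<le> B * wseq \<omega> q j" using G(2) by blast
    have "norm (F j x) \<le> B * wseq \<omega> q j" for j x
      using B order_trans[OF abs_ge_zero] by (auto simp: F_def)
    then show "\<exists>B. \<forall>j x. \<bar>x\<bar> \<le> c k \<longrightarrow> norm (F j x) \<le> B * wseq \<omega> q j" by blast
  qed
  then show ?thesis using that[of "F 0"] G(3,4) by (auto simp: F_def)
qed

end

section \<open>Separation by functionals\<close>

context ultra_space
begin

text \<open>The norm as a real number; it is meaningful on \<open>U\<close>, where it is finite.\<close>

definition seminorm :: "real \<Rightarrow> nat \<Rightarrow> (real \<Rightarrow> complex) \<Rightarrow> real" where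
  "seminorm q k f = real_of_ereal (U_norm a \<omega> c q k f)"

lemma seminorm_bounded:
  assumes "f \<in> U" "0 < q" "q < 1"
  shows "bounded_by q k f (seminorm q k f)"
proof -
  obtain B where B: "bounded_by q k f B" using U_bounded[OF assms] by blast
  then have "U_norm a \<omega> c q k f \<le> ereal B" by (simp add: U_norm_le_iff)
  moreover have "\<not> U_norm a \<omega> c q k f \<le> ereal (-1)"
    using bounded_by_nonneg[of q k f "-1"] by (auto simp: U_norm_le_iff)
  ultimately have "\<bar>U_norm a \<omega> c q k f\<bar> \<noteq> \<infinity>" by (cases "U_norm a \<omega> c q k f") auto
  then have "U_norm a \<omega> c q k f \<le> ereal (seminorm q k f)" by (simp add: seminorm_def ereal_real)
  then show ?thesis by (simp add: U_norm_le_iff)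
qed

lemma seminorm_least:
  assumes "bounded_by q k f B"
  shows "seminorm q k f \<le> B"
proof -
  have "U_norm a \<omega> c q k f \<le> ereal B" using assms by (simp add: U_norm_le_iff)
  moreover have "\<not> U_norm a \<omega> c q k f \<le> ereal (-1)"
    using bounded_by_nonneg[of q k f "-1"] by (auto simp: U_norm_le_iff)
  ultimately show ?thesis unfolding seminorm_def by (cases "U_norm a \<omega> c q k f") auto
qed

lemma subspace_of_complex_subspace:
  assumes "(\<lambda>x. 0) \<in> V" "\<And>f g \<alpha> \<beta>. f \<in> V \<Longrightarrow> g \<in> V \<Longrightarrow> (\<lambda>x. \<alpha> * f x + \<beta> * g x :: complex) \<in> V"
  shows "subspace V"
  unfolding subspace_def
proof (intro conjI ballI allI)
  show "0 \<in> V" using assms(1) by (simp add: zero_fun_def)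
  show "f + g \<in> V" if "f \<in> V" "g \<in> V" for f g
    using assms(2)[OF that, of 1 1] by (simp add: plus_fun_def)
  show "r *\<^sub>R f \<in> V" if "f \<in> V" for r f
    using assms(2)[OF that that, of "of_real r" 0] by (simp add: scaleR_fun_def scaleR_conv_of_real)
qed

text \<open>A closed subspace is the common kernel of its annihilator.\<close>

lemma annihilator_separates:
  assumes W: "W \<subseteq> U" "(\<lambda>x. 0) \<in> W"
    and lin: "\<And>f g \<alpha> \<beta>. f \<in> W \<Longrightarrow> g \<in> W \<Longrightarrow> (\<lambda>x. \<alpha> * f x + \<beta> * g x) \<in> W"
    and closed: "closedin (U_top a \<omega> c) W" and f0: "f0 \<in> U" "f0 \<notin> W"
  obtains S where "S \<in> annihilator a \<omega> c W" "S f0 \<noteq> 0"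
proof -
  have "openin (U_top a \<omega> c) (U - W)" using closed by (simp add: closedin_def U_top_topspace)
  then obtain q k \<epsilon> where q: "0 < q" "q < 1" "0 < \<epsilon>"
    and far: "\<forall>g\<in>U. bounded_by q k (\<lambda>x. g x - f0 x) \<epsilon> \<longrightarrow> g \<in> U - W"
    using U_top_nbhd[of "U - W" f0] f0 by blast
  let ?p = "seminorm q k"
  note bd = seminorm_bounded[OF _ q(1,2)]
  have sU: "subspace U" by (rule subspace_of_complex_subspace) (simp_all add: zero_U U_lincomb)
  have sW: "subspace W" by (rule subspace_of_complex_subspace) (use W lin in auto)
  have mult: "(\<lambda>x. \<alpha> * f x) \<in> U" if "f \<in> U" for f \<alpha> using U_lincomb[OF that that, of \<alpha> 0] by simp
  have multb: "bounded_by q k (\<lambda>x. \<alpha> * f x) (norm \<alpha> * B)" if "f \<in> U" "bounded_by q k f B" for f B \<alpha>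
    using bounded_by_lincomb[OF that(1,1,2,2), of \<alpha> 0] by simp
  have p_mult: "?p (\<lambda>x. \<alpha> * f x) \<le> norm \<alpha> * ?p f" if "f \<in> U" for f \<alpha>
    by (rule seminorm_least[OF multb[OF that bd[OF that]]])
  have p_add: "?p (f + g) \<le> ?p f + ?p g" if "f \<in> U" "g \<in> U" for f g
    using seminorm_least[OF bounded_by_lincomb[OF that bd[OF that(1)] bd[OF that(2)], where \<alpha> = 1 and \<beta> = 1]]
    by (simp add: plus_fun_def)
  have p_nonneg: "0 \<le> ?p f" if "f \<in> U" for f by (rule bounded_by_nonneg[OF bd[OF that]])
  have p_sc_le: "?p (t *\<^sub>R f) \<le> \<bar>t\<bar> * ?p f" if "f \<in> U" for t f
    using p_mult[OF that, of "of_real t"] by (simp add: scaleR_fun_def scaleR_conv_of_real)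
  have p_sc: "?p (t *\<^sub>R f) = \<bar>t\<bar> * ?p f" if f: "f \<in> U" for t f
  proof (cases "t = 0")
    case True
    then show ?thesis using p_sc_le[OF f, of t] p_nonneg[OF subspace_scale[OF sU f, of t]] by simp
  next
    case False
    have "?p ((1 / t) *\<^sub>R (t *\<^sub>R f)) \<le> \<bar>1 / t\<bar> * ?p (t *\<^sub>R f)"
      by (rule p_sc_le[OF subspace_scale[OF sU f]])
    then have "\<bar>t\<bar> * ?p f \<le> ?p (t *\<^sub>R f)" using False by (simp add: abs_divide field_simps)
    then show ?thesis using p_sc_le[OF f, of t] by simp
  qed
  have p_far: "\<epsilon> \<le> ?p (f0 - w)" if w: "w \<in> W" for w
  proof (rule ccontr)
    assume "\<not> \<epsilon> \<le> ?p (f0 - w)"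
    then have lt: "?p (f0 - w) \<le> \<epsilon>" by simp
    have wU: "w \<in> U" using w W by blast
    have dU: "f0 - w \<in> U" by (rule subspace_diff[OF sU f0(1) wU])
    have "bounded_by q k (\<lambda>x. (-1) * (f0 - w) x) (norm (-1::complex) * ?p (f0 - w))"
      by (rule multb[OF dU bd[OF dU]])
    then have "bounded_by q k (\<lambda>x. w x - f0 x) (?p (f0 - w))" by simp
    then have "bounded_by q k (\<lambda>x. w x - f0 x) \<epsilon>"
      by (rule bounded_by_mono) (use q lt in auto)
    then show False using far wU w by blast
  qed
  obtain L where L: "linear L" "\<And>g. g \<in> U \<Longrightarrow> \<bar>L g\<bar> \<le> ?p g" "\<And>w. w \<in> W \<Longrightarrow> L w = 0" "\<epsilon> \<le> L f0"
    using seminorm_separation[OF sU sW W(1) f0(1), of ?p \<epsilon>] p_add p_sc p_far by auto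
  (* The complex-linear functional with real part L. *)
  define S where "S g = (if g \<in> U then Complex (L g) (- L (\<lambda>x. \<i> * g x)) else 0)" for g
  have L_mult: "L (\<lambda>x. \<alpha> * g x) = Re \<alpha> * L g + Im \<alpha> * L (\<lambda>x. \<i> * g x)" for \<alpha> g
  proof -
    have "(\<lambda>x. \<alpha> * g x) = Re \<alpha> *\<^sub>R g + Im \<alpha> *\<^sub>R (\<lambda>x. \<i> * g x)"
    proof
      fix x
      have "\<alpha> = of_real (Re \<alpha>) + of_real (Im \<alpha>) * \<i>" by (simp add: complex_eq_iff)
      then have "\<alpha> * g x = (of_real (Re \<alpha>) + of_real (Im \<alpha>) * \<i>) * g x" by simp
      then show "\<alpha> * g x = (Re \<alpha> *\<^sub>R g + Im \<alpha> *\<^sub>R (\<lambda>x. \<i> * g x)) x"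
        by (simp only: plus_fun_def scaleR_fun_def scaleR_conv_of_real distrib_right mult.assoc)
    qed
    then show ?thesis by (simp add: linear_add[OF L(1)] linear_scale[OF L(1)])
  qed
  have L_add: "L (\<lambda>x. f x + g x) = L f + L g" for f g
    using linear_add[OF L(1), of f g] by (simp add: plus_fun_def)
  have S_mult: "Complex (L (\<lambda>x. \<alpha> * g x)) (- L (\<lambda>x. \<i> * (\<alpha> * g x))) = \<alpha> * Complex (L g) (- L (\<lambda>x. \<i> * g x))" for \<alpha> g
  proof -
    have "L (\<lambda>x. \<i> * (\<alpha> * g x)) = L (\<lambda>x. (\<i> * \<alpha>) * g x)" by (simp add: mult.assoc)
    also have "\<dots> = - Im \<alpha> * L g + Re \<alpha> * L (\<lambda>x. \<i> * g x)" unfolding L_mult[of "\<i> * \<alpha>"] by simp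
    finally show ?thesis by (simp add: complex_eq_iff L_mult[of \<alpha>])
  qed
  have S: "S \<in> U_dual a \<omega> c"
  proof (rule dualI[where q = q and k = k and C = 2])
    fix f g \<alpha> \<beta> assume f: "f \<in> U" and g: "g \<in> U"
    have "S (\<lambda>x. \<alpha> * f x + \<beta> * g x) = Complex (L (\<lambda>x. \<alpha> * f x + \<beta> * g x)) (- L (\<lambda>x. \<i> * (\<alpha> * f x) + \<i> * (\<beta> * g x)))"
      using U_lincomb[OF f g, of \<alpha> \<beta>] by (simp add: S_def distrib_left)
    also have "\<dots> = Complex (L (\<lambda>x. \<alpha> * f x)) (- L (\<lambda>x. \<i> * (\<alpha> * f x))) +
        Complex (L (\<lambda>x. \<beta> * g x)) (- L (\<lambda>x. \<i> * (\<beta> * g x)))"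
      by (simp add: L_add complex_eq_iff)
    also have "\<dots> = \<alpha> * S f + \<beta> * S g" unfolding S_mult using f g by (simp add: S_def)
    finally show "S (\<lambda>x. \<alpha> * f x + \<beta> * g x) = \<alpha> * S f + \<beta> * S g" .
  next
    fix f B assume f: "f \<in> U" and B: "bounded_by q k f B"
    have "norm (S f) \<le> \<bar>L f\<bar> + \<bar>L (\<lambda>x. \<i> * f x)\<bar>"
      using cmod_le[of "S f"] f by (simp add: S_def)
    also have "\<dots> \<le> B + B"
      using L(2)[OF f] L(2)[OF mult[OF f, of \<i>]] seminorm_least[OF B] seminorm_least[OF multb[OF f B, of \<i>]]
      by simp
    finally show "norm (S f) \<le> 2 * B" by simp
  qed (use q in \<open>auto simp: S_def\<close>)
  have "S w = 0" if w: "w \<in> W" for w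
  proof -
    have "(\<lambda>x. \<i> * w x) \<in> W" using lin[OF w w, of \<i> 0] by simp
    then show ?thesis using L(3) w by (simp add: S_def zero_complex.code)
  qed
  then have "S \<in> annihilator a \<omega> c W" using S by (simp add: annihilator_def)
  moreover have "S f0 \<noteq> 0"
  proof
    assume "S f0 = 0"
    then have "Re (S f0) = 0" by simp
    then show False using L(4) q f0 by (simp add: S_def)
  qed
  ultimately show ?thesis by (rule that)
qed

section \<open>Growth of a functional on the exponentials\<close>

text \<open>The indicator of the Fourier-Laplace transform of \<open>S\<close> in the direction \<open>\<pi> / 2\<close>, written
  without the transform.\<close>

definition growth :: "((real \<Rightarrow> complex) \<Rightarrow> complex) \<Rightarrow> ereal" where
  "growth S = Limsup at_top (\<lambda>r::real. if S (exp_fn r) = 0 then - \<infinity> else ereal (ln (norm (S (exp_fn r))) / r))"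

lemma indicator_fn_right: "indicator_fn (fourier_laplace a S) (pi / 2) = growth S"
proof -
  have *: "fourier_laplace a S (of_real r * cis (pi / 2)) = S (exp_fn r)" for r :: real
  proof -
    have "exp (- \<i> * of_real t * (of_real r * cis (pi / 2))) = of_real (exp (r * t))" for t :: real
      by (simp add: exp_of_real[symmetric] mult_ac)
    then show ?thesis unfolding fourier_laplace_def exp_fn_def by (simp only:)
  qed
  show ?thesis unfolding indicator_fn_def growth_def * ..
qed

lemma indicator_fn_left: "indicator_fn (fourier_laplace a S) (- pi / 2) = growth (reflect_dual S)"
proof -
  have *: "fourier_laplace a S (of_real r * cis (- pi / 2)) = reflect_dual S (exp_fn r)" for r :: real
  proof -
    have "cis (- pi / 2) = - \<i>" by (simp add: complex_eq_iff)
    then have "exp (- \<i> * of_real t * (of_real r * cis (- pi / 2))) = of_real (exp (- r * t))" for t :: real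
      by (simp add: exp_of_real[symmetric] mult_ac)
    then have "fourier_laplace a S (of_real r * cis (- pi / 2)) = S (exp_fn (- r))"
      unfolding fourier_laplace_def exp_fn_def by (simp only:)
    then show ?thesis by (simp only: reflect_dual_exp)
  qed
  show ?thesis unfolding indicator_fn_def growth_def * ..
qed

lemma growth_le_iff:
  "growth S \<le> ereal d \<longleftrightarrow> (\<forall>\<epsilon>>0. eventually (\<lambda>r. norm (S (exp_fn r)) \<le> exp ((d + \<epsilon>) * r)) at_top)"
proof
  assume le: "growth S \<le> ereal d"
  show "\<forall>\<epsilon>>0. eventually (\<lambda>r. norm (S (exp_fn r)) \<le> exp ((d + \<epsilon>) * r)) at_top"
  proof (intro allI impI)
    fix \<epsilon> :: real assume e: "0 < \<epsilon>"
    have "growth S < ereal (d + \<epsilon>)" using le e by (simp add: le_less_trans)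
    then have "eventually (\<lambda>r. (if S (exp_fn r) = 0 then - \<infinity> else ereal (ln (norm (S (exp_fn r))) / r)) < ereal (d + \<epsilon>)) at_top"
      unfolding growth_def by (rule Limsup_lessD)
    then show "eventually (\<lambda>r. norm (S (exp_fn r)) \<le> exp ((d + \<epsilon>) * r)) at_top"
      using eventually_gt_at_top[of 0]
    proof eventually_elim
      case (elim r)
      show ?case
      proof (cases "S (exp_fn r) = 0")
        case False
        then have "ln (norm (S (exp_fn r))) \<le> (d + \<epsilon>) * r" using elim by (simp add: field_simps)
        then show ?thesis using False by (simp add: ln_le_cancel_iff[symmetric] del: ln_le_cancel_iff)
      qed simp
    qed
  qed
next
  assume r: "\<forall>\<epsilon>>0. eventually (\<lambda>r. norm (S (exp_fn r)) \<le> exp ((d + \<epsilon>) * r)) at_top"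
  show "growth S \<le> ereal d"
  proof (rule ereal_le_epsilon2)
    fix \<epsilon> :: real assume "0 < \<epsilon>"
    then have "eventually (\<lambda>r. norm (S (exp_fn r)) \<le> exp ((d + \<epsilon>) * r)) at_top" using r by blast
    then have "eventually (\<lambda>r. (if S (exp_fn r) = 0 then - \<infinity> else ereal (ln (norm (S (exp_fn r))) / r)) \<le> ereal d + ereal \<epsilon>) at_top"
      using eventually_gt_at_top[of 0]
    proof eventually_elim
      case (elim r)
      show ?case
      proof (cases "S (exp_fn r) = 0")
        case False
        then have "ln (norm (S (exp_fn r))) \<le> ln (exp ((d + \<epsilon>) * r))" using elim by (subst ln_le_cancel_iff) auto
        then have "ln (norm (S (exp_fn r))) / r \<le> d + \<epsilon>" using elim by (simp add: field_simps)
        then show ?thesis using False by simp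
      qed simp
    qed
    then show "growth S \<le> ereal d + ereal \<epsilon>" unfolding growth_def by (rule Limsup_bounded)
  qed
qed

text \<open>A factor \<open>exp (\<omega> r)\<close> does not affect the growth, because \<open>\<omega> r = o(r)\<close>.\<close>

lemma growth_leI:
  assumes M: "\<And>r. 1 \<le> r \<Longrightarrow> norm (S (exp_fn r)) \<le> M * exp (\<omega> r) * exp (d * r)" and M0: "0 \<le> M"
  shows "growth S \<le> ereal d"
  unfolding growth_le_iff
proof (intro allI impI)
  fix \<epsilon> :: real assume e: "0 < \<epsilon>"
  obtain K where K: "\<And>x. 0 \<le> x \<Longrightarrow> \<omega> x \<le> (\<epsilon> / 2) * x + K"
    using omega_le_linear[OF half_gt_zero[OF e]] by blast
  have "eventually (\<lambda>r. M * exp K \<le> \<epsilon> / 2 * r) at_top"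
    using e eventually_ge_at_top[of "M * exp K / (\<epsilon> / 2)"] by (auto elim!: eventually_mono simp: field_simps)
  then show "eventually (\<lambda>r. norm (S (exp_fn r)) \<le> exp ((d + \<epsilon>) * r)) at_top"
    using eventually_ge_at_top[of 1]
  proof eventually_elim
    case (elim r)
    have "norm (S (exp_fn r)) \<le> M * exp (\<omega> r) * exp (d * r)" using M elim by blast
    also have "\<dots> \<le> M * exp ((\<epsilon> / 2) * r + K) * exp (d * r)"
      using K[of r] elim M0 by (intro mult_right_mono mult_left_mono) auto
    also have "\<dots> = (M * exp K) * (exp ((\<epsilon> / 2) * r) * exp (d * r))" by (simp add: exp_add)
    also have "\<dots> \<le> exp ((\<epsilon> / 2) * r) * (exp ((\<epsilon> / 2) * r) * exp (d * r))"
      using elim order_trans[OF _ exp_ge_add_one_self, of "\<epsilon> / 2 * r" "\<epsilon> / 2 * r"]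
      by (intro mult_right_mono) auto
    also have "\<dots> = exp ((d + \<epsilon>) * r)" unfolding exp_add[symmetric] by (simp add: algebra_simps)
    finally show ?case .
  qed
qed

lemma growth_le_support:
  assumes S: "S \<in> U_dual a \<omega> c" and q: "0 < q" "q < 1" and C: "0 \<le> C"
    "\<And>f B. f \<in> U \<Longrightarrow> bounded_by q k f B \<Longrightarrow> norm (S f) \<le> C * B"
  shows "growth S \<le> ereal (c k)"
proof (rule growth_leI[OF _ C(1)])
  fix r :: real assume r: "1 \<le> r"
  have "norm (S (exp_fn r)) \<le> C * (exp (q * \<omega> (max 1 \<bar>r\<bar>)) * exp (\<bar>r\<bar> * c k))"
    by (rule C(2)[OF exp_fn_U bounded_by_exp_fn[OF q(1)]])
  also have "\<dots> \<le> C * (exp (1 * \<omega> r) * exp (c k * r))"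
    using r q C(1) omega_nonneg[of r] mult_right_mono[of q 1 "\<omega> r"]
    by (intro mult_left_mono mult_mono) (auto simp: mult.commute)
  finally show "norm (S (exp_fn r)) \<le> C * exp (\<omega> r) * exp (c k * r)" by simp
qed

text \<open>The converse of the support theorem: if \<open>S\<close> annihilates the functions supported on the right of
  \<open>p\<close>, a cutoff replaces the exponential by a function that vanishes on the right of \<open>p'\<close> and is
  bounded in the norms by a constant multiple of \<open>exp (p' r + \<omega> r)\<close>.\<close>

lemma growth_le_of_kills:
  assumes S: "S \<in> U_dual a \<omega> c" and p: "p < p'"
    and kills: "\<And>f. f \<in> U \<Longrightarrow> (\<And>x. x \<le> p \<Longrightarrow> f x = 0) \<Longrightarrow> S f = 0"
  shows "growth S \<le> ereal p'"
proof -
  obtain q k C where q: "0 < q" "q < 1" and C: "0 \<le> C"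
    "\<And>f B. f \<in> U \<Longrightarrow> bounded_by q k f B \<Longrightarrow> norm (S f) \<le> C * B"
    using dual_bounded[OF S] by metis
  obtain q' where q': "q < q'" "q' < 1" using q(2) dense by blast
  have q'0: "0 < q'" using q q' by simp
  obtain u where u: "u \<in> U" "\<And>x. x \<le> p \<Longrightarrow> u x = 0" "\<And>x. x \<in> sym_interval a \<Longrightarrow> p' \<le> x \<Longrightarrow> u x = 1"
    using cutoff[OF p] by metis
  define v where "v x = exp_fn 0 x - u x" for x
  have vU: "v \<in> U" unfolding v_def[abs_def] by (rule U_diff[OF exp_fn_U u(1)])
  obtain A where A: "bounded_by q' k v A" using U_bounded[OF vU q'0 q'(2)] by blast
  have A0: "0 \<le> A" by (rule bounded_by_nonneg[OF A])
  obtain C' where C': "0 < C'" "\<forall>f\<in>U. \<forall>g\<in>U. \<forall>x A B. (\<forall>i. norm ((D a ^^ i) f x) \<le> A * wseq \<omega> q' i) \<longrightarrow>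
       (\<forall>i. norm ((D a ^^ i) g x) \<le> B * wseq \<omega> q' i) \<longrightarrow>
       (\<forall>j. norm ((D a ^^ j) (\<lambda>x. f x * g x) x) \<le> C' * A * B * wseq \<omega> q j)"
    using D_mult_bound[OF q(1) q'(1)] by blast
  show ?thesis
  proof (rule growth_leI)
    show "0 \<le> C * (C' * A)" using C C' A0 by simp
    fix r :: real assume r: "1 \<le> r"
    have ur: "(\<lambda>x. u x * exp_fn r x) \<in> U" and vr: "(\<lambda>x. v x * exp_fn r x) \<in> U"
      by (intro U_mult u vU exp_fn_U)+
    have "S (exp_fn r) = S (\<lambda>x. u x * exp_fn r x + v x * exp_fn r x)"
      by (rule arg_cong[of _ _ S]) (auto simp: v_def exp_fn_def fun_eq_iff algebra_simps)
    also have "\<dots> = S (\<lambda>x. v x * exp_fn r x)"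
      using kills[OF ur] u(2) by (simp add: dual_add[OF S ur vr])
    finally have eq: "S (exp_fn r) = S (\<lambda>x. v x * exp_fn r x)" .
    have b: "bounded_by q k (\<lambda>x. v x * exp_fn r x) (C' * A * (exp (\<omega> r) * exp (p' * r)))"
      unfolding bounded_by_def
    proof (intro allI impI)
      fix j x assume x: "\<bar>x\<bar> \<le> c k"
      show "norm ((D a ^^ j) (\<lambda>x. v x * exp_fn r x) x) \<le> C' * A * (exp (\<omega> r) * exp (p' * r)) * wseq \<omega> q j"
      proof (cases "x \<le> p'")
        case True
        have "norm ((D a ^^ i) (exp_fn r) x) \<le> (exp (\<omega> r) * exp (p' * r)) * wseq \<omega> q' i" for i
        proof -
          have "q' * \<omega> r \<le> 1 * \<omega> r" using q' omega_nonneg[of r] r by (intro mult_right_mono) auto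
          then have "r ^ i \<le> wseq \<omega> q' i * exp (\<omega> r)"
            using power_le_wseq[OF q'0 r, of i]
            by (metis exp_le_cancel_iff mult_1 mult_left_mono order_trans wseq_nonneg)
          moreover have "exp (r * x) \<le> exp (p' * r)" using True r by (simp add: mult.commute)
          ultimately have "r ^ i * exp (r * x) \<le> (wseq \<omega> q' i * exp (\<omega> r)) * exp (p' * r)"
            using r by (intro mult_mono) auto
          moreover have "norm ((D a ^^ i) (exp_fn r) x) = r ^ i * exp (r * x)"
            using c_in[OF x] r by (simp add: D_exp_fn norm_mult norm_power)
          ultimately show ?thesis by (simp add: mult_ac)
        qed
        then show ?thesis using C'(2) vU exp_fn_U bounded_byD[OF A x] by blast
      next
        case False
        have "(D a ^^ j) (\<lambda>x. v x * exp_fn r x) x = 0"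
        proof (rule D_eq_0_open[of "{p'<..}"])
          show "v y * exp_fn r y = 0" if "y \<in> {p'<..}" for y
            using that u(3)[of y] by (auto simp: v_def exp_fn_def)
        qed (use False in auto)
        then show ?thesis using C' A0 by simp
      qed
    qed
    show "norm (S (exp_fn r)) \<le> C * (C' * A) * exp (\<omega> r) * exp (p' * r)"
      using C(2)[OF vr b] by (simp add: eq mult_ac)
  qed
qed

lemma growth_kills_right:
  assumes S: "S \<in> U_dual a \<omega> c" "growth S \<le> ereal d" and d: "d \<in> sym_interval a"
    and f: "f \<in> U" "\<And>x. x \<le> d \<Longrightarrow> f x = 0"
  shows "S f = 0"
  using S(2) unfolding growth_le_iff by (intro kills_right[OF S(1) f(1) d f(2)]) auto

lemma growth_kills_left:
  assumes S: "S \<in> U_dual a \<omega> c" "growth (reflect_dual S) \<le> ereal (- d)" and d: "d \<in> sym_interval a"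
    and f: "f \<in> U" "\<And>x. d \<le> x \<Longrightarrow> f x = 0"
  shows "S f = 0"
proof -
  have "reflect_dual S (\<lambda>x. f (- x)) = 0"
    by (rule growth_kills_right[OF reflect_dual[OF S(1)] S(2)])
      (use d f U_reflect in \<open>auto simp: sym_interval_uminus\<close>)
  then show ?thesis using reflect_dual_reflect[OF f(1)] by simp
qed

text \<open>A functional of growth at most \<open>p\<close> annihilates the functions supported on the right of \<open>p\<close>. If it
  also annihilates those supported on the left of \<open>p' > p\<close>, then it is zero, by a partition of
  unity.\<close>

lemma dual_zero_of_split:
  assumes S: "S \<in> U_dual a \<omega> c" and p: "p < p'" "p \<in> sym_interval a" and g: "growth S \<le> ereal p"
    and kills: "\<And>f. f \<in> U \<Longrightarrow> (\<And>x. p' \<le> x \<Longrightarrow> f x = 0) \<Longrightarrow> S f = 0"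
  shows "S f = 0"
proof (cases "f \<in> U")
  case True
  obtain u where u: "u \<in> U" "\<And>x. x \<le> p \<Longrightarrow> u x = 0" "\<And>x. x \<in> sym_interval a \<Longrightarrow> p' \<le> x \<Longrightarrow> u x = 1"
    using cutoff[OF p(1)] by metis
  define w where "w x = f x - u x * f x" for x
  have uU: "(\<lambda>x. u x * f x) \<in> U" by (rule U_mult[OF u(1) True])
  have wU: "w \<in> U" unfolding w_def[abs_def] by (rule U_diff[OF True uU])
  have f_off: "f x = 0" if "x \<notin> sym_interval a" for x
    using True that by (simp add: U_iff smooth_fns_def)
  have "S w = 0"
  proof (rule kills[OF wU])
    fix x assume "p' \<le> x"
    then show "w x = 0" using u(3)[of x] f_off[of x] by (cases "x \<in> sym_interval a") (auto simp: w_def)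
  qed
  moreover have "S (\<lambda>x. u x * f x) = 0"
    by (rule growth_kills_right[OF S g p(2) uU]) (simp add: u(2))
  moreover have "f = (\<lambda>x. w x + u x * f x)" by (simp add: w_def)
  ultimately show ?thesis using dual_add[OF S wU uU] by simp
qed (use S in \<open>simp add: U_dual_def\<close>)

text \<open>The segment of a nonzero functional meets \<open>(-a;a)\<close>.\<close>

lemma growth_point:
  assumes S: "S \<in> U_dual a \<omega> c" and f: "S f \<noteq> 0"
  obtains x where "x \<in> sym_interval a" "- growth (reflect_dual S) \<le> ereal x" "ereal x \<le> growth S"
proof -
  obtain q k C where q: "0 < q" "q < 1" and C: "0 \<le> C"
    "\<And>f B. f \<in> U \<Longrightarrow> bounded_by q k f B \<Longrightarrow> norm (S f) \<le> C * B"
    using dual_bounded[OF S] by metis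
  have up: "growth S \<le> ereal (c k)" by (rule growth_le_support[OF S q C])
  have up': "growth (reflect_dual S) \<le> ereal (c k)"
  proof (rule growth_le_support[OF reflect_dual[OF S] q C(1)])
    fix f B assume fB: "f \<in> U" "bounded_by q k f B"
    show "norm (reflect_dual S f) \<le> C * B"
      using C(2)[OF U_reflect[OF fB(1)] bounded_by_reflect[OF fB]] fB by (simp add: reflect_dual_def)
  qed
  have c_a: "- a < ereal (- c k)" "ereal (c k) < a" using c_less[of k] by (cases a; simp)+
  (* S does not see functions supported off [- c k;c k]. If the right end of the segment were to the
     left of - c k, S would therefore be zero. *)
  have low: "ereal (- c k) \<le> growth S"
  proof (rule ccontr)
    assume "\<not> ereal (- c k) \<le> growth S"
    then have "max (growth S) (- a) < ereal (- c k)" using c_a by (simp add: not_le)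
    then obtain p where p: "max (growth S) (- a) < ereal p" "ereal p < ereal (- c k)"
      using ereal_dense2 by blast
    have "p < - c k" using p by simp
    then obtain p' where p': "p < p'" "p' < - c k" using dense by blast
    have "S f = 0"
    proof (rule dual_zero_of_split[OF S p'(1)])
      have "ereal p < a" using p(2) c_pos[of k] c_a(2) by (meson less_trans ereal_less(2) less_ereal.simps(1) neg_less_0_iff_less)
      then show "p \<in> sym_interval a" using p by (simp add: sym_interval_def)
      show "growth S \<le> ereal p" using p by (auto intro: less_imp_le)
      fix g assume g: "g \<in> U" "\<And>x. p' \<le> x \<Longrightarrow> g x = 0"
      have "bounded_by q k g 0"
        unfolding bounded_by_def
      proof (intro allI impI)
        fix j x assume "\<bar>x\<bar> \<le> c k"
        then have "(D a ^^ j) g x = 0" using p' g(2) by (intro D_eq_0_open[of "{p'<..}"]) auto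
        then show "norm ((D a ^^ j) g x) \<le> 0 * wseq \<omega> q j" by simp
      qed
      then show "S g = 0" using C(2)[OF g(1)] by fastforce
    qed
    then show False using f by simp
  qed
  (* The same argument applies if the two ends of the segment are in the wrong order. *)
  have ord: "- growth (reflect_dual S) \<le> growth S"
  proof (rule ccontr)
    assume "\<not> - growth (reflect_dual S) \<le> growth S"
    then have lt: "growth S < - growth (reflect_dual S)" by simp
    have "growth S < a" using up c_a(2) by (rule le_less_trans)
    moreover have "- a < - growth (reflect_dual S)"
      using le_less_trans[OF up' c_a(2)] by (simp add: ereal_minus_less_minus)
    moreover have "- a < a" using a_pos by (cases a) auto
    ultimately have "max (growth S) (- a) < min a (- growth (reflect_dual S))" using lt by simp
    then obtain p' where p': "max (growth S) (- a) < ereal p'" "ereal p' < min a (- growth (reflect_dual S))"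
      using ereal_dense2 by blast
    then obtain p where p: "max (growth S) (- a) < ereal p" "ereal p < ereal p'"
      using ereal_dense2 by blast
    have p'_in: "p' \<in> sym_interval a" using p' by (simp add: sym_interval_def)
    have "S f = 0"
    proof (rule dual_zero_of_split[OF S])
      show "p < p'" using p by simp
      have "ereal p < a" using p(2) p'(2) by (meson less_trans min_less_iff_conj)
      then show "p \<in> sym_interval a" using p by (simp add: sym_interval_def)
      show "growth S \<le> ereal p" using p by (auto intro: less_imp_le)
      have "growth (reflect_dual S) \<le> ereal (- p')"
        using p'(2) by (cases "growth (reflect_dual S)") auto
      then show "S g = 0" if "g \<in> U" "\<And>x. p' \<le> x \<Longrightarrow> g x = 0" for g
        using growth_kills_left[OF S _ p'_in that] by blast
    qed
    then show False using f by simp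
  qed
  obtain x where x: "growth S = ereal x" using up low by (cases "growth S") auto
  have "\<bar>x\<bar> \<le> c k" using up low by (simp add: x abs_le_iff)
  then show ?thesis using that[OF c_in] ord by (simp add: x)
qed

end

section \<open>The residual interval\<close>

context ultra_space
begin

text \<open>The part of \<open>f\<close> on the right of \<open>e\<close> belongs to the space and is annihilated. If \<open>e \<ge> a\<close> this
  part is zero; otherwise \<open>e\<close> is a point of \<open>(-a;a)\<close>, at which \<open>f\<close> is flat.\<close>

lemma vanishing_right_part:
  assumes S: "S \<in> U_dual a \<omega> c" and f: "f \<in> U" and g: "growth S \<le> e" and le: "- a < e"
    and flat: "\<And>d j. e = ereal d \<Longrightarrow> e < a \<Longrightarrow> (D a ^^ j) f d = 0"
  shows "(\<lambda>x. if e < ereal x then f x else 0) \<in> U \<and> S (\<lambda>x. if e < ereal x then f x else 0) = 0"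
proof (cases "e < a")
  case True
  then obtain d where d: "e = ereal d" using le by (cases e) auto
  have d_in: "d \<in> sym_interval a" using True le d by (simp add: sym_interval_def)
  have eq: "(\<lambda>x. if e < ereal x then f x else 0) = (\<lambda>x. if d < x then f x else 0)" using d by simp
  have U: "(\<lambda>x. if d < x then f x else 0) \<in> U" by (rule right_part_U[OF f flat[OF d True]])
  have "S (\<lambda>x. if d < x then f x else 0) = 0"
    by (rule growth_kills_right[OF S _ d_in U]) (use g d in auto)
  then show ?thesis using U unfolding eq by blast
next
  case False
  have "f x = 0" if "e < ereal x" for x
  proof -
    have "x \<notin> sym_interval a" using that False by (auto simp: sym_interval_def)
    then show ?thesis using f by (simp add: U_iff smooth_fns_def)
  qed
  then have "(\<lambda>x. if e < ereal x then f x else 0) = (\<lambda>x. 0)" by auto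
  then show ?thesis using zero_U dual_zero[OF S] by simp
qed

text \<open>A functional with segment in \<open>[l;u]\<close> annihilates the functions flat on \<open>[l;u] \<inter> (-a;a)\<close>. For
  \<open>S \<noteq> 0\<close> this intersection is nonempty by \<open>growth_point\<close>, so that a flat function is the sum of its
  parts on the right of \<open>u\<close> and on the left of \<open>l\<close>.\<close>

lemma growth_kills_flat:
  assumes S: "S \<in> U_dual a \<omega> c" and lo: "growth (reflect_dual S) \<le> - l" and hi: "growth S \<le> u"
    and f: "f \<in> U" and flat: "\<And>x j. x \<in> sym_interval a \<Longrightarrow> l \<le> ereal x \<Longrightarrow> ereal x \<le> u \<Longrightarrow> (D a ^^ j) f x = 0"
  shows "S f = 0"
proof (rule ccontr)
  assume nz: "S f \<noteq> 0"
  obtain x0 where x0: "x0 \<in> sym_interval a" "- growth (reflect_dual S) \<le> ereal x0" "ereal x0 \<le> growth S"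
    using growth_point[OF S nz] .
  have "- (- l) \<le> - growth (reflect_dual S)" using lo by (simp only: ereal_minus_le_minus)
  then have l: "l \<le> ereal x0" using x0(2) unfolding ereal_uminus_uminus by (rule order_trans)
  have u: "ereal x0 \<le> u" using hi x0(3) by (rule order_trans[rotated])
  have x0a: "- a < ereal x0" "ereal x0 < a" using x0(1) by (auto simp: sym_interval_def)
  have ua: "- a < u" using x0a(1) u by (rule less_le_trans)
  have la: "l < a" using l x0a(2) by (rule le_less_trans)
  let ?r = "\<lambda>x. if u < ereal x then f x else 0"
  have r: "?r \<in> U \<and> S ?r = 0"
  proof (rule vanishing_right_part[OF S f hi ua])
    fix d j assume d: "u = ereal d" "u < a"
    then show "(D a ^^ j) f d = 0"
      using ua l u by (intro flat) (auto simp: sym_interval_def intro: order_trans)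
  qed
  let ?h = "\<lambda>x. f (- x)"
  let ?s = "\<lambda>x. if - l < ereal x then ?h x else 0"
  have s: "?s \<in> U \<and> reflect_dual S ?s = 0"
  proof (rule vanishing_right_part[OF reflect_dual[OF S] U_reflect[OF f] lo])
    show "- a < - l" using la by simp
    fix d j assume d: "- l = ereal d" "- l < a"
    then have ld: "l = ereal (- d)" by (cases l) auto
    have "- d \<in> sym_interval a" using d(2) la ld by (cases a) (auto simp: sym_interval_def)
    then have "(D a ^^ j) f (- d) = 0"
      by (rule flat) (use order_trans[OF l u] in \<open>simp_all add: ld\<close>)
    then show "(D a ^^ j) ?h d = 0" by (simp add: D_reflect[OF f])
  qed
  have s': "(\<lambda>x. ?s (- x)) \<in> U" "S (\<lambda>x. ?s (- x)) = 0"
    using s U_reflect[of ?s] by (auto simp: reflect_dual_def)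
  have "f = (\<lambda>x. ?r x + ?s (- x))"
  proof
    fix x
    have le: "l \<le> u" using l u by (rule order_trans)
    have iff: "- l < ereal (- x) \<longleftrightarrow> ereal x < l" by (cases l) auto
    consider "u < ereal x" | "ereal x < l" | "l \<le> ereal x" "ereal x \<le> u" by force
    then show "f x = ?r x + ?s (- x)"
    proof cases
      case 1
      then have "\<not> ereal x < l" using le by auto
      then show ?thesis using 1 iff by simp
    next
      case 2
      then have "\<not> u < ereal x" using le by auto
      then show ?thesis using 2 iff by simp
    next
      case 3
      have "f x = 0"
      proof (cases "x \<in> sym_interval a")
        case True
        then show ?thesis using flat[OF _ 3, of 0] by simp
      next
        case False
        then show ?thesis using f by (simp add: U_iff smooth_fns_def)
      qed
      then show ?thesis by simp
    qed
  qed
  then have "S f = S ?r + S (\<lambda>x. ?s (- x))" using dual_add[OF S conjunct1[OF r] s'(1)] by simp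
  then show False using nz r s'(2) by simp
qed

text \<open>If \<open>S\<close> annihilates everything flat on \<open>I\<close>, then its segment stays strictly on the left of any
  point of \<open>(-a;a)\<close> to the right of \<open>I\<close>.\<close>

lemma growth_below:
  assumes I: "closedin (top_of_set (sym_interval a)) I" and x: "x \<in> sym_interval a" "x \<notin> I"
    and left: "\<And>y. y \<in> I \<Longrightarrow> y < x"
  obtains y where "y < x" "\<And>S. S \<in> U_dual a \<omega> c \<Longrightarrow> (\<And>f. f \<in> vanishing_space a \<omega> c I \<Longrightarrow> S f = 0) \<Longrightarrow> growth S \<le> ereal y"
proof -
  have "openin (top_of_set (sym_interval a)) (sym_interval a - I)"
    using I by (simp add: closedin_def)
  then have "open (sym_interval a - I)"
    using openin_open_eq[OF sym_interval_open] by blast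
  then obtain e where e: "0 < e" "ball x e \<subseteq> sym_interval a - I"
    using x unfolding open_contains_ball by blast
  have far: "y < x - e / 2" if y: "y \<in> I" for y
  proof (rule ccontr)
    assume "\<not> y < x - e / 2"
    then have "y \<in> ball x e" using left[OF y] e(1) by (simp add: dist_real_def)
    then show False using e(2) y by blast
  qed
  show ?thesis
  proof (rule that[of "x - e / 4"])
    show "x - e / 4 < x" using e by simp
    fix S assume S: "S \<in> U_dual a \<omega> c" and k: "\<And>f. f \<in> vanishing_space a \<omega> c I \<Longrightarrow> S f = 0"
    show "growth S \<le> ereal (x - e / 4)"
    proof (rule growth_le_of_kills[OF S, of "x - e / 2"])
      fix f assume f: "f \<in> U" "\<And>y. y \<le> x - e / 2 \<Longrightarrow> f y = 0"
      have "(D a ^^ j) f y = 0" if "y \<in> I" for j y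
        by (rule D_eq_0_open[of "{..<x - e / 2}"]) (use far[OF that] f(2) in auto)
      then show "S f = 0" using f(1) by (intro k) (simp add: vanishing_space_def)
    qed (use e in simp)
  qed
qed

lemma vanishing_space_reflect:
  assumes "f \<in> vanishing_space a \<omega> c (uminus ` I)"
  shows "(\<lambda>x. f (- x)) \<in> vanishing_space a \<omega> c I"
proof -
  have f: "f \<in> U" using assms by (simp add: vanishing_space_def)
  show ?thesis using assms U_reflect[OF f] by (auto simp: vanishing_space_def D_reflect[OF f])
qed

lemma closedin_uminus:
  assumes "closedin (top_of_set (sym_interval a)) I"
  shows "closedin (top_of_set (sym_interval a)) (uminus ` I)"
proof -
  obtain T where T: "closed T" "I = sym_interval a \<inter> T" using assms by (auto simp: closedin_closed)
  have "uminus ` I = sym_interval a \<inter> uminus ` T"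
    unfolding T(2) using sym_interval_uminus by (auto simp: image_iff)
  then show ?thesis using closed_negations[OF T(1)] by (auto simp: closedin_closed image_def Collect_mem_eq)
qed

text \<open>The submodule \<open>\<F> W\<^sup>0\<close>.\<close>

abbreviation transforms :: "(real \<Rightarrow> complex) set \<Rightarrow> (complex \<Rightarrow> complex) set" where
  "transforms W \<equiv> fourier_laplace a ` annihilator a \<omega> c W"

text \<open>The intersection of the indicator segment of \<open>\<F> W\<^sup>0\<close> with \<open>(-a;a)\<close>.\<close>

definition segment :: "(real \<Rightarrow> complex) set \<Rightarrow> real set" where
  "segment W = {x. ereal x \<in> indicator_segment (transforms W)} \<inter> sym_interval a"

lemma seg_right_eq: "seg_right (transforms W) = (SUP S\<in>annihilator a \<omega> c W. growth S)"
  by (simp add: seg_right_def image_image indicator_fn_right)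

lemma seg_left_eq:
  "seg_left (transforms W) = - (SUP S\<in>annihilator a \<omega> c W. growth (reflect_dual S))"
  by (simp only: seg_left_def image_image indicator_fn_left)

lemma segment_closed_interval: "rel_closed_interval a (segment W)"
proof -
  let ?l = "seg_left (transforms W)"
  let ?u = "seg_right (transforms W)"
  have eq: "segment W = {x. ?l \<le> ereal x} \<inter> {x. ereal x \<le> ?u} \<inter> sym_interval a"
    by (auto simp: segment_def indicator_segment_def)
  have "closed ({x. ?l \<le> ereal x} \<inter> {x. ereal x \<le> ?u})"
    by (intro closed_Int closed_Collect_le continuous_intros)
  then have "closedin (top_of_set (sym_interval a)) (segment W)"
    unfolding eq by (auto simp: closedin_closed)
  moreover have "is_interval (segment W)"
    unfolding is_interval_1
  proof (intro ballI allI impI, elim conjE)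
    fix x y z assume xy: "x \<in> segment W" "y \<in> segment W" and z: "x \<le> z" "z \<le> y"
    have "ereal x \<le> ereal z" "ereal z \<le> ereal y" using z by auto
    moreover have "z \<in> sym_interval a" using xy sym_interval_convexD[OF _ _ z] unfolding eq by blast
    moreover have "?l \<le> ereal x" "ereal y \<le> ?u" using xy unfolding eq by auto
    ultimately show "z \<in> segment W" unfolding eq using order_trans by blast
  qed
  ultimately show ?thesis by (simp add: rel_closed_interval_def eq)
qed

lemma vanishing_on_segment:
  assumes W: "D_invariant_subspace a \<omega> c W"
  shows "vanishing_space a \<omega> c (segment W) \<subseteq> W"
proof
  fix f assume f: "f \<in> vanishing_space a \<omega> c (segment W)"
  show "f \<in> W"
  proof (rule ccontr)
    assume nf: "f \<notin> W"
    have fU: "f \<in> U" using f by (simp add: vanishing_space_def)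
    obtain S where S: "S \<in> annihilator a \<omega> c W" "S f \<noteq> 0"
    proof (rule annihilator_separates[OF _ _ _ _ fU nf])
      show "W \<subseteq> U" "(\<lambda>x. 0) \<in> W" "closedin (U_top a \<omega> c) W"
        using W by (simp_all add: D_invariant_subspace_def)
      show "(\<lambda>x. \<alpha> * f x + \<beta> * g x) \<in> W" if "f \<in> W" "g \<in> W" for f g \<alpha> \<beta>
        using W that by (simp add: D_invariant_subspace_def)
    qed
    have Sd: "S \<in> U_dual a \<omega> c" using S by (simp add: annihilator_def)
    have "S f = 0"
    proof (rule growth_kills_flat[OF Sd _ _ fU])
      show "growth S \<le> seg_right (transforms W)"
        unfolding seg_right_eq by (rule SUP_upper[OF S(1)])
      show "growth (reflect_dual S) \<le> - seg_left (transforms W)"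
        unfolding seg_left_eq ereal_uminus_uminus by (rule SUP_upper[OF S(1)])
      show "(D a ^^ j) f x = 0"
        if "x \<in> sym_interval a" "seg_left (transforms W) \<le> ereal x"
          "ereal x \<le> seg_right (transforms W)" for x j
        using f that by (simp add: vanishing_space_def segment_def indicator_segment_def)
    qed
    then show False using S(2) by simp
  qed
qed

text \<open>A point of the segment outside \<open>I\<close> has all of \<open>I\<close> on one side, which contradicts
  \<open>growth_below\<close> for \<open>W\<^sup>0\<close> or for its reflection.\<close>

lemma segment_subset:
  assumes I: "rel_closed_interval a I" and W: "vanishing_space a \<omega> c I \<subseteq> W"
  shows "segment W \<subseteq> I"
proof
  fix x assume x: "x \<in> segment W"
  have x_in: "x \<in> sym_interval a" using x by (simp add: segment_def)
  have hi: "ereal x \<le> (SUP S\<in>annihilator a \<omega> c W. growth S)"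
    and lo: "- (SUP S\<in>annihilator a \<omega> c W. growth (reflect_dual S)) \<le> ereal x"
    using x by (simp_all add: segment_def indicator_segment_def seg_left_eq seg_right_eq)
  have cl: "closedin (top_of_set (sym_interval a)) I" using I by (simp add: rel_closed_interval_def)
  have kill: "S f = 0" if "S \<in> annihilator a \<omega> c W" "f \<in> vanishing_space a \<omega> c I" for S f
    using that W by (auto simp: annihilator_def)
  have dual: "S \<in> U_dual a \<omega> c" if "S \<in> annihilator a \<omega> c W" for S
    using that by (simp add: annihilator_def)
  show "x \<in> I"
  proof (rule ccontr)
    assume nx: "x \<notin> I"
    have "(\<forall>y\<in>I. y < x) \<or> (\<forall>y\<in>I. x < y)"
    proof (rule ccontr)
      assume "\<not> ((\<forall>y\<in>I. y < x) \<or> (\<forall>y\<in>I. x < y))"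
      then obtain y z where yz: "y \<in> I" "z \<in> I" "x \<le> y" "z \<le> x" by (auto simp: not_less)
      then have "x \<in> I" using I unfolding rel_closed_interval_def is_interval_1 by blast
      then show False using nx by simp
    qed
    then show False
    proof
      assume left: "\<forall>y\<in>I. y < x"
      obtain y where y: "y < x" "\<And>S. S \<in> U_dual a \<omega> c \<Longrightarrow> (\<And>f. f \<in> vanishing_space a \<omega> c I \<Longrightarrow> S f = 0) \<Longrightarrow> growth S \<le> ereal y"
        using growth_below[OF cl x_in nx] left by metis
      have "(SUP S\<in>annihilator a \<omega> c W. growth S) \<le> ereal y"
        by (rule SUP_least) (use y(2) dual kill in blast)
      then have "ereal x \<le> ereal y" using hi by (rule order_trans[rotated])
      then show False using y(1) by simp
    next
      assume right: "\<forall>y\<in>I. x < y"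
      have nx': "- x \<notin> uminus ` I" using nx by auto
      have left': "\<And>y. y \<in> uminus ` I \<Longrightarrow> y < - x" using right by auto
      obtain y where y: "y < - x" "\<And>S. S \<in> U_dual a \<omega> c \<Longrightarrow>
          (\<And>f. f \<in> vanishing_space a \<omega> c (uminus ` I) \<Longrightarrow> S f = 0) \<Longrightarrow> growth S \<le> ereal y"
        using growth_below[OF closedin_uminus[OF cl] _ nx' left'] x_in sym_interval_uminus by metis
      have "(SUP S\<in>annihilator a \<omega> c W. growth (reflect_dual S)) \<le> ereal y"
      proof (rule SUP_least)
        fix S assume S: "S \<in> annihilator a \<omega> c W"
        show "growth (reflect_dual S) \<le> ereal y"
        proof (rule y(2)[OF reflect_dual[OF dual[OF S]]])
          fix f assume f: "f \<in> vanishing_space a \<omega> c (uminus ` I)"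
          show "reflect_dual S f = 0"
            using kill[OF S vanishing_space_reflect[OF f]] by (simp add: reflect_dual_def)
        qed
      qed
      then have "- ereal y \<le> - (SUP S\<in>annihilator a \<omega> c W. growth (reflect_dual S))"
        by (simp only: ereal_minus_le_minus)
      then have "- ereal y \<le> ereal x" using lo by (rule order_trans)
      then show False using y(1) by simp
    qed
  qed
qed

lemma residual_interval_iff:
  assumes W: "D_invariant_subspace a \<omega> c W"
  shows "is_residual_interval a \<omega> c W I \<longleftrightarrow> I = segment W"
proof
  assume I: "is_residual_interval a \<omega> c W I"
  then have "segment W \<subseteq> I" by (intro segment_subset) (auto simp: is_residual_interval_def)
  moreover have "\<not> segment W \<subset> I"
  proof
    assume "segment W \<subset> I"
    then have "vanishing_space a \<omega> c (segment W) - W \<noteq> {}"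
      using I segment_closed_interval by (simp add: is_residual_interval_def)
    then show False using vanishing_on_segment[OF W] by blast
  qed
  ultimately show "I = segment W" by blast
next
  have "vanishing_space a \<omega> c I' - W \<noteq> {}" if "rel_closed_interval a I'" "I' \<subset> segment W" for I'
    using segment_subset[OF that(1)] that(2) by blast
  then show "is_residual_interval a \<omega> c W I" if "I = segment W"
    using that segment_closed_interval vanishing_on_segment[OF W] by (auto simp: is_residual_interval_def)
qed

end

theorem proposition2p3:
  fixes \<omega> :: "real \<Rightarrow> real" and a :: ereal and c :: "nat \<Rightarrow> real"
    and W :: "(real \<Rightarrow> complex) set" and J :: "(complex \<Rightarrow> complex) set"
  assumes "is_weight \<omega>"
    and "0 < a"
    and "exhausting a c"
    and "D_invariant_subspace a \<omega> c W"
    and "J = fourier_laplace a ` annihilator a \<omega> c W"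
  shows "(\<exists>!I. is_residual_interval a \<omega> c W I) \<and>
         residual_interval a \<omega> c W = {x. ereal x \<in> indicator_segment J} \<inter> sym_interval a"
proof -
  interpret ultra_space \<omega> a c by unfold_locales (rule assms)+
  have "is_residual_interval a \<omega> c W I \<longleftrightarrow> I = segment W" for I
    by (rule residual_interval_iff[OF assms(4)])
  then show ?thesis by (simp add: residual_interval_def segment_def assms(5))
qed

end
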